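(* Let $E$ be an arbitrary directed graph and let $K$ be any field. The ideal $I(P_{ppi})$ is the largest purely infinite ideal of $L_K(E)$; that is, $I(P_{ppi})$ is purely infinite and contains every purely infinite two-sided ideal of $L_K(E)$.
   Context: A directed graph $E=(E^0,E^1,s,r)$ consists of arbitrary sets $E^0$ (vertices), $E^1$ (edges) and maps $s,r:E^1\to E^0$ (source, range). A vertex $v$ is a sink if $s^{-1}(v)=\emptyset$, an infinite emitter if $s^{-1}(v)$ is infinite, and regular otherwise. A path is a vertex (length $0$) or a finite sequence of edges $e_1\cdots e_n$ with $r(e_i)=s(e_{i+1})$. Write $u\ge v$ if there is a path from $u$ to $v$, and $T(v)=\{u\in E^0: v\ge u\}$. A set $H\subseteq E^0$ is hereditary if $v\in H$, $v\ge w$ imply $w\in H$; it is saturated if for every regular vertex $v$, $r(s^{-1}(v))\subseteq H$ implies $v\in H$. $\overline{X}$ denotes the smallest hereditary and saturated subset of $E^0$ containing $X$. ${\rm CSP}(w)$ is the set of closed simple paths based at $w$, i.e. paths $e_1\cdots e_n$, $n>0$, with $s(e_1)=r(e_n)=w$ and $s(e_i)\ne w$ for $i\ge2$. A vertex $v$ is properly infinite if there exist vertices $w_1,\dots,w_n\in T(v)$ with $|{\rm CSP}(w_i)|\ge 2$ for all $i$ and $v\in\overline{\{w_1,\dots,w_n\}}$. $P_{pi}$ is the set of properly infinite vertices. For a hereditary saturated $H\subseteq E^0$, the set of breaking vertices of $H$ is $B_H=\{v\in E^0\setminus H: v \text{ is an infinite emitter and } 0<|s^{-1}(v)\cap r^{-1}(E^0\setminus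 H)|<\infty\}$; a breaking vertex is a vertex lying in $B_H$ for some hereditary saturated $H$. Define $P_{ppi}=\{v\in E^0: T(v)\subseteq P_{pi}\text{ and }T(v)\text{ has no breaking vertices}\}$. The Leavitt path algebra $L_K(E)$ is the $K$-algebra generated by $\{v: v\in E^0\}\cup\{e,e^*: e\in E^1\}$ subject to: $vw=\delta_{v,w}v$ for $v,w\in E^0$; $s(e)e=e\,r(e)=e$ and $r(e)e^*=e^*s(e)=e^*$ for $e\in E^1$; $e^*e'=\delta_{e,e'}r(e)$ for $e,e'\in E^1$; $v=\sum_{s(e)=v}ee^*$ for every regular vertex $v$. $I(X)$ is the two-sided ideal generated by $X$. A ring $R$ (not necessarily unital) is purely infinite if (1) no quotient of $R$ is a division ring, and (2) whenever $a\in R$ and $b\in RaR$, there are $x,y\in R$ with $b=xay$. An ideal is purely infinite if it is so as a ring. *)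

theory Defs
  imports
    "HOL-Algebra.QuotRing"
    "HOL-Algebra.Module"
    "HOL-Algebra.Generated_Groups"
    "HOL-Library.Poly_Mapping"
    "Graph_Theory.Arc_Walk"
begin

section \<open>Rings without unit\<close>

text \<open>
  Rings are carried by the \<open>ring\<close> records of HOL-Algebra, so that cosets and the
  quotient \<open>R Quot J\<close> are the library's. The field \<open>one\<close> of such a record has no meaning here
  and its value is irrelevant: a ring has a unit when some element \<open>u\<close>, put into this field,
  makes it a \<open>ring\<close> in the sense of HOL-Algebra.
\<close>

locale nonunital_ring = abelian_group R for R (structure) +
  assumes mult_closed: "\<lbrakk>x \<in> carrier R; y \<in> carrier R\<rbrakk> \<Longrightarrow> x \<otimes> y \<in> carrier R"
    and mult_assoc: "\<lbrakk>x \<in> carrier R; y \<in> carrier R; z \<in> carrier R\<rbrakk>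
      \<Longrightarrow> (x \<otimes> y) \<otimes> z = x \<otimes> (y \<otimes> z)"
    and distrib_right: "\<lbrakk>x \<in> carrier R; y \<in> carrier R; z \<in> carrier R\<rbrakk>
      \<Longrightarrow> (x \<oplus> y) \<otimes> z = x \<otimes> z \<oplus> y \<otimes> z"
    and distrib_left: "\<lbrakk>x \<in> carrier R; y \<in> carrier R; z \<in> carrier R\<rbrakk>
      \<Longrightarrow> z \<otimes> (x \<oplus> y) = z \<otimes> x \<oplus> z \<otimes> y"

locale two_sided_ideal = additive_subgroup J R + nonunital_ring R for J and R (structure) +
  assumes mult_left_closed: "\<lbrakk>a \<in> J; x \<in> carrier R\<rbrakk> \<Longrightarrow> x \<otimes> a \<in> J"
    and mult_right_closed: "\<lbrakk>a \<in> J; x \<in> carrier R\<rbrakk> \<Longrightarrow> a \<otimes> x \<in> J"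

definition generated_ideal :: "('a, 'm) ring_scheme \<Rightarrow> 'a set \<Rightarrow> 'a set" where
  "generated_ideal R X = \<Inter>{J. two_sided_ideal J R \<and> X \<subseteq> J}"

definition is_division_ring :: "('a, 'm) ring_scheme \<Rightarrow> bool" where
  "is_division_ring R \<longleftrightarrow>
     (\<exists>u. ring (R\<lparr>one := u\<rparr>) \<and> Units (R\<lparr>one := u\<rparr>) = carrier R - {\<zero>\<^bsub>R\<^esub>})"

text \<open>The set \<open>RaR\<close> of all finite sums of products \<open>x a y\<close>.\<close>

definition principal_products :: "('a, 'm) ring_scheme \<Rightarrow> 'a \<Rightarrow> 'a set" where
  "principal_products R a =
     generate (add_monoid R) {x \<otimes>\<^bsub>R\<^esub> a \<otimes>\<^bsub>R\<^esub> y | x y. x \<in> carrier R \<and> y \<in> carrier R}"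

locale purely_infinite_ring = nonunital_ring R for R (structure) +
  assumes no_division_ring_quotient: "two_sided_ideal J R \<Longrightarrow> \<not> is_division_ring (R Quot J)"
    and purely_infinite: "\<lbrakk>a \<in> carrier R; b \<in> principal_products R a\<rbrakk>
      \<Longrightarrow> \<exists>x \<in> carrier R. \<exists>y \<in> carrier R. b = x \<otimes> a \<otimes> y"

definition purely_infinite_ideal :: "'a set \<Rightarrow> ('a, 'm) ring_scheme \<Rightarrow> bool" where
  "purely_infinite_ideal J R \<longleftrightarrow>
     two_sided_ideal J R \<and> purely_infinite_ring (R\<lparr>carrier := J\<rparr>)"


section \<open>Algebras given by generators and relations\<close>

datatype 'g free_word = Word (letters: "'g list")

instantiation free_word :: (type) monoid_add
begin

definition zero_free_word :: "'a free_word" where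
  "0 = Word []"

definition plus_free_word :: "'a free_word \<Rightarrow> 'a free_word \<Rightarrow> 'a free_word" where
  "u + v = Word (letters u @ letters v)"

instance
  by standard (simp_all add: zero_free_word_def plus_free_word_def)

end

text \<open>
  The free algebra without unit on \<open>X\<close> lies in the monoid algebra of words, whose product
  (convolution) is the multiplication of type \<open>\<Rightarrow>\<^sub>0\<close>: it consists of the linear combinations of
  nonempty words in the letters \<open>X\<close>. Scalars act through multiples of the empty word.
\<close>

definition free_algebra :: "'g set \<Rightarrow> ('k::field, 'g free_word \<Rightarrow>\<^sub>0 'k) module" where
  "free_algebra X =
     \<lparr>carrier = {p. \<forall>w \<in> Poly_Mapping.keys p. letters w \<noteq> [] \<and> set (letters w) \<subseteq> X},
      mult = (*), one = undefined, zero = 0, add = (+),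
      smult = (\<lambda>c p. Poly_Mapping.single 0 c * p)\<rparr>"

definition generated_algebra_ideal :: "('k, 'a, 'm) module_scheme \<Rightarrow> 'a set \<Rightarrow> 'a set" where
  "generated_algebra_ideal A X =
     \<Inter>{J. two_sided_ideal J A \<and> (\<forall>c. \<forall>x \<in> J. c \<odot>\<^bsub>A\<^esub> x \<in> J) \<and> X \<subseteq> J}"

definition quotient_algebra ::
    "('k, 'a, 'm) module_scheme \<Rightarrow> 'a set \<Rightarrow> ('k, 'a set) module" where
  "quotient_algebra A N =
     ring.extend (A Quot N)
       (module.fields (\<lambda>c C. \<Union>x \<in> C. N +>\<^bsub>A\<^esub> (c \<odot>\<^bsub>A\<^esub> x)))"


section \<open>Leavitt path algebras\<close>

text \<open>
  In \<^term>\<open>G :: ('v, 'e) pre_digraph\<close> the source and range maps are \<^term>\<open>tail G\<close> and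
  \<^term>\<open>head G\<close>. The set of edges with source \<open>v\<close> is \<^term>\<open>out_arcs G v\<close>.
\<close>

definition regular_vertex :: "('v, 'e) pre_digraph \<Rightarrow> 'v \<Rightarrow> bool" where
  "regular_vertex G v \<longleftrightarrow> v \<in> verts G \<and> out_arcs G v \<noteq> {} \<and> finite (out_arcs G v)"

definition infinite_emitter :: "('v, 'e) pre_digraph \<Rightarrow> 'v \<Rightarrow> bool" where
  "infinite_emitter G v \<longleftrightarrow> v \<in> verts G \<and> infinite (out_arcs G v)"

text \<open>\<open>Ghost e\<close> stands for the generator written \<open>e\<^sup>*\<close>.\<close>

datatype ('v, 'e) lpa_letter = Vertex 'v | Edge 'e | Ghost 'e

type_synonym ('v, 'e, 'k) lpa_free = "('v, 'e) lpa_letter free_word \<Rightarrow>\<^sub>0 'k"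

definition lpa_letters :: "('v, 'e) pre_digraph \<Rightarrow> ('v, 'e) lpa_letter set" where
  "lpa_letters G = Vertex ` verts G \<union> Edge ` arcs G \<union> Ghost ` arcs G"

abbreviation letter :: "('v, 'e) lpa_letter \<Rightarrow> ('v, 'e, 'k::field) lpa_free" where
  "letter g \<equiv> Poly_Mapping.single (Word [g]) 1"

text \<open>Each defining relation \<open>p = q\<close> is represented by the element \<open>p - q\<close>.\<close>

definition lpa_relations :: "('v, 'e) pre_digraph \<Rightarrow> ('v, 'e, 'k::field) lpa_free set" where
  "lpa_relations G =
     {letter (Vertex v) * letter (Vertex w) - (if v = w then letter (Vertex v) else 0)
        | v w. v \<in> verts G \<and> w \<in> verts G} \<union>
     {letter (Vertex (tail G e)) * letter (Edge e) - letter (Edge e) | e. e \<in> arcs G} \<union>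
     {letter (Edge e) * letter (Vertex (head G e)) - letter (Edge e) | e. e \<in> arcs G} \<union>
     {letter (Vertex (head G e)) * letter (Ghost e) - letter (Ghost e) | e. e \<in> arcs G} \<union>
     {letter (Ghost e) * letter (Vertex (tail G e)) - letter (Ghost e) | e. e \<in> arcs G} \<union>
     {letter (Ghost e) * letter (Edge f) - (if e = f then letter (Vertex (head G e)) else 0)
        | e f. e \<in> arcs G \<and> f \<in> arcs G} \<union>
     {letter (Vertex v) - (\<Sum>e \<in> out_arcs G v. letter (Edge e) * letter (Ghost e))
        | v. regular_vertex G v}"

definition lpa_relation_ideal :: "('v, 'e) pre_digraph \<Rightarrow> ('v, 'e, 'k::field) lpa_free set" where
  "lpa_relation_ideal G =
     generated_algebra_ideal (free_algebra (lpa_letters G)) (lpa_relations G)"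

text \<open>The field is the type \<^typ>\<open>'k\<close>; the argument \<open>K\<close> only serves to name it.\<close>

definition leavitt_path_algebra ::
    "'k::field itself \<Rightarrow> ('v, 'e) pre_digraph \<Rightarrow> ('k, ('v, 'e, 'k) lpa_free set) module" where
  "leavitt_path_algebra K G =
     quotient_algebra (free_algebra (lpa_letters G)) (lpa_relation_ideal G)"

definition lpa_vertex ::
    "'k::field itself \<Rightarrow> ('v, 'e) pre_digraph \<Rightarrow> 'v \<Rightarrow> ('v, 'e, 'k) lpa_free set" where
  "lpa_vertex K G v =
     lpa_relation_ideal G +>\<^bsub>free_algebra (lpa_letters G) :: ('k, ('v, 'e, 'k) lpa_free) module\<^esub>
       letter (Vertex v)"

definition vertex_ideal ::
    "'k::field itself \<Rightarrow> ('v, 'e) pre_digraph \<Rightarrow> 'v set \<Rightarrow> ('v, 'e, 'k) lpa_free set set" where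
  "vertex_ideal K G X = generated_ideal (leavitt_path_algebra K G) (lpa_vertex K G ` X)"


section \<open>Properly infinite vertices\<close>

definition descendants :: "('v, 'e) pre_digraph \<Rightarrow> 'v \<Rightarrow> 'v set" where
  "descendants G v = {u \<in> verts G. \<exists>p. pre_digraph.awalk G v p u}"

definition hereditary :: "('v, 'e) pre_digraph \<Rightarrow> 'v set \<Rightarrow> bool" where
  "hereditary G H \<longleftrightarrow> H \<subseteq> verts G \<and> (\<forall>v \<in> H. descendants G v \<subseteq> H)"

definition saturated :: "('v, 'e) pre_digraph \<Rightarrow> 'v set \<Rightarrow> bool" where
  "saturated G H \<longleftrightarrow>
     H \<subseteq> verts G \<and> (\<forall>v. regular_vertex G v \<longrightarrow> head G ` out_arcs G v \<subseteq> H \<longrightarrow> v \<in> H)"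

definition hereditary_saturated_closure :: "('v, 'e) pre_digraph \<Rightarrow> 'v set \<Rightarrow> 'v set" where
  "hereditary_saturated_closure G X = \<Inter>{H. hereditary G H \<and> saturated G H \<and> X \<subseteq> H}"

definition closed_simple_paths :: "('v, 'e) pre_digraph \<Rightarrow> 'v \<Rightarrow> 'e list set" where
  "closed_simple_paths G w =
     {p. pre_digraph.awalk G w p w \<and> p \<noteq> [] \<and> (\<forall>e \<in> set (tl p). tail G e \<noteq> w)}"

text \<open>The cardinality of an infinite set is \<open>0\<close> in HOL, whence the first disjunct.\<close>

definition properly_infinite_vertices :: "('v, 'e) pre_digraph \<Rightarrow> 'v set" where
  "properly_infinite_vertices G =
     {v \<in> verts G. \<exists>W. finite W \<and> W \<subseteq> descendants G v \<and>
        (\<forall>w \<in> W. infinite (closed_simple_paths G w) \<or> card (closed_simple_paths G w) \<ge> 2) \<and>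
        v \<in> hereditary_saturated_closure G W}"

definition breaking_vertices_of :: "('v, 'e) pre_digraph \<Rightarrow> 'v set \<Rightarrow> 'v set" where
  "breaking_vertices_of G H =
     {v \<in> verts G - H. infinite_emitter G v \<and>
        {e \<in> out_arcs G v. head G e \<notin> H} \<noteq> {} \<and> finite {e \<in> out_arcs G v. head G e \<notin> H}}"

definition breaking_vertices :: "('v, 'e) pre_digraph \<Rightarrow> 'v set" where
  "breaking_vertices G =
     \<Union>{breaking_vertices_of G H | H. hereditary G H \<and> saturated G H}"

definition P_ppi :: "('v, 'e) pre_digraph \<Rightarrow> 'v set" where
  "P_ppi G =
     {v \<in> verts G. descendants G v \<subseteq> properly_infinite_vertices G \<and>
        descendants G v \<inter> breaking_vertices G = {}}"

end

theory Submission
  imports Defs "HOL-Library.Sublist" "HOL-Library.Function_Algebras"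
    "HOL-Computational_Algebra.Polynomial_Factorial" "Jordan_Normal_Form.Determinant"
begin

text \<open>
  For \<open>H\<close> hereditary and saturated, every element outside \<open>I(H)\<close> can be multiplied on both sides into
  one of three shapes modulo \<open>I(H)\<close>: a vertex \<open>v \<notin> H\<close>, the idempotent \<open>v\<^sup>H = v - \<Sum> e e\<^sup>*\<close> of a singular vertex
  with finitely many arcs leading outside \<open>H\<close>, or a nonzero polynomial in a cycle without exits outside \<open>H\<close>.

  For \<open>a \<in> I(P_ppi)\<close>, the set \<open>K\<close> of all \<open>x\<close> with \<open>a \<oplus> x \<lesssim> a\<close> is an ideal. If \<open>a \<notin> K\<close>, the reduction modulo the
  vertices of \<open>K\<close> yields a vertex \<open>w \<notin> K\<close> on two closed simple paths such that \<open>w\<close> is subordinate to \<open>a\<close>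
  modulo \<open>K\<close>. As \<open>w \<oplus> w \<lesssim> w\<close>, the relation \<open>a \<oplus> w \<lesssim> a\<close> holds modulo \<open>K\<close> and lifts, so \<open>w \<in> K\<close>, which is absurd. Hence
  \<open>a \<oplus> \<dots> \<oplus> a \<lesssim> a\<close>, and every sum of products \<open>x a y\<close> is a single such product.

  Conversely, let \<open>J\<close> be purely infinite. An element \<open>x \<in> J\<close> of one of the three shapes that comes from an obstruction
  (a vertex without two closed simple paths below it, a breaking vertex, a polynomial in a cycle)
  acts as an invertible scalar on a finite dimensional space of functions on boundary paths,
  while any arc entering from elsewhere yields \<open>x \<oplus> x \<lesssim> x\<close>; determinants exclude this. If no such arc exists, \<open>J\<close>
  has a field as a quotient. So \<open>J\<close> is generated by vertices, and these lie in \<open>P_ppi\<close>.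

  The algebra is embedded into the additive endomorphisms of the free algebra, so that
  calculations take place in a type of class \<open>ring\<close>.
\<close>

section \<open>Absorption in rings\<close>

text \<open>The algebra may lack a unit, whereas the witnesses of a \<oplus> x \<lesssim> a contain
  1. They therefore range over multipliers, and the outer factors x, y of a sum of products x a y
  bring the result back into the ideal. Of the three shapes only vertices survive in the first half:
  a gap below a properly infinite vertex would come from a breaking vertex, and a cycle without
  exits cannot lead to two closed simple paths. In the second half, an arc into the vertex from
  elsewhere doubles the obstruction; without one, all other vertices can be sent to 0. For a
  polynomial f in a loop, the quotient must be a field in which f is invertible. A factor of X f - 1
  provides it over every K, since X becomes the inverse of f. Doubling instead needs an invertible
  scalar. Over a finite field f may vanish at all points, so the cycle gets an indeterminate as
  weight, in the fraction field of K[X]. Monomials are nowhere compared by independence: that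
  something does not vanish is read off from a representation.\<close>

locale unital_subring =
  fixes M :: "'r::{ring,monoid_mult} set"
  assumes one_mem: "1 \<in> M"
    and add_mem: "x \<in> M \<Longrightarrow> y \<in> M \<Longrightarrow> x + y \<in> M"
    and uminus_mem: "x \<in> M \<Longrightarrow> - x \<in> M"
    and mult_mem: "x \<in> M \<Longrightarrow> y \<in> M \<Longrightarrow> x * y \<in> M"
begin

lemma zero_mem: "0 \<in> M"
  using add_mem[OF one_mem uminus_mem[OF one_mem]] by simp

lemma diff_mem: "x \<in> M \<Longrightarrow> y \<in> M \<Longrightarrow> x - y \<in> M"
  using add_mem[of x "- y"] uminus_mem by simp

text \<open>\<open>x \<in> absorbed a\<close> is the relation \<open>a \<oplus> x \<lesssim> a\<close> between diagonal matrices.\<close>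

definition absorbed :: "'r \<Rightarrow> 'r set" where
  "absorbed a = {x. \<exists>\<alpha>\<in>M. \<exists>\<beta>\<in>M. \<exists>\<gamma>\<in>M. \<exists>\<delta>\<in>M.
     \<alpha> * a * \<beta> = a \<and> \<gamma> * a * \<delta> = x \<and> \<alpha> * a * \<delta> = 0 \<and> \<gamma> * a * \<beta> = 0}"

lemma absorbedI:
  assumes "\<alpha> \<in> M" "\<beta> \<in> M" "\<gamma> \<in> M" "\<delta> \<in> M" "\<alpha> * a * \<beta> = a" "\<gamma> * a * \<delta> = x"
    "\<alpha> * a * \<delta> = 0" "\<gamma> * a * \<beta> = 0"
  shows "x \<in> absorbed a"
  using assms unfolding absorbed_def by blast

lemma assoc3: "x * y * z = (w::'r) \<Longrightarrow> x * (y * z) = w"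
  by (simp add: mult.assoc)

lemma assoc4: "x * y * z = (w::'r) \<Longrightarrow> x * (y * (z * t)) = w * t"
  by (metis mult.assoc)

lemma assoc2: "x * y = (w::'r) \<Longrightarrow> x * (y * t) = w * t"
  by (metis mult.assoc)

text \<open>The witnesses for the last element return an intact copy of \<open>a\<close>, from which
  the earlier witnesses split off the other elements. As all cross products vanish, finitely many
  elements are split off simultaneously.\<close>

lemma absorbed_family:
  fixes m :: "nat \<Rightarrow> 'r"
  assumes "\<forall>i<n. m i \<in> absorbed a"
  shows "\<exists>\<alpha>\<in>M. \<exists>\<beta>\<in>M. \<exists>\<gamma> \<delta>. (\<forall>i<n. \<gamma> i \<in> M \<and> \<delta> i \<in> M) \<and> \<alpha> * a * \<beta> = a \<and>
    (\<forall>i<n. \<alpha> * a * \<delta> i = 0 \<and> \<gamma> i * a * \<beta> = 0) \<and>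
    (\<forall>i<n. \<forall>j<n. \<gamma> i * a * \<delta> j = (if i = j then m i else 0))"
  using assms
proof (induction n)
  case 0
  show ?case using one_mem by (intro bexI[of _ 1] exI[of _ "\<lambda>_. 0"]) auto
next
  case (Suc n)
  from Suc.IH Suc.prems obtain \<alpha> \<beta> \<gamma> \<delta> where M: "\<alpha> \<in> M" "\<beta> \<in> M" "\<And>i. i < n \<Longrightarrow> \<gamma> i \<in> M \<and> \<delta> i \<in> M"
    and e: "\<alpha> * a * \<beta> = a" "\<And>i. i < n \<Longrightarrow> \<alpha> * a * \<delta> i = 0" "\<And>i. i < n \<Longrightarrow> \<gamma> i * a * \<beta> = 0"
    "\<And>i j. i < n \<Longrightarrow> j < n \<Longrightarrow> \<gamma> i * a * \<delta> j = (if i = j then m i else 0)"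
    by (metis less_SucI)

  from Suc.prems obtain \<alpha>' \<beta>' \<gamma>' \<delta>' where M': "\<alpha>' \<in> M" "\<beta>' \<in> M" "\<gamma>' \<in> M" "\<delta>' \<in> M"
    and e': "\<alpha>' * a * \<beta>' = a" "\<gamma>' * a * \<delta>' = m n" "\<alpha>' * a * \<delta>' = 0" "\<gamma>' * a * \<beta>' = 0"
    unfolding absorbed_def by blast
  note r = e[THEN assoc3] e'[THEN assoc3] e'[THEN assoc4]
  show ?case
  proof (rule bexI[of _ "\<alpha> * \<alpha>'"], rule bexI[of _ "\<beta>' * \<beta>"],
      rule exI[of _ "\<lambda>i. if i < n then \<gamma> i * \<alpha>' else \<gamma>'"],
      rule exI[of _ "\<lambda>i. if i < n then \<beta>' * \<delta> i else \<delta>'"], intro conjI allI impI)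
  qed (use M M' in \<open>auto simp: mult_mem mult.assoc r less_Suc_eq\<close>)
qed

lemma zero_absorbed: "0 \<in> absorbed a"
  using one_mem zero_mem by (intro absorbedI[of 1 1 0 0]) auto

lemma mult_absorbed:
  assumes "x \<in> absorbed a" "r \<in> M" "s \<in> M"
  shows "r * x * s \<in> absorbed a"
proof -
  from assms(1) obtain \<alpha> \<beta> \<gamma> \<delta> where M: "\<alpha> \<in> M" "\<beta> \<in> M" "\<gamma> \<in> M" "\<delta> \<in> M"
    and e: "\<alpha> * a * \<beta> = a" "\<gamma> * a * \<delta> = x" "\<alpha> * a * \<delta> = 0" "\<gamma> * a * \<beta> = 0"
    unfolding absorbed_def by blast
  show ?thesis
    by (rule absorbedI[of \<alpha> \<beta> "r * \<gamma>" "\<delta> * s"])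
      (use M assms in \<open>auto simp: mult.assoc e[THEN assoc3] e[THEN assoc4] mult_mem\<close>)
qed

text \<open>In a family of length two the cross products vanish, so adding the two rows and the two
  columns leaves just the diagonal products.\<close>

lemma add_absorbed:
  assumes "x \<in> absorbed a" "y \<in> absorbed a"
  shows "x + y \<in> absorbed a"
proof -
  define m where "m = (\<lambda>i::nat. if i = 0 then x else y)"
  have "\<forall>i<2. m i \<in> absorbed a" using assms by (simp add: m_def)
  from absorbed_family[of 2 m a, OF this]
  obtain \<alpha> \<beta> \<gamma> \<delta> where M: "\<alpha> \<in> M" "\<beta> \<in> M" "\<And>i. i < 2 \<Longrightarrow> \<gamma> i \<in> M \<and> \<delta> i \<in> M"
    and e: "\<alpha> * a * \<beta> = a" "\<And>i. i < 2 \<Longrightarrow> \<alpha> * a * \<delta> i = 0" "\<And>i. i < 2 \<Longrightarrow> \<gamma> i * a * \<beta> = 0"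
    "\<And>i j. i < 2 \<Longrightarrow> j < 2 \<Longrightarrow> \<gamma> i * a * \<delta> j = (if i = j then m i else 0)"
    by metis
  show ?thesis
  proof (rule absorbedI[of \<alpha> \<beta> "\<gamma> 0 + \<gamma> 1" "\<delta> 0 + \<delta> 1"])
  qed (use M e in \<open>auto simp: m_def distrib_left distrib_right add_mem\<close>)
qed

lemma uminus_absorbed:
  assumes "x \<in> absorbed a" shows "- x \<in> absorbed a"
  using mult_absorbed[OF assms uminus_mem[OF one_mem] one_mem] by simp

text \<open>The relation \<open>a \<oplus> x \<lesssim> a\<close> lifts from the quotient modulo \<open>absorbed a\<close>: the four error
  terms can be absorbed into \<open>a\<close> along with \<open>a\<close> itself.\<close>

lemma absorbed_lift:
  assumes M: "\<alpha> \<in> M" "\<beta> \<in> M" "\<gamma> \<in> M" "\<delta> \<in> M"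
    and K: "a - \<alpha> * a * \<beta> \<in> absorbed a" "x - \<gamma> * a * \<delta> \<in> absorbed a"
      "\<alpha> * a * \<delta> \<in> absorbed a" "\<gamma> * a * \<beta> \<in> absorbed a"
  shows "x \<in> absorbed a"
proof -
  define m where "m = (\<lambda>i::nat. if i = 0 then a - \<alpha> * a * \<beta> else if i = 1 then x - \<gamma> * a * \<delta>
     else if i = 2 then - (\<alpha> * a * \<delta>) else - (\<gamma> * a * \<beta>))"
  have "\<forall>i<4. m i \<in> absorbed a"
    using K by (auto simp: m_def uminus_absorbed)
  from absorbed_family[of 4 m a, OF this]
  obtain \<alpha>' \<beta>' \<gamma>' \<delta>' where M': "\<alpha>' \<in> M" "\<beta>' \<in> M" "\<And>i. i < 4 \<Longrightarrow> \<gamma>' i \<in> M \<and> \<delta>' i \<in> M"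
    and e: "\<alpha>' * a * \<beta>' = a" "\<And>i. i < 4 \<Longrightarrow> \<alpha>' * a * \<delta>' i = 0" "\<And>i. i < 4 \<Longrightarrow> \<gamma>' i * a * \<beta>' = 0"
    "\<And>i j. i < 4 \<Longrightarrow> j < 4 \<Longrightarrow> \<gamma>' i * a * \<delta>' j = (if i = j then m i else 0)"
    by metis
  note r = e[THEN assoc3] e[THEN assoc4]
  \<comment> \<open>Corrections 0 and 1 act on the diagonal, correction 2 on the first row and
    second column, correction 3 on the second row and first column. Each index meets itself in
    exactly one of the four entries.\<close>
  show ?thesis
  proof (rule absorbedI[of "\<alpha> * \<alpha>' + \<gamma>' 0 + \<gamma>' 2" "\<beta>' * \<beta> + \<delta>' 0 + \<delta>' 3"
      "\<gamma> * \<alpha>' + \<gamma>' 1 + \<gamma>' 3" "\<beta>' * \<delta> + \<delta>' 1 + \<delta>' 2"])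
  qed (use M M' in \<open>auto simp: algebra_simps r m_def add_mem mult_mem\<close>)
qed

text \<open>Modulo \<open>absorbed a\<close>, the product \<open>a * \<beta> * \<alpha>\<close> is
  idempotent and cuts a copy of \<open>w\<close> out of \<open>a\<close>. The partial isometries
  \<open>c\<close> and \<open>d\<close> put two orthogonal copies of \<open>w\<close> into
  \<open>w\<close>: one restores the copy that was cut out, the other is the new summand.\<close>

lemma absorbed_infinite_idempotent:
  assumes M: "a \<in> M" "w \<in> M" "c \<in> M" "c' \<in> M" "d \<in> M" "d' \<in> M" "\<alpha> \<in> M" "\<beta> \<in> M"
    and cd: "c' * c = w" "d' * d = w" "c' * d = 0" "d' * c = 0"
    and w: "w * c = c" "c' * w = c'" "w * d = d" "d' * w = d'" "w * \<alpha> = \<alpha>" "\<beta> * w = \<beta>"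
    and K: "\<alpha> * a * \<beta> - w \<in> absorbed a"
  shows "w \<in> absorbed a"
proof -
  define \<kappa> where "\<kappa> = \<alpha> * a * \<beta> - w"
  have k: "\<alpha> * a * \<beta> = w + \<kappa>" by (simp add: \<kappa>_def)
  have KI: "r * \<kappa> * s \<in> absorbed a" if "r \<in> M" "s \<in> M" for r s
    using mult_absorbed[OF K that] by (simp add: \<kappa>_def)
  note r = cd cd[THEN assoc2] w w[THEN assoc2] k[THEN assoc3] k[THEN assoc4]
  \<comment> \<open>Up to the error \<open>\<kappa>\<close>, \<open>?\<alpha>\<close> is the
    identity on the complement of the copy of \<open>w\<close> and acts through \<open>c'\<close> on
    the copy; \<open>?\<beta>\<close> does the same on the other side with \<open>c\<close>.\<close>
  let ?\<alpha> = "1 - a * \<beta> * \<alpha> + a * \<beta> * c' * \<alpha>" and ?\<beta> = "1 - \<beta> * \<alpha> * a + \<beta> * c * \<alpha> * a"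
    and ?\<gamma> = "d' * \<alpha>" and ?\<delta> = "\<beta> * d"
  note Ms = M one_mem zero_mem mult_mem add_mem diff_mem uminus_mem
  show ?thesis
  proof (rule absorbed_lift[of ?\<alpha> ?\<beta> ?\<gamma> ?\<delta>])
    have "a - ?\<alpha> * a * ?\<beta> = (- (a * \<beta> * (1 - c'))) * \<kappa> * ((1 - c) * \<alpha> * a)"
      by (simp add: algebra_simps r)
    then show "a - ?\<alpha> * a * ?\<beta> \<in> absorbed a" by (simp only:) (intro KI Ms)
    have "w - ?\<gamma> * a * ?\<delta> = (- d') * \<kappa> * d" by (simp add: algebra_simps r)
    then show "w - ?\<gamma> * a * ?\<delta> \<in> absorbed a" by (simp only:) (intro KI Ms)
    have "?\<alpha> * a * ?\<delta> = (- (a * \<beta> * (1 - c'))) * \<kappa> * d" by (simp add: algebra_simps r)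
    then show "?\<alpha> * a * ?\<delta> \<in> absorbed a" by (simp only:) (intro KI Ms)
    have "?\<gamma> * a * ?\<beta> = (- d') * \<kappa> * ((1 - c) * \<alpha> * a)" by (simp add: algebra_simps r)
    then show "?\<gamma> * a * ?\<beta> \<in> absorbed a" by (simp only:) (intro KI Ms)
  qed (intro Ms)+
qed

end

section \<open>Paths in directed graphs\<close>

context wf_digraph
begin

lemma awalk_append_ex: "awalk u (p @ q) v \<longleftrightarrow> (\<exists>x. awalk u p x \<and> awalk x q v)"
  by (metis awalk_appendI awalk_append_iff)

lemma awalk_range_unique: "awalk u p v \<Longrightarrow> awalk u p v' \<Longrightarrow> v = v'"
  by (metis awalk_ends)

lemma descendants_iff: "v \<in> descendants G u \<longleftrightarrow> (\<exists>p. awalk u p v)"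
  unfolding descendants_def by (auto intro: awalk_last_in_verts)

lemma self_descendant: "u \<in> verts G \<Longrightarrow> u \<in> descendants G u"
  using awalk_Nil_iff descendants_iff by blast

lemma descendants_trans: "v \<in> descendants G u \<Longrightarrow> w \<in> descendants G v \<Longrightarrow> w \<in> descendants G u"
  unfolding descendants_iff using awalk_appendI by blast

lemma hereditary_awalk: "hereditary G H \<Longrightarrow> v \<in> H \<Longrightarrow> awalk v p w \<Longrightarrow> w \<in> H"
  unfolding hereditary_def using descendants_iff by blast

lemma hereditary_arc: "hereditary G H \<Longrightarrow> e \<in> arcs G \<Longrightarrow> tail G e \<in> H \<Longrightarrow> head G e \<in> H"
  using hereditary_awalk[OF _ _ arc_implies_awalk] by blast

lemma hereditary_sub: "hereditary G H \<Longrightarrow> H \<subseteq> verts G"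
  by (simp add: hereditary_def)

lemma hereditaryI:
  assumes "H \<subseteq> verts G" "\<And>e. e \<in> arcs G \<Longrightarrow> tail G e \<in> H \<Longrightarrow> head G e \<in> H"
  shows "hereditary G H"
proof -
  have "awalk v p w \<Longrightarrow> v \<in> H \<Longrightarrow> w \<in> H" for v p w
    by (induction p arbitrary: v) (auto simp: awalk_Cons_iff awalk_Nil_iff assms(2))
  then show ?thesis unfolding hereditary_def using assms(1) descendants_iff by blast
qed

lemma hereditary_verts: "hereditary G (verts G)"
  by (rule hereditaryI) auto

lemma saturated_verts: "saturated G (verts G)"
  by (auto simp: saturated_def regular_vertex_def)

section \<open>Powers of a cycle and closed simple paths\<close>

definition pow_path :: "'b list \<Rightarrow> nat \<Rightarrow> 'b list" where
  "pow_path c m = concat (replicate m c)"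

lemma pow_path_0 [simp]: "pow_path c 0 = []"
  by (simp add: pow_path_def)

lemma pow_path_Suc: "pow_path c (Suc m) = c @ pow_path c m"
  by (simp add: pow_path_def)

lemma pow_path_add: "pow_path c (m + n) = pow_path c m @ pow_path c n"
  by (simp add: pow_path_def replicate_add)

lemma length_pow_path [simp]: "length (pow_path c m) = m * length c"
  by (induction m) (auto simp: pow_path_Suc)

lemma awalk_pow_path: "awalk u c u \<Longrightarrow> awalk u (pow_path c m) u"
  by (induction m) (auto simp: pow_path_Suc awalk_Nil_iff intro: awalk_appendI)

text \<open>Iteration makes \<open>g\<close> a prefix of \<open>pow_path c (m * k) @ g\<close> for
  every \<open>k\<close>; once \<open>k\<close> reaches the length of \<open>g\<close>, the power
  alone is long enough to contain \<open>g\<close>.\<close>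

lemma prefix_pow_path_of_prefix:
  assumes "prefix g (pow_path c m @ g)" "m > 0" "c \<noteq> []"
  shows "\<exists>k. prefix g (pow_path c k)"
proof -
  have *: "prefix g (pow_path c (m * k) @ g)" for k
  proof (induction k)
    case (Suc k)
    have "prefix (pow_path c m @ g) (pow_path c m @ pow_path c (m * k) @ g)"
      using Suc by simp
    then show ?case using assms(1) prefix_order.trans by (fastforce simp: pow_path_add)
  qed simp
  have "length g \<le> length (pow_path c (m * length g))"
  proof -
    have "1 \<le> m * length c" using assms by (simp add: Suc_leI)
    then have "length g * 1 \<le> length g * (m * length c)" by (intro mult_le_mono) auto
    then show ?thesis by (simp add: mult_ac)
  qed
  then show ?thesis using *[of "length g"] prefix_length_prefix[of g "pow_path c (m * length g) @ g" "pow_path c (m * length g)"]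
    by auto
qed

abbreviation "CSP u \<equiv> closed_simple_paths G u"

lemma CSP_awalk: "c \<in> CSP u \<Longrightarrow> awalk u c u"
  and CSP_nonempty: "c \<in> CSP u \<Longrightarrow> c \<noteq> []"
  by (auto simp: closed_simple_paths_def)

lemma CSP_no_return:
  assumes "c \<in> CSP u" "c = p @ q" "p \<noteq> []" "q \<noteq> []"
  shows "\<not> awalk u p u"
proof
  assume "awalk u p u"
  moreover have "awalk u (p @ q) u" using assms CSP_awalk by blast
  ultimately have "awalk u q u" by (metis awalk_append_ex awalk_range_unique)
  then have "tail G (hd q) = u" using assms(4) by (cases q) (auto simp: awalk_Cons_iff)
  moreover have "hd q \<in> set (tl c)" using assms by (cases p) auto
  ultimately show False using assms(1) by (auto simp: closed_simple_paths_def)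
qed

text \<open>A proper extension of a closed simple path returns to \<open>u\<close> too early. So
  these paths form a prefix code, which makes distinct ones orthogonal in the algebra
  (\<open>ghost_path_CSP\<close>).\<close>

lemma CSP_prefix_eq:
  assumes "c \<in> CSP u" "d \<in> CSP u" "prefix c d"
  shows "c = d"
proof (rule ccontr)
  assume "c \<noteq> d"
  then obtain r where "d = c @ r" "r \<noteq> []" using assms(3) unfolding prefix_def by auto
  then show False using CSP_no_return[OF assms(2)] CSP_awalk[OF assms(1)] CSP_nonempty[OF assms(1)] by blast
qed

text \<open>No proper nonempty prefix of \<open>c\<close> is closed at \<open>u\<close>, so a
  nonempty closed walk along a power of \<open>c\<close> starts with all of \<open>c\<close>, which
  can be cancelled.\<close>

lemma closed_prefix_pow_path:
  assumes "c \<in> CSP u" "awalk u d u" "prefix d (pow_path c m)"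
  shows "\<exists>j. d = pow_path c j"
  using assms(2,3)
proof (induction m arbitrary: d)
  case 0
  then show ?case by (intro exI[of _ 0]) simp
next
  case (Suc m)
  show ?case
  proof (cases "d = []")
    case True then show ?thesis by (intro exI[of _ 0]) simp
  next
    case False
    have pc: "prefix c (pow_path c (Suc m))" by (simp add: pow_path_Suc)
    from prefix_same_cases[OF pc Suc.prems(2)] have "prefix c d"
    proof
      assume "prefix d c"
      then obtain r where "c = d @ r" by (auto simp: prefix_def)
      then show ?thesis using CSP_no_return[OF assms(1), of d r] Suc.prems(1) False by (cases "r = []") auto
    qed
    then obtain d' where d: "d = c @ d'" by (auto simp: prefix_def)
    then have "prefix d' (pow_path c m)" using Suc.prems(2) by (simp add: pow_path_Suc)
    moreover have "awalk u d' u" using Suc.prems(1) d CSP_awalk[OF assms(1)]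
      by (metis awalk_append_ex awalk_range_unique)
    ultimately obtain j where "d' = pow_path c j" using Suc.IH by blast
    then show ?thesis using d by (intro exI[of _ "Suc j"]) (simp add: pow_path_Suc)
  qed
qed

text \<open>A walk that passes through \<open>u\<close> in between is cut there, and the shorter
  initial piece is treated by induction. Thus closed simple paths generate all closed walks at
  \<open>u\<close>.\<close>

lemma closed_walk_CSP_prefix:
  assumes "awalk u d u" "d \<noteq> []"
  obtains c r where "c \<in> CSP u" "d = c @ r" "awalk u r u"
  using assms
proof (induction "length d" arbitrary: d thesis rule: less_induct)
  case less
  show ?case
  proof (cases "\<forall>e \<in> set (tl d). tail G e \<noteq> u")
    case True
    then have "d \<in> CSP u" using less.prems by (auto simp: closed_simple_paths_def)
    then show ?thesis using less.prems(1)[of d "[]"] less.prems(2) awalk_hd_in_verts awalk_Nil_iff by auto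
  next
    case False
    then obtain e p q where e: "tl d = p @ e # q" "tail G e = u" by (metis split_list)
    define d1 where "d1 = hd d # p"
    have d: "d = d1 @ e # q" using e less.prems(3) unfolding d1_def by (cases d) auto
    obtain x where x: "awalk u d1 x" "awalk x (e # q) u" using less.prems(2) d awalk_append_ex by auto
    have "x = u" using x e by (simp add: awalk_Cons_iff)
    then have w: "awalk u d1 u" "awalk u (e # q) u" using x by auto
    have "length d1 < length d" using arg_cong[OF d, of length] by simp
    moreover have "d1 \<noteq> []" by (simp add: d1_def)
    ultimately obtain c r where "c \<in> CSP u" "d1 = c @ r" "awalk u r u" using less.hyps[of d1] w by metis
    then show ?thesis using less.prems(1)[of c "r @ e # q"] d w(2) awalk_appendI by auto
  qed
qed

lemma closed_walk_unique_CSP: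
  assumes "CSP u = {c}" "awalk u d u"
  shows "\<exists>m. d = pow_path c m"
  using assms(2)
proof (induction "length d" arbitrary: d rule: less_induct)
  case less
  show ?case
  proof (cases "d = []")
    case True then show ?thesis by (intro exI[of _ 0]) simp
  next
    case False
    then obtain c' r where c: "c' \<in> CSP u" "d = c' @ r" "awalk u r u"
      using closed_walk_CSP_prefix less.prems by metis
    then have "c' = c" "c' \<noteq> []" using assms CSP_nonempty by auto
    then obtain m where "r = pow_path c m" using less.hyps[of r] c by auto
    then show ?thesis using c \<open>c' = c\<close> by (intro exI[of _ "Suc m"]) (simp add: pow_path_Suc)
  qed
qed

text \<open>The path \<open>pow_path c n @ g\<close> isolates the leading term in
  \<open>reduces_real\<close>: conjugation by it kills all nonempty closed paths of length at most
  \<open>n\<close>. If it did not, \<open>d\<close> would be a prefix of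
  \<open>pow_path c n\<close>, hence a power of \<open>c\<close>; after cancelling
  \<open>pow_path c n\<close>, \<open>g\<close> would be a prefix of a positive power of
  \<open>c\<close> followed by \<open>g\<close>, and so of a power of \<open>c\<close>.\<close>

lemma closed_CSP_shift:
  assumes c: "c \<in> CSP u" and d: "awalk u d u" "d \<noteq> []" "length d \<le> n"
    and g: "\<And>k. \<not> prefix g (pow_path c k)"
  shows "\<not> prefix (pow_path c n @ g) (d @ pow_path c n @ g)"
proof
  assume P: "prefix (pow_path c n @ g) (d @ pow_path c n @ g)"
  have "length c > 0" using CSP_nonempty[OF c] by simp
  then have "length d \<le> length (pow_path c n)" using d(3) by (cases "length c") auto
  moreover have "prefix (pow_path c n) (d @ pow_path c n @ g)"
    using P append_prefixD by blast
  ultimately have "prefix d (pow_path c n)"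
    using prefix_length_prefix[of d "d @ pow_path c n @ g"] by auto
  then obtain m where m: "d = pow_path c m" using closed_prefix_pow_path[OF c d(1)] by blast
  then have "m > 0" using d(2) by (cases m) auto
  have "d @ pow_path c n @ g = pow_path c n @ pow_path c m @ g"
    by (simp only: m append_assoc[symmetric] pow_path_add[symmetric] add.commute)
  then have "prefix g (pow_path c m @ g)" using P by (simp only: same_prefix_prefix)
  then show False using prefix_pow_path_of_prefix[OF _ \<open>m > 0\<close> CSP_nonempty[OF c]] g by blast
qed

lemma regular_arc_outside:
  assumes "saturated G H" "regular_vertex G v" "v \<notin> H"
  obtains e where "e \<in> arcs G" "tail G e = v" "head G e \<notin> H"
  using assms unfolding saturated_def by (metis image_subsetI in_out_arcs_conv)

end

section \<open>Leavitt families\<close>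

text \<open>Only on the vertices must \<open>sc 1\<close> act as a unit: in some of the models below
  it is the passage to a normal form or the reduction modulo a polynomial, and not the unit of the
  ring type.\<close>

locale lpa_family = wf_digraph G for G :: "('v, 'e) pre_digraph" +
  fixes sc :: "'k::field \<Rightarrow> 'r::{ring,monoid_mult}"
    and V :: "'v \<Rightarrow> 'r" and Ed :: "'e \<Rightarrow> 'r" and Gh :: "'e \<Rightarrow> 'r"
  assumes sc_add: "sc (a + b) = sc a + sc b"
    and sc_mult: "sc (a * b) = sc a * sc b"
    and sc_V: "v \<in> verts G \<Longrightarrow> V v * sc a = sc a * V v"
    and sc_Ed: "e \<in> arcs G \<Longrightarrow> Ed e * sc a = sc a * Ed e"
    and sc_Gh: "e \<in> arcs G \<Longrightarrow> Gh e * sc a = sc a * Gh e"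
    and sc_one: "v \<in> verts G \<Longrightarrow> sc 1 * V v = V v"
    and V_V: "v \<in> verts G \<Longrightarrow> w \<in> verts G \<Longrightarrow> V v * V w = (if v = w then V v else 0)"
    and V_Ed: "e \<in> arcs G \<Longrightarrow> V (tail G e) * Ed e = Ed e"
    and Ed_V: "e \<in> arcs G \<Longrightarrow> Ed e * V (head G e) = Ed e"
    and V_Gh: "e \<in> arcs G \<Longrightarrow> V (head G e) * Gh e = Gh e"
    and Gh_V: "e \<in> arcs G \<Longrightarrow> Gh e * V (tail G e) = Gh e"
    and Gh_Ed: "e \<in> arcs G \<Longrightarrow> f \<in> arcs G \<Longrightarrow> Gh e * Ed f = (if e = f then V (head G e) else 0)"
    and V_regular: "regular_vertex G v \<Longrightarrow> V v = (\<Sum>e\<in>out_arcs G v. Ed e * Gh e)"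
begin

lemma sc_0 [simp]: "sc 0 = 0"
  using sc_add[of 0 0] by simp

lemma sc_uminus: "sc (- a) = - sc a"
  using sc_add[of a "- a"] by (simp add: eq_neg_iff_add_eq_0 add.commute)

lemma V_Ed_if: "e \<in> arcs G \<Longrightarrow> v \<in> verts G \<Longrightarrow> V v * Ed e = (if v = tail G e then Ed e else 0)"
  using V_Ed[of e] V_V[of v "tail G e"] by (metis mult.assoc mult_zero_left tail_in_verts)

lemma Gh_V_if: "e \<in> arcs G \<Longrightarrow> v \<in> verts G \<Longrightarrow> Gh e * V v = (if v = tail G e then Gh e else 0)"
  using Gh_V[of e] V_V[of "tail G e" v] by (metis mult.assoc mult_zero_right tail_in_verts)

section \<open>Paths, ghost paths and their products\<close>

primrec path :: "'v \<Rightarrow> 'e list \<Rightarrow> 'r" where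
  "path v [] = V v"
| "path v (e # p) = Ed e * path (head G e) p"

primrec ghost :: "'v \<Rightarrow> 'e list \<Rightarrow> 'r" where
  "ghost v [] = V v"
| "ghost v (e # p) = ghost (head G e) p * Gh e"

lemma V_path: "awalk v p x \<Longrightarrow> V v * path v p = path v p"
  by (cases p) (auto simp: awalk_Cons_iff awalk_Nil_iff V_V V_Ed mult.assoc[symmetric])

lemma ghost_V: "awalk v p x \<Longrightarrow> ghost v p * V v = ghost v p"
  by (cases p) (auto simp: awalk_Cons_iff awalk_Nil_iff V_V Gh_V mult.assoc)

lemma V_path_if: "awalk v p x \<Longrightarrow> w \<in> verts G \<Longrightarrow> V w * path v p = (if w = v then path v p else 0)"
  using V_path[of v p x] V_V[of w v] by (metis mult.assoc mult_zero_left awalk_hd_in_verts)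

lemma ghost_V_if: "awalk v p x \<Longrightarrow> w \<in> verts G \<Longrightarrow> ghost v p * V w = (if w = v then ghost v p else 0)"
  using ghost_V[of v p x] V_V[of v w] by (metis mult.assoc mult_zero_right awalk_hd_in_verts)

lemma path_append: "awalk v p x \<Longrightarrow> awalk x q y \<Longrightarrow> path v (p @ q) = path v p * path x q"
  by (induction p arbitrary: v) (auto simp: awalk_Cons_iff awalk_Nil_iff V_path mult.assoc)

lemma ghost_append: "awalk v p x \<Longrightarrow> awalk x q y \<Longrightarrow> ghost v (p @ q) = ghost x q * ghost v p"
  by (induction p arbitrary: v) (auto simp: awalk_Cons_iff awalk_Nil_iff ghost_V mult.assoc[symmetric])

lemma path_V: "awalk v p x \<Longrightarrow> path v p * V x = path v p"
  using path_append[of v p x "[]" x] awalk_last_in_verts[of v p x] by (simp add: awalk_Nil_iff)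

lemma V_ghost: "awalk v p x \<Longrightarrow> V x * ghost v p = ghost v p"
  using ghost_append[of v p x "[]" x] awalk_last_in_verts[of v p x] by (simp add: awalk_Nil_iff)

lemma ghost_path: "awalk v p x \<Longrightarrow> ghost v p * path v p = V x"
proof (induction p arbitrary: v)
  case (Cons e p)
  then have w: "e \<in> arcs G" "awalk (head G e) p x" by (auto simp: awalk_Cons_iff)
  have "ghost v (e # p) * path v (e # p) = ghost (head G e) p * (Gh e * Ed e) * path (head G e) p"
    by (simp add: mult.assoc)
  also have "\<dots> = ghost (head G e) p * path (head G e) p" using w by (simp add: Gh_Ed ghost_V)
  finally show ?case using Cons.IH w by simp
qed (simp add: awalk_Nil_iff V_V)

lemma ghost_path_extend: "awalk v p x \<Longrightarrow> awalk x r y \<Longrightarrow> ghost v p * path v (p @ r) = path x r"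
  by (simp add: path_append mult.assoc[symmetric] ghost_path V_path)

lemma ghost_path_distinct_source:
  assumes "awalk v p x" "awalk w q y" "v \<noteq> w"
  shows "ghost v p * path w q = 0"
proof -
  have "ghost v p * path w q = ghost v p * (V v * V w) * path w q"
    by (simp add: mult.assoc V_path[OF assms(2)]) (simp add: mult.assoc[symmetric] ghost_V[OF assms(1)])
  then show ?thesis using assms V_V awalk_hd_in_verts by simp
qed

text \<open>After cancelling the common prefix, the first differing arcs \<open>e\<close> and
  \<open>f\<close> meet in \<open>Gh e * Ed f\<close>, which is 0.\<close>

lemma ghost_path_parallel:
  assumes "awalk v p x" "awalk v q y" "\<not> prefix p q" "\<not> prefix q p"
  shows "ghost v p * path v q = 0"
proof -
  from parallel_decomp[of p q] assms(3,4) obtain s e ps f qs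
    where s: "e \<noteq> f" "p = s @ e # ps" "q = s @ f # qs" by blast
  obtain z where z: "awalk v s z" "awalk z (e # ps) x" using assms s awalk_append_ex by auto
  then have z': "awalk z (f # qs) y" using assms s awalk_append_ex awalk_range_unique by blast
  have "ghost v p * path v q = ghost z (e # ps) * path z (f # qs)"
    using z z' s by (simp del: ghost.simps path.simps add: ghost_append path_append mult.assoc)
      (simp del: ghost.simps path.simps add: mult.assoc[symmetric] ghost_path ghost_V)
  also have "\<dots> = ghost (head G e) ps * (Gh e * Ed f) * path (head G f) qs" by (simp add: mult.assoc)
  finally show ?thesis using s z z' by (simp add: Gh_Ed awalk_Cons_iff)
qed

lemma path_pow_path: "awalk u c u \<Longrightarrow> path u (pow_path c (Suc m)) = path u c * path u (pow_path c m)"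
  using path_append[of u c u "pow_path c m" u] by (simp add: pow_path_Suc awalk_pow_path)

text \<open>For hereditary \<open>X\<close>, this span of monomials is the ideal generated by the
  vertices in \<open>X\<close>; see \<open>lideal_lspan\<close> and
  \<open>lspan_least\<close>.\<close>

inductive_set lspan :: "'v set \<Rightarrow> 'r set" for X where
  lspan_zero: "0 \<in> lspan X"
| lspan_step: "awalk v p x \<Longrightarrow> awalk w q x \<Longrightarrow> x \<in> X \<Longrightarrow> z \<in> lspan X
    \<Longrightarrow> sc k * path v p * ghost w q + z \<in> lspan X"

abbreviation "L \<equiv> lspan (verts G)"

lemma lspan_monomial: "awalk v p x \<Longrightarrow> awalk w q x \<Longrightarrow> x \<in> X \<Longrightarrow> sc k * path v p * ghost w q \<in> lspan X"
  using lspan_step[OF _ _ _ lspan_zero] by fastforce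

lemma lspan_add: "y \<in> lspan X \<Longrightarrow> z \<in> lspan X \<Longrightarrow> y + z \<in> lspan X"
  by (induction rule: lspan.induct) (auto simp: add.assoc intro: lspan_step)

lemma lspan_uminus: "y \<in> lspan X \<Longrightarrow> - y \<in> lspan X"
proof (induction rule: lspan.induct)
  case (lspan_step v p x w q z k)
  then have "sc (- k) * path v p * ghost w q + - z \<in> lspan X" by (intro lspan.lspan_step) auto
  then show ?case by (simp add: sc_uminus)
qed (simp add: lspan_zero)

lemma lspan_diff: "y \<in> lspan X \<Longrightarrow> z \<in> lspan X \<Longrightarrow> y - z \<in> lspan X"
  using lspan_add[of y X "- z"] lspan_uminus by simp

lemma lspan_mono: "X \<subseteq> Y \<Longrightarrow> y \<in> lspan X \<Longrightarrow> y \<in> lspan Y"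
  by (erule lspan.induct) (auto intro: lspan_zero lspan_step)

lemma lspan_sum: "(\<And>i. i \<in> A \<Longrightarrow> f i \<in> lspan X) \<Longrightarrow> sum f A \<in> lspan X"
  by (induction A rule: infinite_finite_induct) (auto intro: lspan_zero lspan_add)

lemma V_lspan: "v \<in> X \<Longrightarrow> v \<in> verts G \<Longrightarrow> V v \<in> lspan X"
  using lspan_monomial[of v "[]" v v "[]" X 1] by (simp add: awalk_Nil_iff V_V sc_one)

lemma sc_one_path: "awalk v p x \<Longrightarrow> sc 1 * path v p = path v p"
  using sc_one[of v] V_path[of v p x] awalk_hd_in_verts by (metis mult.assoc)

lemma sc_one_ghost: "awalk v p x \<Longrightarrow> sc 1 * ghost v p = ghost v p"
  using sc_one[of x] V_ghost[of v p x] awalk_last_in_verts by (metis mult.assoc)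

lemma path_sc: "awalk v p x \<Longrightarrow> path v p * sc k = sc k * path v p"
  by (induction p arbitrary: v) (auto simp: awalk_Cons_iff awalk_Nil_iff sc_V mult.assoc,
    metis mult.assoc sc_Ed)

lemma ghost_sc: "awalk v p x \<Longrightarrow> ghost v p * sc k = sc k * ghost v p"
  by (induction p arbitrary: v) (auto simp: awalk_Cons_iff awalk_Nil_iff sc_V mult.assoc,
    metis mult.assoc sc_Gh)

lemma sc_path_L: "awalk v p x \<Longrightarrow> sc k * path v p \<in> L"
  using lspan_monomial[of v p x x "[]" "verts G" k] awalk_last_in_verts[of v p x]
  by (simp add: awalk_Nil_iff mult.assoc path_V)

lemma path_L: "awalk v p x \<Longrightarrow> path v p \<in> L"
  using sc_path_L[of v p x 1] sc_one_path by simp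

lemma ghost_L: "awalk v p x \<Longrightarrow> ghost v p \<in> L"
  using lspan_monomial[of x "[]" x v p "verts G" 1] awalk_last_in_verts[of v p x]
  by (simp add: awalk_Nil_iff mult.assoc V_ghost sc_one_ghost)

lemma Ed_L: "e \<in> arcs G \<Longrightarrow> Ed e \<in> L"
  using path_L[OF arc_implies_awalk, of e] by (simp add: Ed_V)

lemma Gh_L: "e \<in> arcs G \<Longrightarrow> Gh e \<in> L"
  using ghost_L[OF arc_implies_awalk, of e] by (simp add: V_Gh)

lemma V_L: "v \<in> verts G \<Longrightarrow> V v \<in> L"
  by (simp add: V_lspan)

lemma L_induct [consumes 1, case_names zero add sc_mult V Ed Gh mult]:
  assumes "z \<in> L" and "P 0" "\<And>x y. x \<in> L \<Longrightarrow> y \<in> L \<Longrightarrow> P x \<Longrightarrow> P y \<Longrightarrow> P (x + y)"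
    "\<And>k x. x \<in> L \<Longrightarrow> P x \<Longrightarrow> P (sc k * x)" "\<And>v. v \<in> verts G \<Longrightarrow> P (V v)"
    "\<And>e. e \<in> arcs G \<Longrightarrow> P (Ed e)" "\<And>e. e \<in> arcs G \<Longrightarrow> P (Gh e)"
    "\<And>x y. x \<in> L \<Longrightarrow> y \<in> L \<Longrightarrow> P x \<Longrightarrow> P y \<Longrightarrow> P (x * y)"
  shows "P z"
  using assms(1)
proof (induction rule: lspan.induct)
  case (lspan_step v p x w q z k)
  have "P (path v p)" if "awalk v p x" for v p x using that
    by (induction p arbitrary: v) (auto simp: awalk_Cons_iff awalk_Nil_iff intro!: assms Ed_L path_L)
  moreover have "P (ghost v p)" if "awalk v p x" for v p x using that
    by (induction p arbitrary: v) (auto simp: awalk_Cons_iff awalk_Nil_iff intro!: assms Gh_L ghost_L)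
  ultimately show ?case using lspan_step
    by (intro assms lspan_monomial) (auto intro: sc_path_L path_L ghost_L)
qed (rule assms)

lemma lspan_induct_mono [consumes 1, case_names zero add monomial]:
  assumes "z \<in> lspan X" "P 0" "\<And>x y. x \<in> lspan X \<Longrightarrow> y \<in> lspan X \<Longrightarrow> P x \<Longrightarrow> P y \<Longrightarrow> P (x + y)"
    "\<And>k v p x w q. awalk v p x \<Longrightarrow> awalk w q x \<Longrightarrow> x \<in> X \<Longrightarrow> P (sc k * path v p * ghost w q)"
  shows "P z"
  using assms(1) by (induction rule: lspan.induct) (auto intro: assms(2-) lspan_monomial)

lemma sc_lspan:
  assumes "z \<in> lspan X" shows "sc k * z \<in> lspan X"
  using assms
proof (induction rule: lspan_induct_mono)
  case (monomial j v p x w q)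
  then have "sc (k * j) * path v p * ghost w q \<in> lspan X" by (rule lspan_monomial)
  then show ?case by (simp add: sc_mult mult.assoc)
qed (auto simp: distrib_left intro: lspan_zero lspan_add)

lemma V_mult_lspan:
  assumes "v \<in> verts G" and z: "z \<in> lspan X"
  shows "V v * z \<in> lspan X"
  using z
proof (induction rule: lspan_induct_mono)
  case (monomial k u p x w q)
  note monomial = monomial assms(1-2)
  have "V v * (sc k * path u p * ghost w q) = sc k * (V v * path u p) * ghost w q"
    using monomial by (simp add: mult.assoc[symmetric] sc_V)
  then show ?case using monomial by (auto simp: V_path_if mult.assoc intro: lspan_zero lspan_monomial[unfolded mult.assoc])
qed (auto simp: distrib_left intro: lspan_zero lspan_add)

lemma Ed_mult_lspan:
  assumes "e \<in> arcs G" and z: "z \<in> lspan X"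
  shows "Ed e * z \<in> lspan X"
  using z
proof (induction rule: lspan_induct_mono)
  case (monomial k u p x w q)
  note monomial = monomial assms(1-2)
  have "Ed e * (sc k * path u p * ghost w q) = sc k * (Ed e * (V (head G e) * path u p)) * ghost w q"
    using monomial by (simp add: mult.assoc[symmetric] sc_Ed Ed_V)
  moreover have "head G e = u \<Longrightarrow> sc k * path (tail G e) (e # p) * ghost w q \<in> lspan X"
    using monomial by (intro lspan_monomial) (auto simp: awalk_Cons_iff)
  ultimately show ?case using monomial by (auto simp: V_path_if intro: lspan_zero)
qed (auto simp: distrib_left intro: lspan_zero lspan_add)

lemma mult_Gh_lspan:
  assumes "e \<in> arcs G" and z: "z \<in> lspan X"
  shows "z * Gh e \<in> lspan X"
  using z
proof (induction rule: lspan_induct_mono)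
  case (monomial k u p x w q)
  note monomial = monomial assms(1-2)
  have "ghost w q * Gh e = (if head G e = w then ghost w q * Gh e else 0)"
    using monomial ghost_V_if[of w q x "head G e"] V_Gh[of e]
    by (metis head_in_verts mult.assoc mult_zero_left)
  moreover have "head G e = w \<Longrightarrow> sc k * path u p * ghost (tail G e) (e # q) \<in> lspan X"
    using monomial by (intro lspan_monomial) (auto simp: awalk_Cons_iff)
  ultimately show ?case
    by (cases "head G e = w") (simp_all add: mult.assoc lspan_zero)
qed (auto simp: distrib_right intro: lspan_zero lspan_add)

lemma mult_V_lspan:
  assumes "v \<in> verts G" and z: "z \<in> lspan X"
  shows "z * V v \<in> lspan X"
  using z
proof (induction rule: lspan_induct_mono)
  case (monomial k u p x w q)
  note monomial = monomial assms(1-2)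
  have "sc k * path u p * ghost w q * V v = sc k * path u p * (ghost w q * V v)" by (simp add: mult.assoc)
  then show ?case using monomial by (auto simp: ghost_V_if intro: lspan_zero lspan_monomial)
qed (auto simp: distrib_right intro: lspan_zero lspan_add)

lemma Gh_path:
  assumes "e \<in> arcs G" "awalk u p x"
  shows "Gh e * path u p = (case p of [] \<Rightarrow> if tail G e = u then Gh e else 0
    | f # p' \<Rightarrow> if e = f then path (head G e) p' else 0)"
  using assms by (cases p) (auto simp: awalk_Nil_iff awalk_Cons_iff Gh_V_if Gh_Ed V_path mult.assoc[symmetric])

lemma ghost_Ed:
  assumes "e \<in> arcs G" "awalk u p x"
  shows "ghost u p * Ed e = (case p of [] \<Rightarrow> if tail G e = u then Ed e else 0
    | f # p' \<Rightarrow> if e = f then ghost (head G e) p' else 0)"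
  using assms by (cases p) (auto simp: awalk_Nil_iff awalk_Cons_iff V_Ed_if Gh_Ed ghost_V mult.assoc)

lemma Gh_mult_lspan:
  assumes "e \<in> arcs G" "hereditary G X" and z: "z \<in> lspan X"
  shows "Gh e * z \<in> lspan X"
  using z
proof (induction rule: lspan_induct_mono)
  case (monomial k u p x w q)
  note monomial = monomial assms(1-2)
  have *: "Gh e * (sc k * path u p * ghost w q) = sc k * (Gh e * path u p) * ghost w q"
    using monomial by (simp add: mult.assoc[symmetric] sc_Gh)
  show ?case
  proof (cases p)
    case Nil
    then have u: "u = x" using monomial by (simp add: awalk_Nil_iff)
    show ?thesis
    proof (cases "tail G e = x")
      case True
      \<comment> \<open>With an empty path part, \<open>Gh e\<close> joins the ghost part and the
        common range moves from \<open>x\<close> to \<open>head G e\<close>. This is where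
        \<open>X\<close> has to be hereditary.\<close>
      have h: "head G e \<in> X" using hereditary_arc monomial True by auto
      have w: "awalk w (q @ [e]) (head G e)" "awalk (head G e) [] (head G e)"
        using monomial True by (auto simp: awalk_append_ex awalk_Cons_iff awalk_Nil_iff)
      have "ghost w (q @ [e]) = V (head G e) * Gh e * ghost w q"
        using ghost_append[of w q x "[e]" "head G e"] monomial True by (simp add: awalk_Cons_iff awalk_Nil_iff)
      then have "Gh e * (sc k * path u p * ghost w q) = sc k * path (head G e) [] * ghost w (q @ [e])"
        using * Nil u True monomial Gh_V[of e] V_Gh[of e] by (simp add: mult.assoc)
          (simp add: mult.assoc[symmetric])
      then show ?thesis using lspan_monomial[OF w(2,1) h, of k] by simp
    qed (use * Nil u monomial in \<open>auto simp: Gh_V_if awalk_Nil_iff lspan_zero\<close>)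
  next
    case (Cons f p')
    then show ?thesis using * monomial
      by (auto simp: Gh_path awalk_Cons_iff simp del: path.simps intro: lspan_zero lspan_monomial)
  qed
qed (auto simp: distrib_left intro: lspan_zero lspan_add)

lemma mult_Ed_lspan:
  assumes "e \<in> arcs G" "hereditary G X" and z: "z \<in> lspan X"
  shows "z * Ed e \<in> lspan X"
  using z
proof (induction rule: lspan_induct_mono)
  case (monomial k u p x w q)
  note monomial = monomial assms(1-2)
  have *: "sc k * path u p * ghost w q * Ed e = sc k * path u p * (ghost w q * Ed e)"
    by (simp add: mult.assoc)
  show ?case
  proof (cases q)
    case Nil
    then have u: "w = x" using monomial by (simp add: awalk_Nil_iff)
    show ?thesis
    proof (cases "tail G e = x")
      case True
      have h: "head G e \<in> X" using hereditary_arc monomial True by auto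
      have w: "awalk u (p @ [e]) (head G e)" "awalk (head G e) [] (head G e)"
        using monomial True by (auto simp: awalk_append_ex awalk_Cons_iff awalk_Nil_iff)
      have "path u (p @ [e]) = path u p * Ed e"
        using path_append[of u p x "[e]" "head G e"] monomial True
        by (simp add: awalk_Cons_iff awalk_Nil_iff Ed_V)
      then have "sc k * path u p * ghost w q * Ed e = sc k * path u (p @ [e]) * ghost (head G e) []"
        using * Nil u True monomial V_Ed[of e] by (simp add: mult.assoc Ed_V)
      then show ?thesis using lspan_monomial[OF w h, of k] by simp
    qed (use * Nil u monomial in \<open>auto simp: V_Ed_if awalk_Nil_iff lspan_zero\<close>)
  next
    case (Cons f p')
    then show ?thesis using * monomial
      by (auto simp: ghost_Ed awalk_Cons_iff simp del: ghost.simps intro: lspan_zero lspan_monomial)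
  qed
qed (auto simp: distrib_right intro: lspan_zero lspan_add)

lemma lspan_path_mult: "z \<in> lspan X \<Longrightarrow> awalk v p x \<Longrightarrow> path v p * z \<in> lspan X"
  by (induction p arbitrary: v) (auto simp: awalk_Nil_iff awalk_Cons_iff mult.assoc V_mult_lspan Ed_mult_lspan)

lemma lspan_mult_ghost: "z \<in> lspan X \<Longrightarrow> awalk v p x \<Longrightarrow> z * ghost v p \<in> lspan X"
  by (induction p arbitrary: v) (auto simp: awalk_Nil_iff awalk_Cons_iff mult.assoc[symmetric] mult_V_lspan mult_Gh_lspan)

lemma lspan_ghost_mult: "z \<in> lspan X \<Longrightarrow> hereditary G X \<Longrightarrow> awalk v p x \<Longrightarrow> ghost v p * z \<in> lspan X"
  by (induction p arbitrary: v z) (auto simp: awalk_Nil_iff awalk_Cons_iff mult.assoc V_mult_lspan Gh_mult_lspan)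

lemma lspan_mult_path: "z \<in> lspan X \<Longrightarrow> hereditary G X \<Longrightarrow> awalk v p x \<Longrightarrow> z * path v p \<in> lspan X"
  by (induction p arbitrary: v z) (auto simp: awalk_Nil_iff awalk_Cons_iff mult.assoc[symmetric] mult_V_lspan mult_Ed_lspan)

lemma sc_central: "z \<in> L \<Longrightarrow> z * sc k = sc k * z"
proof (induction rule: lspan_induct_mono)
  case (monomial j v p x w q)
  have "sc j * sc k = sc k * sc j" by (simp add: sc_mult[symmetric] mult.commute)
  then show ?case using monomial path_sc[of v p x k] ghost_sc[of w q x k] by (metis mult.assoc)
qed (auto simp: distrib_left distrib_right)

lemma lspan_left_mult:
  assumes "hereditary G X" "y \<in> L" "z \<in> lspan X"
  shows "y * z \<in> lspan X"
  using assms(2)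
proof (induction rule: lspan_induct_mono)
  case (monomial k v p x w q)
  then show ?case using assms
    by (auto simp: mult.assoc intro!: sc_lspan lspan_path_mult lspan_ghost_mult)
qed (auto simp: distrib_right intro: lspan_zero lspan_add)

lemma lspan_right_mult:
  assumes "hereditary G X" "y \<in> L" "z \<in> lspan X"
  shows "z * y \<in> lspan X"
  using assms(2)
proof (induction rule: lspan_induct_mono)
  case (monomial k v p x w q)
  have "z * (sc k * path v p * ghost w q) = sc k * (z * path v p * ghost w q)"
    using sc_central[of z k] lspan_mono[OF hereditary_sub[OF assms(1)] assms(3)]
    by (metis mult.assoc)
  then show ?case using assms monomial
    by (auto intro!: sc_lspan lspan_mult_path lspan_mult_ghost)
qed (auto simp: distrib_left intro: lspan_zero lspan_add)

lemma L_mult: "y \<in> L \<Longrightarrow> z \<in> L \<Longrightarrow> y * z \<in> L"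
  using lspan_left_mult hereditary_verts by blast

section \<open>Ideals of the algebra and local units\<close>

definition lideal :: "'r set \<Rightarrow> bool" where
  "lideal I \<longleftrightarrow> I \<subseteq> L \<and> 0 \<in> I \<and> (\<forall>x\<in>I. \<forall>y\<in>I. x + y \<in> I) \<and> (\<forall>x\<in>I. - x \<in> I) \<and>
     (\<forall>x\<in>I. \<forall>y\<in>L. x * y \<in> I \<and> y * x \<in> I)"

lemma lideal_lspan: "hereditary G X \<Longrightarrow> lideal (lspan X)"
  unfolding lideal_def using lspan_left_mult lspan_right_mult lspan_mono[OF hereditary_sub]
  by (auto intro: lspan_zero lspan_add lspan_uminus)

lemma lideal_L: "lideal I \<Longrightarrow> x \<in> I \<Longrightarrow> x \<in> L"
  and lideal_zero: "lideal I \<Longrightarrow> 0 \<in> I"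
  and lideal_add: "lideal I \<Longrightarrow> x \<in> I \<Longrightarrow> y \<in> I \<Longrightarrow> x + y \<in> I"
  and lideal_uminus: "lideal I \<Longrightarrow> x \<in> I \<Longrightarrow> - x \<in> I"
  and lideal_right: "lideal I \<Longrightarrow> x \<in> I \<Longrightarrow> y \<in> L \<Longrightarrow> x * y \<in> I"
  and lideal_left: "lideal I \<Longrightarrow> x \<in> I \<Longrightarrow> y \<in> L \<Longrightarrow> y * x \<in> I"
  unfolding lideal_def by auto

lemma lideal_diff: "lideal I \<Longrightarrow> x \<in> I \<Longrightarrow> y \<in> I \<Longrightarrow> x - y \<in> I"
  using lideal_add[of I x "- y"] lideal_uminus by simp

lemma lideal_sum: "lideal I \<Longrightarrow> (\<And>i. i \<in> A \<Longrightarrow> f i \<in> I) \<Longrightarrow> sum f A \<in> I"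
  by (induction A rule: infinite_finite_induct) (auto intro: lideal_zero lideal_add)

lemma lideal_minus_iff: "lideal I \<Longrightarrow> x - y \<in> I \<Longrightarrow> x \<in> I \<longleftrightarrow> y \<in> I"
  using lideal_add[of I "x - y" y] lideal_diff[of I x "x - y"] by auto

lemma lspan_least:
  assumes "lideal I" "\<And>v. v \<in> X \<Longrightarrow> V v \<in> I" "z \<in> lspan X"
  shows "z \<in> I"
  using assms(3)
proof (induction rule: lspan_induct_mono)
  case (monomial k v p x w q)
  have "V x \<in> I" "sc k * path v p \<in> L" "ghost w q \<in> L"
    using monomial assms by (auto intro: sc_path_L ghost_L)
  then have "(sc k * path v p) * V x * ghost w q \<in> I"
    using assms(1) by (blast intro: lideal_right lideal_left)
  then show ?case using monomial by (simp add: mult.assoc V_ghost)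
qed (auto intro: lideal_zero lideal_add assms)

lemma right_local_unit:
  assumes "z \<in> L"
  obtains F where "finite F" "F \<subseteq> verts G" "z = (\<Sum>v\<in>F. z * V v)"
proof -
  \<comment> \<open>The claim covers all larger sets as well, so that the sets belonging to two
    summands can be merged.\<close>
  have "\<exists>F. finite F \<and> F \<subseteq> verts G \<and> (\<forall>F'. finite F' \<longrightarrow> F \<subseteq> F' \<longrightarrow> F' \<subseteq> verts G \<longrightarrow> (\<Sum>v\<in>F'. z * V v) = z)"
    using assms
  proof (induction rule: lspan_induct_mono)
    case zero then show ?case by (intro exI[of _ "{}"]) simp
  next
    case (add x y)
    from add(3) obtain F where F: "finite F" "F \<subseteq> verts G"
      "\<And>F'. finite F' \<Longrightarrow> F \<subseteq> F' \<Longrightarrow> F' \<subseteq> verts G \<Longrightarrow> (\<Sum>v\<in>F'. x * V v) = x" by blast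
    from add(4) obtain F' where F': "finite F'" "F' \<subseteq> verts G"
      "\<And>F. finite F \<Longrightarrow> F' \<subseteq> F \<Longrightarrow> F \<subseteq> verts G \<Longrightarrow> (\<Sum>v\<in>F. y * V v) = y" by blast
    show ?case by (intro exI[of _ "F \<union> F'"]) (use F F' in \<open>auto simp: distrib_right sum.distrib\<close>)
  next
    case (monomial k v p x w q)
    have "(\<Sum>u\<in>F'. sc k * path v p * ghost w q * V u) = sc k * path v p * ghost w q"
      if "finite F'" "w \<in> F'" "F' \<subseteq> verts G" for F'
    proof -
      have "(\<Sum>u\<in>F'. sc k * path v p * ghost w q * V u) =
        (\<Sum>u\<in>F'. if u = w then sc k * path v p * ghost w q else 0)"
        using that monomial by (intro sum.cong) (auto simp: mult.assoc ghost_V_if)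
      then show ?thesis using that by simp
    qed
    then show ?case using monomial awalk_hd_in_verts by (intro exI[of _ "{w}"]) auto
  qed
  then show ?thesis using that by (metis order_refl)
qed

lemma not_mem_vertex:
  assumes "lideal I" "z \<in> L" "z \<notin> I"
  obtains v where "v \<in> verts G" "z * V v \<notin> I"
  using right_local_unit[OF assms(2)] lideal_sum[OF assms(1)] assms(3) by (metis subsetD)

end

section \<open>The reduction theorem modulo a hereditary saturated set\<close>

declare (in wf_digraph) awalk_append_iff [simp del]

context lpa_family
begin

section \<open>Polynomials in a cycle, gaps and the terminal shapes\<close>

definition evp :: "'v \<Rightarrow> 'e list \<Rightarrow> 'k poly \<Rightarrow> 'r" where
  "evp u c f = (\<Sum>i\<le>degree f. sc (coeff f i) * path u (pow_path c i))"

lemma evp_bound: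
  assumes "degree f \<le> n"
  shows "evp u c f = (\<Sum>i\<le>n. sc (coeff f i) * path u (pow_path c i))"
  unfolding evp_def using assms by (intro sum.mono_neutral_left) (auto simp: coeff_eq_0)

lemma evp_add: "evp u c (f + g) = evp u c f + evp u c g"
proof -
  define n where "n = max (degree f) (degree g)"
  have "degree f \<le> n" "degree g \<le> n" "degree (f + g) \<le> n"
    by (auto simp: n_def degree_add_le_max)
  then show ?thesis by (simp add: evp_bound[of _ n] sc_add distrib_right sum.distrib)
qed

lemma evp_0 [simp]: "evp u c 0 = 0"
  by (simp add: evp_def)

lemma evp_sum: "evp u c (sum f A) = (\<Sum>i\<in>A. evp u c (f i))"
  by (induction A rule: infinite_finite_induct) (auto simp: evp_add)

lemma evp_monom: "evp u c (monom a n) = sc a * path u (pow_path c n)"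
proof -
  have "evp u c (monom a n) = (\<Sum>i\<le>n. if i = n then sc a * path u (pow_path c n) else 0)"
    unfolding evp_bound[OF degree_monom_le] by (intro sum.cong) auto
  then show ?thesis by simp
qed

definition outer_arcs :: "'v set \<Rightarrow> 'v \<Rightarrow> 'e set" where
  "outer_arcs H v = {e \<in> out_arcs G v. head G e \<notin> H}"

text \<open>The idempotent \<open>v\<^sup>H\<close>, which generates modulo \<open>lspan H\<close> the new sink of a breaking vertex.\<close>

definition gap :: "'v set \<Rightarrow> 'v \<Rightarrow> 'r" where
  "gap H v = V v - (\<Sum>e\<in>outer_arcs H v. Ed e * Gh e)"

text \<open>For hereditary \<open>H\<close>, a walk that ends outside \<open>H\<close> lies outside
  \<open>H\<close> throughout; arcs leading from the cycle into \<open>H\<close> thus do not count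
  as exits.\<close>

definition no_exit :: "'v set \<Rightarrow> 'v \<Rightarrow> 'e list \<Rightarrow> bool" where
  "no_exit H u c \<longleftrightarrow> (\<forall>g w. awalk u g w \<longrightarrow> w \<notin> H \<longrightarrow> (\<exists>m. prefix g (pow_path c m)))"

definition terminal :: "'v set \<Rightarrow> 'v set \<Rightarrow> 'r \<Rightarrow> bool" where
  "terminal P H t \<longleftrightarrow> (\<exists>v\<in>P-H. t = V v) \<or>
     (\<exists>v\<in>P-H. \<not> regular_vertex G v \<and> finite (outer_arcs H v) \<and> t = gap H v) \<or>
     (\<exists>u\<in>P-H. \<exists>c\<in>CSP u. \<exists>f. f \<noteq> 0 \<and> no_exit H u c \<and> t = evp u c f)"

definition reduces :: "'v set \<Rightarrow> 'v set \<Rightarrow> 'r \<Rightarrow> bool" where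
  "reduces P H a \<longleftrightarrow> (\<exists>z\<in>L. \<exists>z'\<in>L. \<exists>t. z * a * z' - t \<in> lspan H \<and> terminal P H t)"

lemma reducesI: "z \<in> L \<Longrightarrow> z' \<in> L \<Longrightarrow> z * a * z' - t \<in> lspan H \<Longrightarrow> terminal P H t \<Longrightarrow> reduces P H a"
  unfolding reduces_def by blast

lemma reduces_cong:
  assumes "hereditary G H" "a - b \<in> lspan H" "reduces P H b"
  shows "reduces P H a"
proof -
  from assms(3) obtain z z' t where z: "z \<in> L" "z' \<in> L" "z * b * z' - t \<in> lspan H" "terminal P H t"
    unfolding reduces_def by blast
  have "z * (a - b) * z' \<in> lspan H" using assms z lspan_left_mult lspan_right_mult by blast
  from lspan_add[OF this z(3)] have "z * a * z' - t \<in> lspan H" by (simp add: algebra_simps)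
  then show ?thesis using z reducesI by blast
qed

lemma reduces_mult:
  assumes "reduces P H (y * a * y')" "y \<in> L" "y' \<in> L"
  shows "reduces P H a"
proof -
  from assms(1) obtain z z' t where z: "z \<in> L" "z' \<in> L" "z * (y * a * y') * z' - t \<in> lspan H" "terminal P H t"
    unfolding reduces_def by blast
  then have "(z * y) * a * (y' * z') - t \<in> lspan H" by (simp add: mult.assoc)
  then show ?thesis using z assms L_mult reducesI by blast
qed

lemma gap_L: "v \<in> verts G \<Longrightarrow> gap H v \<in> L"
  unfolding gap_def by (intro lspan_diff lspan_sum V_L L_mult Ed_L Gh_L) (auto simp: outer_arcs_def)

lemma V_gap: "v \<in> verts G \<Longrightarrow> V v * gap H v = gap H v"
  and gap_V: "v \<in> verts G \<Longrightarrow> gap H v * V v = gap H v"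
  unfolding gap_def
  by (auto simp: right_diff_distrib left_diff_distrib V_V sum_distrib_left sum_distrib_right outer_arcs_def
      mult.assoc Gh_V intro!: sum.cong) (auto simp: mult.assoc[symmetric] V_Ed)

text \<open>Left multiplication by the sum subtracted in \<open>gap\<close> fixes each outer arc.
  The remaining arcs at \<open>v\<close> end in \<open>H\<close> and vanish modulo
  \<open>lspan H\<close> for hereditary \<open>H\<close>, so there the gap behaves like a
  sink.\<close>

lemma gap_Ed:
  assumes "finite (outer_arcs H v)" "e \<in> outer_arcs H v"
  shows "gap H v * Ed e = 0"
proof -
  have e: "e \<in> arcs G" "tail G e = v" using assms by (auto simp: outer_arcs_def)
  have "(\<Sum>f\<in>outer_arcs H v. Ed f * Gh f) * Ed e = (\<Sum>f\<in>outer_arcs H v. if f = e then Ed e else 0)"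
    unfolding sum_distrib_right using e
    by (intro sum.cong) (auto simp: mult.assoc Gh_Ed outer_arcs_def Ed_V)
  then show ?thesis using e assms V_Ed[of e] by (simp add: gap_def left_diff_distrib)
qed

lemma Gh_gap:
  assumes "finite (outer_arcs H v)" "e \<in> outer_arcs H v"
  shows "Gh e * gap H v = 0"
proof -
  have e: "e \<in> arcs G" "tail G e = v" using assms by (auto simp: outer_arcs_def)
  have "Gh e * (\<Sum>f\<in>outer_arcs H v. Ed f * Gh f) = (\<Sum>f\<in>outer_arcs H v. if f = e then Gh e else 0)"
    unfolding sum_distrib_left using e
    by (intro sum.cong) (auto simp: mult.assoc[symmetric] Gh_Ed outer_arcs_def V_Gh)
  then show ?thesis using e assms Gh_V[of e] by (simp add: gap_def right_diff_distrib)
qed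

lemma gap_idem:
  assumes "finite (outer_arcs H v)" "v \<in> verts G"
  shows "gap H v * gap H v = gap H v"
proof -
  have "gap H v * gap H v = gap H v * V v - (\<Sum>e\<in>outer_arcs H v. gap H v * Ed e * Gh e)"
    by (subst (2) gap_def) (simp add: right_diff_distrib sum_distrib_left mult.assoc)
  then show ?thesis using assms by (simp add: gap_V gap_Ed)
qed

lemma Ed_lspan: "e \<in> arcs G \<Longrightarrow> hereditary G H \<Longrightarrow> head G e \<in> H \<Longrightarrow> Ed e \<in> lspan H"
  using lspan_left_mult[OF _ Ed_L V_lspan, of H e "head G e"] by (simp add: Ed_V)

text \<open>The path \<open>p\<close> is chosen of minimal length, so no other path of
  \<open>T\<close> from the same vertex is a prefix of it. Its ghost then annihilates each other
  term or shortens it to a nonempty closed path at the common end \<open>u\<close>.\<close>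

lemma real_leading_term:
  assumes T: "finite T" "T \<noteq> {}" "\<And>v p. (v, p) \<in> T \<Longrightarrow> awalk v p u"
  obtains v p T' c where "(v, p) \<in> T" "T' \<subseteq> T" "\<And>t. t \<in> T' \<Longrightarrow> awalk u (c t) u" "\<And>t. t \<in> T' \<Longrightarrow> c t \<noteq> []"
    "ghost v p * (\<Sum>t\<in>T. sc (k t) * path (fst t) (snd t)) = sc (k (v, p)) * V u + (\<Sum>t\<in>T'. sc (k t) * path u (c t))"
proof -
  from ex_is_arg_min_if_finite[OF T(1,2), of "\<lambda>t. length (snd t)"]
  obtain v p where vp: "(v, p) \<in> T" "\<And>t. t \<in> T \<Longrightarrow> length p \<le> length (snd t)"
    by (auto simp: is_arg_min_linorder)
  note w = T(3)[OF vp(1)]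
  define T' where "T' = {t \<in> T. t \<noteq> (v, p) \<and> fst t = v \<and> prefix p (snd t)}"
  define c where "c = (\<lambda>t::'v \<times> 'e list. drop (length p) (snd t))"
  have T': "snd t = p @ c t" "awalk u (c t) u" "c t \<noteq> []" if t: "t \<in> T'" for t
  proof -
    show s: "snd t = p @ c t" using t by (auto simp: T'_def c_def prefix_def)
    have "awalk v (snd t) u" using T(3)[of v "snd t"] t by (cases t) (auto simp: T'_def)
    then have "awalk v (p @ c t) u" using s by simp
    then show "awalk u (c t) u" using w awalk_append_ex awalk_range_unique by metis
    show "c t \<noteq> []" using s t by (cases t) (auto simp: T'_def)
  qed
  have "ghost v p * (sc (k t) * path (fst t) (snd t)) = (if t = (v, p) then sc (k (v, p)) * V u else 0) +
     (if t \<in> T' then sc (k t) * path u (c t) else 0)" if t: "t \<in> T" for t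
  proof -
    obtain v' q where tq: "t = (v', q)" by (cases t)
    have w': "awalk v' q u" using T(3) t tq by auto
    have comm: "ghost v p * (sc (k t) * path (fst t) (snd t)) = sc (k t) * (ghost v p * path v' q)"
      using ghost_sc[OF w] tq by (simp add: mult.assoc[symmetric])
    consider "t = (v, p)" | "t \<in> T'" | "t \<noteq> (v, p)" "v' \<noteq> v" | "t \<noteq> (v, p)" "v' = v" "\<not> prefix p q"
      using t tq by (auto simp: T'_def)
    then show ?thesis
    proof cases
      case 1 then show ?thesis using comm tq w by (simp add: ghost_path T'_def)
    next
      case 2
      then show ?thesis using comm tq T'[OF 2] ghost_path_extend[OF w, of "c t"] by (auto simp: T'_def)
    next
      case 3
      then show ?thesis using comm tq ghost_path_distinct_source[OF w w'] by (auto simp: T'_def)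
    next
      case 4
      have "\<not> prefix q p" using vp(2)[OF t] tq 4 by (auto simp: prefix_def)
      then show ?thesis using comm tq ghost_path_parallel[OF w, of q] w' 4 by (auto simp: T'_def)
    qed
  qed
  then have "ghost v p * (\<Sum>t\<in>T. sc (k t) * path (fst t) (snd t)) =
    (\<Sum>t\<in>T. (if t = (v, p) then sc (k (v, p)) * V u else 0) + (if t \<in> T' then sc (k t) * path u (c t) else 0))"
    by (simp add: sum_distrib_left)
  also have "\<dots> = sc (k (v, p)) * V u + (\<Sum>t\<in>T'. sc (k t) * path u (c t))"
  proof -
    have "T \<inter> T' = T'" by (auto simp: T'_def)
    then have "(\<Sum>t\<in>T. if t \<in> T' then sc (k t) * path u (c t) else 0) = (\<Sum>t\<in>T'. sc (k t) * path u (c t))"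
      using sum.inter_restrict[OF T(1), of "\<lambda>t. sc (k t) * path u (c t)" T'] by simp
    then show ?thesis using T(1) vp(1) by (simp add: sum.distrib)
  qed
  finally show ?thesis by (intro that[of v p T' c] vp(1) T'(2,3)) (auto simp: T'_def)
qed

lemma sc_inverse: "v \<in> verts G \<Longrightarrow> k \<noteq> 0 \<Longrightarrow> sc (inverse k) * (sc k * V v) = V v"
  by (simp add: mult.assoc[symmetric] sc_mult[symmetric] sc_one)

lemma sc_V_inverse:
  assumes "v \<in> verts G" "k \<noteq> 0"
  shows "(sc (inverse k) * V v) * (sc k * V v) = V v"
proof -
  have "(sc (inverse k) * V v) * (sc k * V v) = sc (inverse k) * (sc k * (V v * V v))"
    using sc_V[OF assms(1)] by (metis mult.assoc)
  then show ?thesis using assms by (simp add: V_V sc_inverse)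
qed

lemma sc_V_L: "v \<in> verts G \<Longrightarrow> sc k * V v \<in> L"
  by (simp add: sc_lspan V_L)

text \<open>By \<open>real_leading_term\<close>, a nonzero multiple of \<open>u\<close> plus
  nonempty closed paths at \<open>u\<close> is left. On a cycle without exits these paths are powers
  of the cycle, and the multiple of \<open>u\<close> becomes the nonzero constant term of a
  polynomial. If the cycle has an exit, a path that winds around it and then leaves kills every term
  except the multiple of \<open>u\<close>.\<close>

lemma reduces_real:
  assumes H: "hereditary G H" and P: "hereditary G P" and u: "u \<in> P" "u \<notin> H"
    and T: "finite T" "T \<noteq> {}" "\<And>v p. (v, p) \<in> T \<Longrightarrow> awalk v p u" "\<And>t. t \<in> T \<Longrightarrow> k t \<noteq> 0"
  shows "reduces P H (\<Sum>t\<in>T. sc (k t) * path (fst t) (snd t))"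
proof -
  have uv: "u \<in> verts G" using u P hereditary_sub by blast
  let ?r = "\<Sum>t\<in>T. sc (k t) * path (fst t) (snd t)"
  from real_leading_term[OF T(1,2,3), where k = k] obtain v p T' c where vp: "(v, p) \<in> T" and T': "T' \<subseteq> T"
    "\<And>t. t \<in> T' \<Longrightarrow> awalk u (c t) u" "\<And>t. t \<in> T' \<Longrightarrow> c t \<noteq> []"
    and y: "ghost v p * ?r = sc (k (v, p)) * V u + (\<Sum>t\<in>T'. sc (k t) * path u (c t))"
    by blast
  define k0 where "k0 = k (v, p)"
  have k0: "k0 \<noteq> 0" using T(4) vp k0_def by simp
  have finT': "finite T'" using T' T(1) finite_subset by blast
  have g: "ghost v p \<in> L" using T(3) vp ghost_L by blast
  note y = y[folded k0_def]
  show ?thesis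
  proof (cases "T' = {}")
    case True
    then have "(sc (inverse k0) * V u) * (ghost v p * ?r) * V u = V u"
      using y sc_V_inverse[OF uv k0] uv by (simp add: V_V)
    then have "(sc (inverse k0) * V u) * (ghost v p * ?r) * V u - V u \<in> lspan H" by (simp add: lspan_zero)
    moreover have "terminal P H (V u)" unfolding terminal_def using u by blast
    ultimately have "reduces P H (ghost v p * ?r)" using reducesI sc_V_L[OF uv] V_L[OF uv] by blast
    then have "reduces P H (ghost v p * ?r * V u)" using y True uv by (simp add: mult.assoc V_V)
    then show ?thesis using reduces_mult g V_L uv by blast
  next
    case False
    then obtain t1 where t1: "t1 \<in> T'" by blast
    obtain c0 where c0: "c0 \<in> CSP u" using closed_walk_CSP_prefix[OF T'(2,3)[OF t1]] by blast
    show ?thesis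
    proof (cases "no_exit H u c0")
      case True
      have "\<exists>j. c t = pow_path c0 j" if "t \<in> T'" for t
        using True T'(2)[OF that] u closed_prefix_pow_path[OF c0] unfolding no_exit_def by blast
      then obtain j where j: "\<And>t. t \<in> T' \<Longrightarrow> c t = pow_path c0 (j t)" by metis
      have j0: "j t \<noteq> 0" if "t \<in> T'" for t using j[OF that] T'(3)[OF that] by (metis pow_path_0)
      define f where "f = monom k0 0 + (\<Sum>t\<in>T'. monom (k t) (j t))"
      have "(\<Sum>t\<in>T'. coeff (monom (k t) (j t)) 0) = 0" by (rule sum.neutral, metis coeff_monom j0)
      then have "coeff f 0 = k0" by (simp add: f_def coeff_sum del: coeff_monom) simp
      then have "f \<noteq> 0" using k0 by auto
      have "evp u c0 f = ghost v p * ?r"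
        unfolding y f_def using j by (simp add: evp_add evp_sum evp_monom)
      moreover have "V u * (ghost v p * ?r) = ghost v p * ?r"
        using V_ghost[OF T(3)[OF vp]] by (simp add: mult.assoc[symmetric])
      moreover have "ghost v p * ?r * V u = ghost v p * ?r"
      proof -
        have "?r * V u = ?r" unfolding sum_distrib_right
        proof (intro sum.cong refl)
          fix t assume "t \<in> T"
          then show "sc (k t) * path (fst t) (snd t) * V u = sc (k t) * path (fst t) (snd t)"
            using T(3)[of "fst t" "snd t"] by (simp add: mult.assoc path_V)
        qed
        then show ?thesis by (simp add: mult.assoc)
      qed
      ultimately have "V u * (ghost v p * ?r) * V u - evp u c0 f \<in> lspan H" by (simp add: lspan_zero)
      moreover have "terminal P H (evp u c0 f)"
        unfolding terminal_def using u c0 \<open>f \<noteq> 0\<close> True by blast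
      ultimately have "reduces P H (ghost v p * ?r)" using reducesI V_L uv by blast
      then have "reduces P H (ghost v p * ?r * V u)" using \<open>ghost v p * ?r * V u = ghost v p * ?r\<close> by simp
      then show ?thesis using reduces_mult g V_L uv by blast
    next
      case False
      then obtain g w where gw: "awalk u g w" "w \<notin> H" "\<And>m. \<not> prefix g (pow_path c0 m)"
        unfolding no_exit_def by blast
      \<comment> \<open>Any common bound on the lengths of the closed paths serves
        \<open>closed_CSP_shift\<close>; their sum is one.\<close>
      define n where "n = (\<Sum>t\<in>T'. length (c t))"
      have n: "length (c t) \<le> n" if "t \<in> T'" for t
        unfolding n_def using member_le_sum[of t T' "\<lambda>t. length (c t)"] that finT' by simp
      define \<gamma> where "\<gamma> = pow_path c0 n @ g"
      have \<gamma>: "awalk u \<gamma> w" unfolding \<gamma>_def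
        using awalk_pow_path[OF CSP_awalk[OF c0]] gw(1) awalk_appendI by blast
      have wP: "w \<in> P" "w \<in> verts G" using hereditary_awalk[OF P u(1) gw(1)] P hereditary_sub by auto
      have z: "ghost u \<gamma> * path u (c t) * path u \<gamma> = 0" if t: "t \<in> T'" for t
      proof -
        have "\<not> prefix \<gamma> (c t @ \<gamma>)" unfolding \<gamma>_def
          using closed_CSP_shift[OF c0 T'(2)[OF t] T'(3)[OF t] n[OF t] gw(3)] .
        moreover have "\<not> prefix (c t @ \<gamma>) \<gamma>" using T'(3)[OF t] by (auto dest: prefix_length_le)
        ultimately have "ghost u \<gamma> * path u (c t @ \<gamma>) = 0"
          using ghost_path_parallel[OF \<gamma>, of "c t @ \<gamma>" w] awalk_appendI[OF T'(2)[OF t] \<gamma>] by blast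
        then show ?thesis using path_append[OF T'(2)[OF t] \<gamma>] by (simp add: mult.assoc)
      qed
      have "ghost u \<gamma> * (ghost v p * ?r) * path u \<gamma> = sc k0 * V w"
      proof -
        have "ghost u \<gamma> * (ghost v p * ?r) * path u \<gamma> = ghost u \<gamma> * (sc k0 * V u) * path u \<gamma> +
          (\<Sum>t\<in>T'. ghost u \<gamma> * (sc (k t) * path u (c t)) * path u \<gamma>)"
          unfolding y by (simp add: distrib_left distrib_right sum_distrib_left sum_distrib_right)
        also have "(\<Sum>t\<in>T'. ghost u \<gamma> * (sc (k t) * path u (c t)) * path u \<gamma>) =
          (\<Sum>t\<in>T'. sc (k t) * (ghost u \<gamma> * path u (c t) * path u \<gamma>))"
          using ghost_sc[OF \<gamma>] by (intro sum.cong refl) (metis mult.assoc)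
        also have "\<dots> = 0" using z by simp
        also have "ghost u \<gamma> * (sc k0 * V u) * path u \<gamma> = sc k0 * (ghost u \<gamma> * (V u * path u \<gamma>))"
          using ghost_sc[OF \<gamma>] by (metis mult.assoc)
        also have "\<dots> = sc k0 * V w" using V_path[OF \<gamma>] ghost_path[OF \<gamma>] by simp
        finally show ?thesis by simp
      qed
      then have "(sc (inverse k0) * V w) * (ghost u \<gamma> * (ghost v p * ?r) * path u \<gamma>) * V w - V w \<in> lspan H"
        using sc_V_inverse[OF wP(2) k0] wP by (simp add: lspan_zero V_V)
      moreover have "terminal P H (V w)" unfolding terminal_def using wP gw(2) by blast
      ultimately have "reduces P H (ghost u \<gamma> * (ghost v p * ?r) * path u \<gamma>)"
        using reducesI sc_V_L V_L wP by blast
      then have "reduces P H ((ghost u \<gamma> * ghost v p) * ?r * path u \<gamma>)" by (simp add: mult.assoc)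
      then show ?thesis using reduces_mult L_mult g ghost_L[OF \<gamma>] path_L[OF \<gamma>] by blast
    qed
  qed
qed

section \<open>Ghost-free elements and the filtration by ghost length\<close>

inductive_set rspan :: "'v set \<Rightarrow> 'v \<Rightarrow> 'r set" for X w where
  rspan_zero: "0 \<in> rspan X w"
| rspan_step: "awalk v p w \<Longrightarrow> w \<in> X \<Longrightarrow> z \<in> rspan X w \<Longrightarrow> sc k * path v p + z \<in> rspan X w"

lemma rspan_empty: "z \<in> rspan X w \<Longrightarrow> w \<notin> X \<Longrightarrow> z = 0"
  by (induction rule: rspan.induct) auto

lemma rspan_V: "z \<in> rspan X w \<Longrightarrow> z * V w = z"
  by (induction rule: rspan.induct) (auto simp: distrib_right mult.assoc path_V)

lemma rspan_L: "z \<in> rspan X w \<Longrightarrow> z \<in> L"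
  by (induction rule: rspan.induct) (auto intro: lspan_zero lspan_add sc_path_L)

lemma rspan_repr:
  assumes "r \<in> rspan X w"
  obtains T k where "finite T" "\<And>v p. (v, p) \<in> T \<Longrightarrow> awalk v p w" "\<And>t. t \<in> T \<Longrightarrow> k t \<noteq> 0"
    "r = (\<Sum>t\<in>T. sc (k t) * path (fst t) (snd t))"
proof -
  have "\<exists>T k. finite T \<and> (\<forall>t\<in>T. awalk (fst t) (snd t) w) \<and> r = (\<Sum>t\<in>T. sc (k t) * path (fst t) (snd t))"
    using assms
  proof (induction rule: rspan.induct)
    case rspan_zero
    show ?case by (intro exI[of _ "{}"]) simp
  next
    case (rspan_step v p z j)
    then obtain T k where T: "finite T" "\<forall>t\<in>T. awalk (fst t) (snd t) w"
      "z = (\<Sum>t\<in>T. sc (k t) * path (fst t) (snd t))" by blast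
    define k' where "k' = (\<lambda>t. (if t = (v, p) then j else 0) + (if t \<in> T then k t else 0))"
    let ?T = "insert (v, p) T"
    have "(\<Sum>t\<in>?T. sc (k' t) * path (fst t) (snd t)) =
      (\<Sum>t\<in>?T. (if t = (v, p) then sc j * path v p else 0) + (if t \<in> T then sc (k t) * path (fst t) (snd t) else 0))"
      by (intro sum.cong) (auto simp: k'_def sc_add distrib_right)
    also have "\<dots> = sc j * path v p + (\<Sum>t\<in>?T. if t \<in> T then sc (k t) * path (fst t) (snd t) else 0)"
      using T by (subst sum.distrib) simp
    also have "(\<Sum>t\<in>?T. if t \<in> T then sc (k t) * path (fst t) (snd t) else 0) = z"
      unfolding T(3) using T(1) by (intro sum.mono_neutral_cong_right) auto
    finally show ?case using T rspan_step by (intro exI[of _ ?T] exI[of _ k']) auto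
  qed
  then obtain T k where T: "finite T" "\<forall>t\<in>T. awalk (fst t) (snd t) w"
    "r = (\<Sum>t\<in>T. sc (k t) * path (fst t) (snd t))" by blast
  have r: "r = (\<Sum>t\<in>{t\<in>T. k t \<noteq> 0}. sc (k t) * path (fst t) (snd t))"
    unfolding T(3) using T(1) by (intro sum.mono_neutral_right) auto
  show ?thesis by (rule that[OF _ _ _ r]) (use T(1,2) in auto)
qed

text \<open>The strict bound makes level 0 trivial and level 1 free of ghost arcs, which gives the
  induction in \<open>reduction\<close> its start.\<close>

inductive_set dspan :: "'v set \<Rightarrow> nat \<Rightarrow> 'r set" for X n where
  dspan_zero: "0 \<in> dspan X n"
| dspan_step: "awalk v p x \<Longrightarrow> awalk w q x \<Longrightarrow> x \<in> X \<Longrightarrow> length q < n \<Longrightarrow> z \<in> dspan X n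
    \<Longrightarrow> sc k * path v p * ghost w q + z \<in> dspan X n"

lemma dspan_monomial: "awalk v p x \<Longrightarrow> awalk w q x \<Longrightarrow> x \<in> X \<Longrightarrow> length q < n \<Longrightarrow> sc k * path v p * ghost w q \<in> dspan X n"
  using dspan_step[OF _ _ _ _ dspan_zero] by fastforce

lemma dspan_add: "y \<in> dspan X n \<Longrightarrow> z \<in> dspan X n \<Longrightarrow> y + z \<in> dspan X n"
  by (induction rule: dspan.induct) (auto simp: add.assoc intro: dspan_step)

lemma dspan_mono: "y \<in> dspan X n \<Longrightarrow> n \<le> m \<Longrightarrow> y \<in> dspan X m"
  by (induction rule: dspan.induct) (auto intro: dspan_zero dspan_step)

lemma dspan_0: "z \<in> dspan X 0 \<Longrightarrow> z = 0"
  by (induction rule: dspan.induct) auto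

lemma dspan_lspan: "z \<in> dspan X n \<Longrightarrow> z \<in> lspan X"
  by (induction rule: dspan.induct) (auto intro: lspan_zero lspan_step)

lemma lspan_dspan: "z \<in> lspan X \<Longrightarrow> \<exists>n. z \<in> dspan X n"
proof (induction rule: lspan.induct)
  case lspan_zero then show ?case using dspan_zero by blast
next
  case (lspan_step v p x w q z k)
  then obtain n where n: "z \<in> dspan X n" by blast
  then have "z \<in> dspan X (n + Suc (length q))" using dspan_mono by simp
  then show ?case using dspan_step[of v p x w q X "n + Suc (length q)"] lspan_step by auto
qed

lemma rspan_Ed:
  assumes "z \<in> rspan X w" "hereditary G X" "e \<in> arcs G" "tail G e = w" "0 < n"
  shows "z * Ed e \<in> dspan X n"
  using assms(1)
proof (induction rule: rspan.induct)
  case (rspan_step v p z k)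
  have h: "head G e \<in> X" using hereditary_arc assms rspan_step by auto
  have w: "awalk v (p @ [e]) (head G e)" "awalk (head G e) [] (head G e)" "awalk w [e] (head G e)"
    using rspan_step assms by (auto simp: awalk_append_ex awalk_Cons_iff awalk_Nil_iff)
  have "sc k * path v p * Ed e = sc k * path v (p @ [e]) * ghost (head G e) []"
    using path_append[OF rspan_step(1) w(3)] assms(3) by (simp add: mult.assoc Ed_V)
  moreover have "sc k * path v (p @ [e]) * ghost (head G e) [] \<in> dspan X n"
    using dspan_monomial[OF w(1,2) h] assms(5) by simp
  ultimately show ?case using rspan_step dspan_add by (simp add: distrib_right)
qed (simp add: dspan_zero)

text \<open>The first arc \<open>f\<close> of a ghost path at \<open>w\<close> appears as the
  rightmost factor \<open>Gh f\<close>; splitting it off lowers the level. The monomials whose ghost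
  part is empty form \<open>r\<close>.\<close>

lemma dspan_decompose:
  assumes "z \<in> dspan X (Suc n)" "w \<in> verts G"
  obtains r F d where "r \<in> rspan X w" "finite F" "F \<subseteq> out_arcs G w" "\<And>e. d e \<in> dspan X n"
    "\<And>e. e \<in> F \<Longrightarrow> d e * V (head G e) = d e" "z * V w = r + (\<Sum>e\<in>F. d e * Gh e)"
proof -
  \<comment> \<open>Since \<open>d\<close> is kept at 0 off \<open>F\<close>, a new term at
    \<open>f\<close> is added in the same way whether or not \<open>f\<close> was already in
    \<open>F\<close>.\<close>
  have "\<exists>r F d. r \<in> rspan X w \<and> finite F \<and> F \<subseteq> out_arcs G w \<and> (\<forall>e. d e \<in> dspan X n) \<and>
    (\<forall>e\<in>F. d e * V (head G e) = d e) \<and> (\<forall>e. e \<notin> F \<longrightarrow> d e = 0) \<and> z * V w = r + (\<Sum>e\<in>F. d e * Gh e)"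
    using assms(1)
  proof (induction rule: dspan.induct)
    case dspan_zero
    show ?case by (intro exI[of _ 0] exI[of _ "{}"] exI[of _ "\<lambda>_. 0"])
      (auto intro: rspan_zero dspan.dspan_zero)
  next
    case (dspan_step v p x w' q z k)
    then obtain r F d where IH: "r \<in> rspan X w" "finite F" "F \<subseteq> out_arcs G w" "\<And>e. d e \<in> dspan X n"
      "\<And>e. e \<in> F \<Longrightarrow> d e * V (head G e) = d e" "\<And>e. e \<notin> F \<Longrightarrow> d e = 0"
      "z * V w = r + (\<Sum>e\<in>F. d e * Gh e)" by blast
    have e: "(sc k * path v p * ghost w' q + z) * V w =
       (if w = w' then sc k * path v p * ghost w' q else 0) + (r + (\<Sum>e\<in>F. d e * Gh e))"
      using dspan_step assms(2) IH(7) by (auto simp: distrib_right mult.assoc ghost_V_if)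
    show ?case
    proof (cases "w = w'")
      case False
      then show ?thesis using e IH by (intro exI[of _ r] exI[of _ F] exI[of _ d]) auto
    next
      case w: True
      show ?thesis
      proof (cases q)
        case Nil
        then have x: "x = w" using dspan_step w by (simp add: awalk_Nil_iff)
        then have "sc k * path v p * ghost w' q = sc k * path v p"
          using Nil w dspan_step by (simp add: mult.assoc path_V)
        then have "(sc k * path v p * ghost w' q + z) * V w = (sc k * path v p + r) + (\<Sum>e\<in>F. d e * Gh e)"
          using e w by (simp add: add.assoc)
        moreover have "sc k * path v p + r \<in> rspan X w" using dspan_step x IH by (intro rspan_step) auto
        ultimately show ?thesis using IH by (intro exI[of _ "sc k * path v p + r"] exI[of _ F] exI[of _ d]) auto
      next
        case (Cons f q')
        then have f: "f \<in> arcs G" "tail G f = w" "awalk (head G f) q' x" "length q' < n"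
          using dspan_step w by (auto simp: awalk_Cons_iff)
        define m where "m = sc k * path v p * ghost (head G f) q'"
        define d' where "d' = d(f := d f + m)"
        have m: "m \<in> dspan X n" unfolding m_def using dspan_step f by (intro dspan_monomial) auto
        have mV: "m * V (head G f) = m" using f by (simp add: m_def mult.assoc ghost_V)
        have "(\<Sum>e\<in>insert f F. d' e * Gh e) = d' f * Gh f + (\<Sum>e\<in>F - {f}. d e * Gh e)"
          using IH(2) by (simp add: sum.insert_remove d'_def)
        also have "(\<Sum>e\<in>F - {f}. d e * Gh e) = (\<Sum>e\<in>F. d e * Gh e) - d f * Gh f"
          using IH(2,6) by (cases "f \<in> F") (simp_all add: sum_diff1)
        finally have s: "(\<Sum>e\<in>insert f F. d' e * Gh e) = m * Gh f + (\<Sum>e\<in>F. d e * Gh e)"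
          by (simp add: d'_def distrib_right)
        have "(sc k * path v p * ghost w' q + z) * V w = r + (\<Sum>e\<in>insert f F. d' e * Gh e)"
          unfolding e s using w Cons by (simp add: m_def mult.assoc add_ac)
        moreover have "\<And>e. d' e \<in> dspan X n" using IH(4) m dspan_add by (simp add: d'_def)
        moreover have "d' e * V (head G e) = d' e" if "e \<in> insert f F" for e
          using that IH(5,6) mV by (cases "f \<in> F") (auto simp: d'_def distrib_right)
        ultimately show ?thesis using IH f
          by (intro exI[of _ r] exI[of _ "insert f F"] exI[of _ d']) (auto simp: d'_def)
      qed
    qed
  qed
  then show ?thesis using that by blast
qed

text \<open>The closed paths left over by \<open>real_leading_term\<close> start with an arc at
  \<open>w\<close>, which the gap annihilates or sends into \<open>lspan H\<close>. Between two gaps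
  only the scalar term survives.\<close>

lemma reduces_gap:
  assumes H: "hereditary G H" and P: "hereditary G P" and w: "w \<in> P" "w \<notin> H" "\<not> regular_vertex G w"
    and fin: "finite (outer_arcs H w)" and r: "r \<in> rspan P w" "r \<noteq> 0"
  shows "reduces P H (r * gap H w)"
proof -
  have wv: "w \<in> verts G" using w P hereditary_sub by blast
  let ?t = "gap H w"
  obtain T k where T: "finite T" "\<And>v p. (v, p) \<in> T \<Longrightarrow> awalk v p w" "\<And>t. t \<in> T \<Longrightarrow> k t \<noteq> 0"
    "r = (\<Sum>t\<in>T. sc (k t) * path (fst t) (snd t))" using rspan_repr[OF r(1)] by blast
  have "T \<noteq> {}" using T(4) r(2) by auto
  from real_leading_term[OF T(1) this T(2), where k = k] obtain v p T' c where vp: "(v, p) \<in> T" and T': "T' \<subseteq> T"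
    "\<And>t. t \<in> T' \<Longrightarrow> awalk w (c t) w" "\<And>t. t \<in> T' \<Longrightarrow> c t \<noteq> []"
    and y: "ghost v p * r = sc (k (v, p)) * V w + (\<Sum>t\<in>T'. sc (k t) * path w (c t))"
    unfolding T(4) by blast
  define k0 where "k0 = k (v, p)"
  have k0: "k0 \<noteq> 0" using T(3) vp k0_def by simp
  have tc: "?t * path w (c t) \<in> lspan H" if "t \<in> T'" for t
  proof -
    obtain e p' where c: "c t = e # p'" using T'(3)[OF \<open>t \<in> T'\<close>] by (cases "c t") auto
    have e: "e \<in> arcs G" "tail G e = w" "awalk (head G e) p' w" using T'(2)[OF that] c by (auto simp: awalk_Cons_iff)
    show ?thesis
    proof (cases "head G e \<in> H")
      case True
      then have "?t * Ed e * path (head G e) p' \<in> lspan H"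
        using e H wv by (intro lspan_right_mult[OF H] lspan_left_mult[OF H] path_L gap_L Ed_lspan)
      then show ?thesis by (simp add: c mult.assoc)
    next
      case False
      then have "?t * Ed e = 0" using e by (intro gap_Ed[OF fin]) (simp add: outer_arcs_def)
      then show ?thesis by (simp add: c mult.assoc[symmetric] lspan_zero)
    qed
  qed
  have gt: "?t * sc k = sc k * ?t" for k using gap_L[OF wv] sc_central by blast
  have "?t * (\<Sum>t\<in>T'. sc (k t) * path w (c t)) * ?t \<in> lspan H"
  proof -
    have "?t * (\<Sum>t\<in>T'. sc (k t) * path w (c t)) = (\<Sum>t\<in>T'. sc (k t) * (?t * path w (c t)))"
      unfolding sum_distrib_left using gt by (intro sum.cong refl) (metis mult.assoc)
    also have "\<dots> \<in> lspan H" using tc by (intro lspan_sum sc_lspan)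
    finally show ?thesis using lspan_right_mult[OF H gap_L[OF wv]] by blast
  qed
  moreover have "?t * (ghost v p * r) * ?t - sc k0 * ?t = ?t * (\<Sum>t\<in>T'. sc (k t) * path w (c t)) * ?t"
  proof -
    have "?t * (sc k0 * V w) * ?t = sc k0 * (?t * V w * ?t)" using gt by (metis mult.assoc)
    then show ?thesis unfolding y k0_def[symmetric]
      using gap_idem[OF fin wv] gap_V[OF wv] by (simp add: distrib_left distrib_right)
  qed
  ultimately have "sc (inverse k0) * (?t * (ghost v p * r) * ?t - sc k0 * ?t) \<in> lspan H"
    using sc_lspan by simp
  moreover have "sc (inverse k0) * (sc k0 * ?t) = ?t"
    using sc_inverse[OF wv k0] V_gap[OF wv] by (metis mult.assoc)
  ultimately have *: "(sc (inverse k0) * ?t * ghost v p) * (r * ?t) * V w - ?t \<in> lspan H"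
    using gap_V[OF wv] by (simp add: right_diff_distrib mult.assoc)
  show ?thesis
  proof (rule reducesI[OF _ V_L[OF wv] *])
    show "sc (inverse k0) * ?t * ghost v p \<in> L"
      using L_mult sc_lspan gap_L[OF wv] ghost_L[OF T(2)[OF vp]] by blast
    show "terminal P H ?t" unfolding terminal_def using w fin by blast
  qed
qed

text \<open>Right multiplication by an arc lowers the ghost length, so induction applies unless
  every \<open>a * Ed e\<close> lies in \<open>lspan H\<close>. In that case \<open>d e\<close> is
  congruent to \<open>- (r * Ed e)\<close>, hence \<open>a * V w\<close> to the product of
  \<open>r\<close> with \<open>V w\<close> minus the sum of \<open>Ed e * Gh e\<close> over
  \<open>F\<close>. The arcs at \<open>w\<close> then decide between a contradiction, a gap and a
  ghost-free element.\<close>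

theorem reduction:
  assumes H: "hereditary G H" "saturated G H" and P: "hereditary G P"
    and a: "a \<in> lspan P" "a \<notin> lspan H"
  shows "reduces P H a"
proof -
  obtain n where "a \<in> dspan P n" using lspan_dspan[OF a(1)] by blast
  then show ?thesis using a(2)
  proof (induction n arbitrary: a)
    case 0
    then show ?case using dspan_0 lspan_zero by blast
  next
    case (Suc n)
    note I = lideal_lspan[OF H(1)]
    have aL: "a \<in> L" using dspan_lspan[OF Suc.prems(1)] lspan_mono hereditary_sub[OF P] by blast
    obtain w where w: "w \<in> verts G" "a * V w \<notin> lspan H" using not_mem_vertex[OF I aL Suc.prems(2)] by blast
    obtain r F d where r: "r \<in> rspan P w" and F: "finite F" "F \<subseteq> out_arcs G w"
      and d: "\<And>e. d e \<in> dspan P n" "\<And>e. e \<in> F \<Longrightarrow> d e * V (head G e) = d e"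
      and aw: "a * V w = r + (\<Sum>e\<in>F. d e * Gh e)"
      using dspan_decompose[OF Suc.prems(1) w(1)] by blast
    have right: "reduces P H a" if ry: "reduces P H (a * y)" "y \<in> L" for y
    proof -
      obtain z z' t where "z \<in> L" "z' \<in> L" "z * (a * y) * z' - t \<in> lspan H" "terminal P H t"
        using ry(1) unfolding reduces_def by blast
      then show ?thesis using ry(2) L_mult reducesI[of z "y * z'" a t H P] by (simp add: mult.assoc)
    qed
    have ae: "a * Ed e = r * Ed e + (if e \<in> F then d e else 0)" if e: "e \<in> out_arcs G w" for e
    proof -
      have "(\<Sum>f\<in>F. d f * Gh f) * Ed e = (\<Sum>f\<in>F. if f = e then d e else 0)"
        unfolding sum_distrib_right using e d(2) F
        by (intro sum.cong) (auto simp: mult.assoc Gh_Ed)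
      then have "a * V w * Ed e = r * Ed e + (if e \<in> F then d e else 0)"
        using F by (simp add: aw distrib_right)
      then show ?thesis using e V_Ed[of e] by (simp add: mult.assoc)
    qed
    show ?case
    proof (cases "n = 0")
      case True
      then have "a * V w = r" using aw d(1) dspan_0 by (metis (no_types, lifting) add.right_neutral mult_zero_left sum.neutral)
      then have r0: "r \<notin> lspan H" using w by simp
      then have "r \<noteq> 0" using lspan_zero by blast
      then have wP: "w \<in> P" using rspan_empty[OF r] by blast
      have "w \<notin> H" using r0 lspan_left_mult[OF H(1) rspan_L[OF r] V_lspan[OF _ w(1)]] rspan_V[OF r] by metis
      obtain T k where T: "finite T" "\<And>v p. (v, p) \<in> T \<Longrightarrow> awalk v p w" "\<And>t. t \<in> T \<Longrightarrow> k t \<noteq> 0"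
        "r = (\<Sum>t\<in>T. sc (k t) * path (fst t) (snd t))" using rspan_repr[OF r] by blast
      have "T \<noteq> {}" using T(4) \<open>r \<noteq> 0\<close> by auto
      then have "reduces P H r" unfolding T(4)
        by (intro reduces_real[OF H(1) P wP \<open>w \<notin> H\<close> T(1)]) (use T(2,3) in auto)
      then show ?thesis using right V_L[OF w(1)] \<open>a * V w = r\<close> by metis
    next
      case False
      \<comment> \<open>The product \<open>r * Ed e\<close> has an empty ghost part and so belongs
        to level 1; this is why \<open>n = 0\<close> is treated separately.\<close>
      have aed: "a * Ed e \<in> dspan P n" if e: "e \<in> out_arcs G w" for e
        using ae[OF e] rspan_Ed[OF r P, of e n] d(1)[of e] dspan_add dspan_zero e False by auto
      show ?thesis
      proof (cases "\<exists>e\<in>out_arcs G w. a * Ed e \<notin> lspan H")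
        case True
        then obtain e where e: "e \<in> out_arcs G w" "a * Ed e \<notin> lspan H" by blast
        then have "reduces P H (a * Ed e)" using Suc.IH aed by blast
        then show ?thesis using right Ed_L e(1) by auto
      next
        case False
        then have ain: "\<And>e. e \<in> out_arcs G w \<Longrightarrow> a * Ed e \<in> lspan H" by blast
        have key: "a * V w - (r - (\<Sum>e\<in>F. r * Ed e * Gh e)) \<in> lspan H"
        proof -
          have "a * V w - (r - (\<Sum>e\<in>F. r * Ed e * Gh e)) = (\<Sum>e\<in>F. (r * Ed e + d e) * Gh e)"
            by (simp add: aw distrib_right sum.distrib)
          also have "\<dots> = (\<Sum>e\<in>F. a * Ed e * Gh e)"
            using ae F by (intro sum.cong refl) (simp add: subset_iff)
          also have "\<dots> \<in> lspan H" using F by (intro lspan_sum lspan_right_mult[OF H(1) Gh_L ain]) auto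
          finally show ?thesis .
        qed
        have rL: "r \<in> L" using rspan_L[OF r] .
        have r0: "r \<notin> lspan H"
        proof
          assume "r \<in> lspan H"
          then have "r - (\<Sum>e\<in>F. r * Ed e * Gh e) \<in> lspan H"
            using F by (intro lspan_diff lspan_sum lspan_right_mult[OF H(1)] Ed_L Gh_L) auto
          then show False using lideal_minus_iff[OF I key] w by blast
        qed
        then have "r \<noteq> 0" using lspan_zero by blast
        then have wP: "w \<in> P" using rspan_empty[OF r] by blast
        have wH: "w \<notin> H" using r0 lspan_left_mult[OF H(1) rL V_lspan[OF _ w(1)]] rspan_V[OF r] by metis
        have rout: "r * Ed e \<in> lspan H" if "e \<in> out_arcs G w" "e \<notin> F" for e
          using ae[OF that(1)] ain[OF that(1)] that by simp
        have rin: "r * Ed e \<in> lspan H" if "e \<in> out_arcs G w" "head G e \<in> H" for e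
          using that lspan_left_mult[OF H(1) rL Ed_lspan[OF _ H(1)]] by auto
        \<comment> \<open>At a regular vertex, the sum relation turns the expression in
          \<open>key\<close> into a sum over the arcs outside \<open>F\<close>, where
          \<open>r * Ed e\<close> equals \<open>a * Ed e\<close>.\<close>
        have nreg: "\<not> regular_vertex G w"
        proof
          assume reg: "regular_vertex G w"
          then have fin: "finite (out_arcs G w)" by (simp add: regular_vertex_def)
          have "r = (\<Sum>e\<in>out_arcs G w. r * Ed e * Gh e)"
            using rspan_V[OF r] V_regular[OF reg] by (metis (no_types, lifting) mult.assoc sum.cong sum_distrib_left)
          then have "r - (\<Sum>e\<in>F. r * Ed e * Gh e) = (\<Sum>e\<in>out_arcs G w - F. r * Ed e * Gh e)"
            using sum_diff[OF fin F(2), of "\<lambda>e. r * Ed e * Gh e"] by simp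
          also have "\<dots> \<in> lspan H" by (intro lspan_sum lspan_right_mult[OF H(1) Gh_L rout]) auto
          finally show False using lideal_minus_iff[OF I key] w by blast
        qed
        show ?thesis
        proof (cases "finite (outer_arcs H w)")
          case fin: True
          let ?S = "outer_arcs H w"
          \<comment> \<open>The two finite sets differ only in arcs with \<open>r * Ed e\<close> in
            \<open>lspan H\<close>, so modulo \<open>lspan H\<close> the sum over \<open>F\<close>
            may be replaced by the one in \<open>gap H w\<close>.\<close>
          have "(\<Sum>e\<in>F. r * Ed e * Gh e) - (\<Sum>e\<in>?S. r * Ed e * Gh e) =
            (\<Sum>e\<in>F - ?S. r * Ed e * Gh e) - (\<Sum>e\<in>?S - F. r * Ed e * Gh e)"
            using sum.Int_Diff[OF F(1), of "\<lambda>e. r * Ed e * Gh e" ?S] sum.Int_Diff[OF fin, of "\<lambda>e. r * Ed e * Gh e" F]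
            by (simp add: Int_commute)
          also have "\<dots> \<in> lspan H"
          proof (intro lspan_diff lspan_sum)
            show "r * Ed e * Gh e \<in> lspan H" if "e \<in> F - ?S" for e
              using that F by (intro lspan_right_mult[OF H(1) Gh_L rin]) (auto simp: outer_arcs_def)
            show "r * Ed e * Gh e \<in> lspan H" if "e \<in> ?S - F" for e
              using that by (intro lspan_right_mult[OF H(1) Gh_L rout]) (auto simp: outer_arcs_def)
          qed
          finally have "(a * V w - (r - (\<Sum>e\<in>F. r * Ed e * Gh e))) -
              ((\<Sum>e\<in>F. r * Ed e * Gh e) - (\<Sum>e\<in>?S. r * Ed e * Gh e)) \<in> lspan H"
            using key lspan_diff by blast
          moreover have "r * gap H w = r - (\<Sum>e\<in>?S. r * Ed e * Gh e)"
            using rspan_V[OF r] by (simp add: gap_def right_diff_distrib sum_distrib_left mult.assoc)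
          moreover have "x - (r - s) - (s - t) = x - (r - t)" for x s t :: 'r by simp
          ultimately have "a * V w - r * gap H w \<in> lspan H" by simp
          then have "reduces P H (a * V w)"
            using reduces_cong[OF H(1)] reduces_gap[OF H(1) P wP wH nreg fin r \<open>r \<noteq> 0\<close>] by blast
          then show ?thesis using right V_L[OF w(1)] by blast
        next
          case False
          \<comment> \<open>An arc outside the finite set \<open>F\<close> meets no ghost term, so
            \<open>a * Ed e\<close> is the ghost-free element \<open>r * Ed e\<close>.\<close>
          then obtain e where e: "e \<in> outer_arcs H w" "e \<notin> F" using F(1) by (meson finite_subset subsetI)
          then have ea: "e \<in> arcs G" "tail G e = w" "head G e \<notin> H" by (auto simp: outer_arcs_def)
          obtain T k where T: "finite T" "\<And>v p. (v, p) \<in> T \<Longrightarrow> awalk v p w" "\<And>t. t \<in> T \<Longrightarrow> k t \<noteq> 0"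
            "r = (\<Sum>t\<in>T. sc (k t) * path (fst t) (snd t))" using rspan_repr[OF r] by blast
          have "T \<noteq> {}" using T(4) \<open>r \<noteq> 0\<close> by auto
          define T' where "T' = (\<lambda>t. (fst t, snd t @ [e])) ` T"
          define k' where "k' = (\<lambda>t. k (fst t, butlast (snd t)))"
          have we: "awalk w [e] (head G e)" using ea by (auto simp: awalk_Cons_iff awalk_Nil_iff)
          have "r * Ed e = (\<Sum>t\<in>T. sc (k t) * path (fst t) (snd t @ [e]))"
            unfolding T(4) sum_distrib_right
          proof (intro sum.cong refl)
            fix t assume "t \<in> T"
            then have "awalk (fst t) (snd t) w" using T(2) by simp
            from path_append[OF this we] show "sc (k t) * path (fst t) (snd t) * Ed e = sc (k t) * path (fst t) (snd t @ [e])"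
              using ea by (simp add: Ed_V mult.assoc)
          qed
          also have "\<dots> = (\<Sum>t\<in>T'. sc (k' t) * path (fst t) (snd t))"
            unfolding T'_def by (subst sum.reindex) (auto simp: inj_on_def k'_def)
          finally have re: "a * Ed e = (\<Sum>t\<in>T'. sc (k' t) * path (fst t) (snd t))"
            using ae[of e] e ea by simp
          have "reduces P H (a * Ed e)" unfolding re
          proof (rule reduces_real[OF H(1) P _ ea(3)])
            show "head G e \<in> P" using hereditary_arc[OF P] ea wP by blast
            show "finite T'" "T' \<noteq> {}" using T \<open>T \<noteq> {}\<close> by (auto simp: T'_def)
            show "awalk v p (head G e)" if "(v, p) \<in> T'" for v p
              using that by (auto simp: T'_def intro: awalk_appendI[OF T(2) we])
            show "k' t \<noteq> 0" if "t \<in> T'" for t using that T(3) by (auto simp: T'_def k'_def)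
          qed
          then show ?thesis using right Ed_L ea by blast
        qed
      qed
    qed
  qed
qed

end

section \<open>The ideal generated by \<open>P_ppi\<close> is purely infinite\<close>

context wf_digraph
begin

text \<open>If the witnessing set were contained in \<open>H\<close>, so would be its closure, and
  with it \<open>v\<close>.\<close>

lemma properly_infinite_connects:
  assumes "v \<in> properly_infinite_vertices G" "hereditary G H" "saturated G H" "v \<notin> H"
  obtains q w c d where "awalk v q w" "w \<notin> H" "c \<in> CSP w" "d \<in> CSP w" "c \<noteq> d"
proof -
  from assms(1) obtain W where W: "W \<subseteq> descendants G v"
    "\<And>w. w \<in> W \<Longrightarrow> infinite (CSP w) \<or> card (CSP w) \<ge> 2" "v \<in> hereditary_saturated_closure G W"
    unfolding properly_infinite_vertices_def by blast
  have "\<not> W \<subseteq> H" using W(3) assms unfolding hereditary_saturated_closure_def by blast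
  then obtain w where w: "w \<in> W" "w \<notin> H" by blast
  have "\<exists>c\<in>CSP w. \<exists>d\<in>CSP w. c \<noteq> d"
  proof (rule ccontr)
    assume "\<not> ?thesis"
    then have eq: "\<forall>c\<in>CSP w. \<forall>d\<in>CSP w. c = d" by blast
    have "finite (CSP w) \<and> card (CSP w) \<le> 1"
    proof (cases "CSP w = {}")
      case False
      then obtain c where "CSP w = {c}" using eq by blast
      then show ?thesis by simp
    qed simp
    then show False using W(2)[OF w(1)] by linarith
  qed
  moreover obtain q where "awalk v q w" using W(1) w descendants_iff by blast
  ultimately show ?thesis using that w by blast
qed

lemma P_ppi_sub: "P_ppi G \<subseteq> properly_infinite_vertices G" "P_ppi G \<inter> breaking_vertices G = {}"
  unfolding P_ppi_def using self_descendant by blast+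

lemma hereditary_P_ppi: "hereditary G (P_ppi G)"
proof -
  have "u \<in> P_ppi G" if "v \<in> P_ppi G" "u \<in> descendants G v" for u v
  proof -
    have "descendants G u \<subseteq> descendants G v" using that(2) descendants_trans by blast
    moreover have "u \<in> verts G" using that(2) by (simp add: descendants_def)
    ultimately show ?thesis using that(1) unfolding P_ppi_def by blast
  qed
  moreover have "P_ppi G \<subseteq> verts G" unfolding P_ppi_def by blast
  ultimately show ?thesis unfolding hereditary_def by blast
qed

lemma descendants_unfold: "u \<in> descendants G v \<Longrightarrow> u = v \<or> (\<exists>e\<in>out_arcs G v. u \<in> descendants G (head G e))"
proof -
  assume "u \<in> descendants G v"
  then obtain p where "awalk v p u" using descendants_iff by blast
  then show ?thesis by (cases p) (auto simp: awalk_Cons_iff awalk_Nil_iff descendants_iff)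
qed

text \<open>A regular vertex has finitely many successors, whose finite witnessing sets unite to a
  finite one for the vertex itself. Being no infinite emitter, it is not breaking either.\<close>

lemma saturated_P_ppi: "saturated G (P_ppi G)"
  unfolding saturated_def
proof (intro conjI allI impI)
  show "P_ppi G \<subseteq> verts G" by (auto simp: P_ppi_def)
  fix v assume reg: "regular_vertex G v" and h: "head G ` out_arcs G v \<subseteq> P_ppi G"
  have v: "v \<in> verts G" "finite (out_arcs G v)" using reg by (auto simp: regular_vertex_def)
  have "\<exists>W. finite W \<and> W \<subseteq> descendants G (head G e) \<and>
        (\<forall>w \<in> W. infinite (CSP w) \<or> card (CSP w) \<ge> 2) \<and> head G e \<in> hereditary_saturated_closure G W"
    if "e \<in> out_arcs G v" for e
    using h P_ppi_sub(1) that unfolding properly_infinite_vertices_def by blast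
  then obtain W where W: "\<And>e. e \<in> out_arcs G v \<Longrightarrow> finite (W e)"
    "\<And>e. e \<in> out_arcs G v \<Longrightarrow> W e \<subseteq> descendants G (head G e)"
    "\<And>e w. e \<in> out_arcs G v \<Longrightarrow> w \<in> W e \<Longrightarrow> infinite (CSP w) \<or> card (CSP w) \<ge> 2"
    "\<And>e. e \<in> out_arcs G v \<Longrightarrow> head G e \<in> hereditary_saturated_closure G (W e)" by metis
  have dv: "descendants G (head G e) \<subseteq> descendants G v" if "e \<in> out_arcs G v" for e
    using descendants_trans that arc_implies_awalk descendants_iff by (metis in_out_arcs_conv subsetI)
  have "v \<in> hereditary_saturated_closure G (\<Union>e\<in>out_arcs G v. W e)"
    unfolding hereditary_saturated_closure_def
  proof (intro InterI, elim CollectE conjE)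
    fix H assume H: "hereditary G H" "saturated G H" "(\<Union>e\<in>out_arcs G v. W e) \<subseteq> H"
    have "head G e \<in> H" if "e \<in> out_arcs G v" for e
      using W(4)[OF that] H that unfolding hereditary_saturated_closure_def by blast
    then show "v \<in> H" using H(2) reg unfolding saturated_def by blast
  qed
  then have "v \<in> properly_infinite_vertices G" unfolding properly_infinite_vertices_def
    using v W(1-3) dv by (intro CollectI conjI exI[of _ "\<Union>e\<in>out_arcs G v. W e"]) blast+
  moreover have "v \<notin> breaking_vertices G"
    using reg by (auto simp: breaking_vertices_def breaking_vertices_of_def regular_vertex_def infinite_emitter_def)
  ultimately have vv: "v \<in> properly_infinite_vertices G - breaking_vertices G" by blast
  have "u \<in> properly_infinite_vertices G - breaking_vertices G" if "u \<in> descendants G v" for u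
    using descendants_unfold[OF that] vv h unfolding P_ppi_def by blast
  then show "v \<in> P_ppi G" unfolding P_ppi_def using v by blast
qed

end

context lpa_family
begin

text \<open>Multipliers serve as a unitization of the algebra.\<close>

definition multipliers :: "'r set" where
  "multipliers = {m. \<forall>X. hereditary G X \<longrightarrow> (\<forall>z\<in>lspan X. m * z \<in> lspan X \<and> z * m \<in> lspan X)}"

sublocale mul: unital_subring multipliers
proof
  fix x y assume "x \<in> multipliers" "y \<in> multipliers"
  then show "x + y \<in> multipliers" "x * y \<in> multipliers"
    unfolding multipliers_def by (auto simp: distrib_left distrib_right mult.assoc lspan_add)
      (auto simp: mult.assoc[symmetric])
qed (auto simp: multipliers_def lspan_uminus)

lemma L_multipliers: "z \<in> L \<Longrightarrow> z \<in> multipliers"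
  unfolding multipliers_def using lspan_left_mult lspan_right_mult by blast

lemma V_head_conj: "e \<in> arcs G \<Longrightarrow> V (head G e) = Gh e * V (tail G e) * Ed e"
  by (simp add: mult.assoc V_Ed Gh_Ed)

lemma V_regular_conj: "regular_vertex G v \<Longrightarrow> V v = (\<Sum>e\<in>out_arcs G v. Ed e * V (head G e) * Gh e)"
  by (simp add: V_regular Ed_V)

lemma sum_absorbed: "(\<And>i. i \<in> A \<Longrightarrow> f i \<in> mul.absorbed a) \<Longrightarrow> sum f A \<in> mul.absorbed a"
  by (induction A rule: infinite_finite_induct) (auto intro: mul.zero_absorbed mul.add_absorbed)

lemma ghost_path_CSP: "c \<in> CSP w \<Longrightarrow> d \<in> CSP w \<Longrightarrow> c \<noteq> d \<Longrightarrow> ghost w c * path w d = 0"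
  using ghost_path_parallel CSP_awalk CSP_prefix_eq by metis

lemma absorbed_self:
  assumes P: "hereditary G P" "saturated G P" "P \<subseteq> properly_infinite_vertices G" "P \<inter> breaking_vertices G = {}"
    and a: "a \<in> lspan P"
  shows "a \<in> mul.absorbed a"
proof (rule ccontr)
  assume na: "a \<notin> mul.absorbed a"
  let ?K = "mul.absorbed a"
  define H where "H = {v \<in> P. V v \<in> ?K}"
  have Pv: "P \<subseteq> verts G" using P hereditary_sub by blast
  have mulK: "x \<in> ?K \<Longrightarrow> r \<in> L \<Longrightarrow> s \<in> L \<Longrightarrow> r * x * s \<in> ?K" for x r s
    using mul.mult_absorbed L_multipliers by blast
  have hH: "hereditary G H"
  proof (rule hereditaryI)
    show "H \<subseteq> verts G" using Pv by (auto simp: H_def)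
    fix e assume e: "e \<in> arcs G" "tail G e \<in> H"
    then show "head G e \<in> H" using hereditary_arc[OF P(1) e(1)] V_head_conj[OF e(1)]
      mulK[OF _ Gh_L Ed_L, of "V (tail G e)" e e] by (auto simp: H_def)
  qed
  have sH: "saturated G H" unfolding saturated_def
  proof (intro conjI allI impI)
    show "H \<subseteq> verts G" using Pv by (auto simp: H_def)
    fix v assume v: "regular_vertex G v" "head G ` out_arcs G v \<subseteq> H"
    have "V (head G e) \<in> ?K" if "e \<in> out_arcs G v" for e
      using subsetD[OF v(2) imageI[OF that]] by (simp add: H_def)
    then have "V v \<in> ?K" unfolding V_regular_conj[OF v(1)]
      by (intro sum_absorbed mulK Ed_L Gh_L) auto
    moreover have "v \<in> P"
      using subset_trans[OF v(2), of P] v(1) P(2) unfolding saturated_def H_def by blast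
    ultimately show "v \<in> H" by (simp add: H_def)
  qed
  have "lideal (?K \<inter> L)" unfolding lideal_def
    using mul.mult_absorbed[OF _ mul.one_mem L_multipliers] mul.mult_absorbed[OF _ L_multipliers mul.one_mem]
    by (auto simp: lspan_zero lspan_add lspan_uminus mul.zero_absorbed mul.add_absorbed mul.uminus_absorbed L_mult)
  \<comment> \<open>Congruences modulo \<open>lspan H\<close> thereby become congruences modulo
    absorbed elements, as \<open>absorbed_infinite_idempotent\<close> takes them.\<close>
  then have HK: "lspan H \<subseteq> ?K" using lspan_least[of "?K \<inter> L" H] Pv V_L by (auto simp: H_def)
  have "reduces P H a" using reduction[OF hH sH P(1) a] na HK by blast
  then obtain z z' t where z: "z \<in> L" "z' \<in> L" "z * a * z' - t \<in> lspan H" and t: "terminal P H t"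
    unfolding reduces_def by blast
  have connect: thesis if "v \<in> P" "v \<notin> H" "\<And>q w c d. awalk v q w \<Longrightarrow> w \<notin> H \<Longrightarrow> w \<in> P \<Longrightarrow>
     c \<in> CSP w \<Longrightarrow> d \<in> CSP w \<Longrightarrow> c \<noteq> d \<Longrightarrow> thesis" for v thesis
    using properly_infinite_connects[OF _ hH sH that(2)] that P(1,3) hereditary_awalk by (metis subsetD)
  from t consider v where "v \<in> P - H" "t = V v"
    | v where "v \<in> P - H" "\<not> regular_vertex G v" "finite (outer_arcs H v)"
    | u c where "u \<in> P - H" "c \<in> CSP u" "no_exit H u c" unfolding terminal_def by blast
  then show False
  proof cases
    case 1
    obtain q w c d where w: "awalk v q w" "w \<notin> H" "w \<in> P" "c \<in> CSP w" "d \<in> CSP w" "c \<noteq> d"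
      by (rule connect[of v]) (use 1 that in \<open>auto\<close>)
    note wc = CSP_awalk[OF w(4)] and wd = CSP_awalk[OF w(5)]
    have "V w \<in> ?K"
    proof (rule mul.absorbed_infinite_idempotent[where \<alpha> = "ghost v q * z" and \<beta> = "z' * path v q"])
      show "a \<in> multipliers" using a Pv lspan_mono L_multipliers by blast
      show "V w \<in> multipliers" using w(3) Pv V_L L_multipliers by blast
      show "path w c \<in> multipliers" "ghost w c \<in> multipliers" "path w d \<in> multipliers" "ghost w d \<in> multipliers"
        using path_L ghost_L wc wd L_multipliers by blast+
      show "ghost v q * z \<in> multipliers" "z' * path v q \<in> multipliers"
        using path_L ghost_L w(1) z L_mult L_multipliers by blast+
      show "ghost w c * path w c = V w" "ghost w d * path w d = V w"
        using ghost_path wc wd by blast+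
      show "ghost w c * path w d = 0" "ghost w d * path w c = 0" using ghost_path_CSP w by metis+
      show "V w * path w c = path w c" "V w * path w d = path w d" using V_path wc wd by blast+
      show "ghost w c * V w = ghost w c" "ghost w d * V w = ghost w d" using ghost_V wc wd by blast+
      show "V w * (ghost v q * z) = ghost v q * z" using V_ghost[OF w(1)] by (simp add: mult.assoc[symmetric])
      show "z' * path v q * V w = z' * path v q" using path_V[OF w(1)] by (simp add: mult.assoc)
      have "ghost v q * (z * a * z' - t) * path v q \<in> ?K"
        using mulK z(3) HK ghost_L path_L w(1) by blast
      moreover have "ghost v q * V v * path v q = V w" using V_path[OF w(1)] ghost_path[OF w(1)] by (simp add: mult.assoc)
      ultimately show "ghost v q * z * a * (z' * path v q) - V w \<in> ?K"
        by (simp add: 1(2) right_diff_distrib left_diff_distrib mult.assoc)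
    qed
    then show False using w by (simp add: H_def)
  next
    case 2
    obtain q w c where w: "awalk v q w" "w \<notin> H" "c \<in> CSP w"
      by (rule connect[of v]) (use 2 that in \<open>auto\<close>)
    \<comment> \<open>Even if \<open>q\<close> is empty, the nonempty path \<open>c\<close> provides
      an arc from \<open>v\<close> towards \<open>w\<close>. It is outer, and being singular with
      finitely many outer arcs, \<open>v\<close> is a breaking vertex of \<open>H\<close>.\<close>
    obtain e p where e: "q @ c = e # p" using CSP_nonempty[OF w(3)] by (cases "q @ c") auto
    have "awalk v (e # p) w" using awalk_appendI[OF w(1) CSP_awalk[OF w(3)]] e by simp
    then have e': "e \<in> arcs G" "tail G e = v" "awalk (head G e) p w" by (auto simp: awalk_Cons_iff)
    then have "head G e \<notin> H" using hereditary_awalk[OF hH _ e'(3)] w(2) by blast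
    then have "e \<in> outer_arcs H v" using e' by (simp add: outer_arcs_def)
    moreover have "infinite_emitter G v" using 2 Pv e'
      by (auto simp: regular_vertex_def infinite_emitter_def)
    ultimately have "v \<in> breaking_vertices_of G H"
      using 2 Pv by (auto simp: breaking_vertices_of_def outer_arcs_def)
    then show False using P(4) 2 hH sH by (auto simp: breaking_vertices_def)
  next
    case 3
    obtain q w c' d where w: "awalk u q w" "w \<notin> H" "c' \<in> CSP w" "d \<in> CSP w" "c' \<noteq> d"
      by (rule connect[of u]) (use 3 that in \<open>auto\<close>)
    have "awalk u (q @ c') w" "awalk u (q @ d) w" using w CSP_awalk awalk_appendI by blast+
    then obtain m n where m: "prefix (q @ c') (pow_path c m)" and n: "prefix (q @ d) (pow_path c n)"
      using 3(3) w(2) unfolding no_exit_def by blast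
    \<comment> \<open>Both paths run along powers of the same cycle and are comparable, unlike two
      distinct closed simple paths.\<close>
    have "prefix (q @ c') (pow_path c (m + n))" using m by (simp add: pow_path_add)
    moreover have "prefix (q @ d) (pow_path c (n + m))" using n by (simp add: pow_path_add)
    ultimately have "prefix c' d \<or> prefix d c'" using prefix_same_cases by (metis add.commute same_prefix_prefix)
    then show False using CSP_prefix_eq w by metis
  qed
qed

text \<open>Splitting \<open>n\<close> orthogonal copies of \<open>a\<close> off \<open>a\<close> at
  once collapses the double sum to its diagonal. The factors \<open>x i\<close> and
  \<open>y i\<close> carry the multipliers back into \<open>lspan P\<close>.\<close>

theorem absorb_products:
  fixes n :: nat
  assumes P: "hereditary G P" "saturated G P" "P \<subseteq> properly_infinite_vertices G" "P \<inter> breaking_vertices G = {}"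
    and a: "a \<in> lspan P" and xy: "\<And>i. i < n \<Longrightarrow> x i \<in> lspan P" "\<And>i. i < n \<Longrightarrow> y i \<in> lspan P"
  shows "\<exists>s\<in>lspan P. \<exists>t\<in>lspan P. (\<Sum>i<n. x i * a * y i) = s * a * t"
proof -
  from mul.absorbed_family[of n "\<lambda>_. a" a] absorbed_self[OF assms(1-5)]
  obtain \<gamma> \<delta> where M: "\<And>i. i < n \<Longrightarrow> \<gamma> i \<in> multipliers" "\<And>i. i < n \<Longrightarrow> \<delta> i \<in> multipliers"
    and e: "\<And>i j. i < n \<Longrightarrow> j < n \<Longrightarrow> \<gamma> i * a * \<delta> j = (if i = j then a else 0)" by blast
  let ?s = "\<Sum>i<n. x i * \<gamma> i" and ?t = "\<Sum>j<n. \<delta> j * y j"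
  have "?s * a * ?t = (\<Sum>i<n. \<Sum>j<n. x i * (\<gamma> i * a * \<delta> j) * y j)"
    by (simp add: sum_distrib_left sum_distrib_right mult.assoc) (rule sum.swap)
  also have "\<dots> = (\<Sum>i<n. \<Sum>j<n. if j = i then x i * a * y i else 0)"
    by (intro sum.cong refl) (auto simp: e)
  also have "\<dots> = (\<Sum>i<n. x i * a * y i)" by simp
  finally have eq: "(\<Sum>i<n. x i * a * y i) = ?s * a * ?t" by simp
  have "?s \<in> lspan P" "?t \<in> lspan P"
    using M xy P(1) by (auto intro!: lspan_sum simp: multipliers_def)
  then show ?thesis using eq by blast
qed

text \<open>For a vertex \<open>w\<close> outside \<open>I\<close> on two closed simple paths
  \<open>c\<close> and \<open>d\<close>, \<open>ghost w c\<close> and \<open>path w d\<close> have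
  product 0. Neither lies in \<open>I\<close>, because \<open>ghost w c * path w c\<close> and
  \<open>ghost w d * path w d\<close> both equal \<open>V w\<close>. No quotient can therefore be a
  division ring.\<close>

theorem zero_divisors_mod_ideal:
  assumes P: "hereditary G P" "saturated G P" "P \<subseteq> properly_infinite_vertices G"
    and I: "I \<subseteq> lspan P" "0 \<in> I" "\<And>x y. x \<in> I \<Longrightarrow> y \<in> I \<Longrightarrow> x + y \<in> I"
      "\<And>x y. x \<in> I \<Longrightarrow> y \<in> lspan P \<Longrightarrow> x * y \<in> I" "\<And>x y. x \<in> I \<Longrightarrow> y \<in> lspan P \<Longrightarrow> y * x \<in> I"
      and proper: "I \<noteq> lspan P"
  shows "\<exists>x\<in>lspan P - I. \<exists>y\<in>lspan P - I. x * y = 0"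
proof -
  have Pv: "P \<subseteq> verts G" using P hereditary_sub by blast
  have VP: "V v \<in> lspan P" if "v \<in> P" for v using that V_lspan Pv by blast
  \<comment> \<open>As \<open>I\<close> is an ideal of \<open>lspan P\<close> only, every factor
    used below has to be placed in \<open>lspan P\<close>.\<close>
  have pathP: "path v p \<in> lspan P" "ghost v p \<in> lspan P" "sc k * path v p \<in> lspan P"
    if w: "awalk v p x" and x: "x \<in> P" for v p x k
  proof -
    have "path v p * V x \<in> lspan P" "V x * ghost v p \<in> lspan P" "sc k * path v p * V x \<in> lspan P"
      using lspan_left_mult[OF P(1) _ VP[OF x]] lspan_right_mult[OF P(1) _ VP[OF x]] path_L[OF w] ghost_L[OF w] sc_path_L[OF w]
      by blast+
    then show "path v p \<in> lspan P" "ghost v p \<in> lspan P" "sc k * path v p \<in> lspan P"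
      using path_V[OF w] V_ghost[OF w] by (simp_all add: mult.assoc)
  qed
  have EdP: "Ed e \<in> lspan P" "Gh e \<in> lspan P" if "e \<in> arcs G" "head G e \<in> P" for e
    using pathP[OF arc_implies_awalk[OF that(1)] that(2)] that by (simp_all add: Ed_V V_Gh)
  have Isum: "(\<And>i. i \<in> A \<Longrightarrow> f i \<in> I) \<Longrightarrow> sum f A \<in> I" for f and A :: "'e set"
    by (induction A rule: infinite_finite_induct) (auto intro: I)
  define H where "H = {v \<in> P. V v \<in> I}"
  have hH: "hereditary G H"
  proof (rule hereditaryI)
    show "H \<subseteq> verts G" using Pv by (auto simp: H_def)
    fix e assume e: "e \<in> arcs G" "tail G e \<in> H"
    then have h: "head G e \<in> P" using hereditary_arc[OF P(1) e(1)] by (simp add: H_def)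
    have "V (head G e) \<in> I" unfolding V_head_conj[OF e(1)]
      using e h by (intro I(4) I(5) EdP) (auto simp: H_def)
    then show "head G e \<in> H" using h by (simp add: H_def)
  qed
  have sH: "saturated G H" unfolding saturated_def
  proof (intro conjI allI impI)
    show "H \<subseteq> verts G" using Pv by (auto simp: H_def)
    fix v assume v: "regular_vertex G v" "head G ` out_arcs G v \<subseteq> H"
    have h: "V (head G e) \<in> I" "head G e \<in> P" if "e \<in> out_arcs G v" for e
      using subsetD[OF v(2) imageI[OF that]] by (simp_all add: H_def)
    have "Ed e * V (head G e) * Gh e \<in> I" if "e \<in> out_arcs G v" for e
      using that h[OF that] by (intro I(4)[OF I(5)] EdP) auto
    then have "V v \<in> I" unfolding V_regular_conj[OF v(1)] by (rule Isum)
    moreover have "v \<in> P"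
      using subset_trans[OF v(2), of P] v(1) P(2) unfolding saturated_def H_def by blast
    ultimately show "v \<in> H" by (simp add: H_def)
  qed
  have "\<exists>v\<in>P. v \<notin> H"
  proof (rule ccontr)
    assume "\<not> ?thesis"
    then have all: "\<And>v. v \<in> P \<Longrightarrow> V v \<in> I" by (auto simp: H_def)
    have "z \<in> I" if "z \<in> lspan P" for z using that
    proof (induction rule: lspan_induct_mono)
      case (monomial k v p x w q)
      have "(sc k * path v p) * V x * ghost w q \<in> I"
        using monomial all pathP by (intro I(4) I(5)) blast+
      then show ?case using monomial by (simp add: mult.assoc V_ghost)
    qed (auto intro: I)
    then show False using proper I(1) by blast
  qed
  then obtain v where v: "v \<in> P" "v \<notin> H" by blast
  then have "v \<in> properly_infinite_vertices G" using P(3) by blast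
  from properly_infinite_connects[OF this hH sH v(2)] obtain q w c d
    where w: "awalk v q w" "w \<notin> H" "c \<in> CSP w" "d \<in> CSP w" "c \<noteq> d" by blast
  have wP: "w \<in> P" using hereditary_awalk[OF P(1) v(1) w(1)] .
  note wc = CSP_awalk[OF w(3)] and wd = CSP_awalk[OF w(4)]
  have Vw: "V w \<notin> I" using w(2) wP by (simp add: H_def)
  have "ghost w c \<notin> I" using Vw I(4)[OF _ pathP(1)[OF wc wP]] ghost_path[OF wc] by metis
  moreover have "path w d \<notin> I" using Vw I(5)[OF _ pathP(2)[OF wd wP]] ghost_path[OF wd] by metis
  moreover have "ghost w c \<in> lspan P" "path w d \<in> lspan P" using pathP wc wd wP by blast+
  ultimately show ?thesis using ghost_path_CSP w by blast
qed

end

section \<open>Additive endomorphisms\<close>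

text \<open>Only additivity is asked for, so that scalars can themselves be elements of the
  ring.\<close>

typedef (overloaded) 'a endo = "{f :: 'a::ab_group_add \<Rightarrow> 'a. \<forall>x y. f (x + y) = f x + f y}"
  morphisms app Endo
  by (intro exI[of _ "\<lambda>_. 0"]) simp

lemma app_add: "app f (x + y) = app f x + app f y"
  using app[of f] by simp

lemma app_zero [simp]: "app f 0 = 0"
  using app_add[of f 0 0] by simp

lemma app_uminus: "app f (- x) = - app f x"
  using app_add[of f x "- x"] by (simp add: eq_neg_iff_add_eq_0 add.commute)

lemma app_diff: "app f (x - y) = app f x - app f y"
  using app_add[of f x "- y"] by (simp add: app_uminus)

lemma app_sum: "app f (sum g A) = (\<Sum>i\<in>A. app f (g i))"
  by (induction A rule: infinite_finite_induct) (auto simp: app_add)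

lemma app_Endo: "(\<And>x y. f (x + y) = f x + f y) \<Longrightarrow> app (Endo f) = f"
  by (simp add: Endo_inverse)

lemma endo_eqI: "(\<And>x. app f x = app g x) \<Longrightarrow> f = g"
  by (metis app_inject ext)

instantiation endo :: (ab_group_add) "{ring, monoid_mult}"
begin

definition zero_endo :: "'a endo" where "0 = Endo (\<lambda>_. 0)"
definition one_endo :: "'a endo" where "1 = Endo (\<lambda>x. x)"
definition plus_endo :: "'a endo \<Rightarrow> 'a endo \<Rightarrow> 'a endo" where "f + g = Endo (\<lambda>x. app f x + app g x)"
definition minus_endo :: "'a endo \<Rightarrow> 'a endo \<Rightarrow> 'a endo" where "f - g = Endo (\<lambda>x. app f x - app g x)"
definition uminus_endo :: "'a endo \<Rightarrow> 'a endo" where "- f = Endo (\<lambda>x. - app f x)"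
definition times_endo :: "'a endo \<Rightarrow> 'a endo \<Rightarrow> 'a endo" where "f * g = Endo (\<lambda>x. app f (app g x))"

lemma app_endo_simps:
  "app (0 :: 'a endo) x = 0" "app (1 :: 'a endo) x = x" "app (f + g) x = app f x + app g x"
  "app (f - g) x = app f x - app g x" "app (- f) x = - app f x" "app (f * g) x = app f (app g x)"
  by (simp_all add: zero_endo_def one_endo_def plus_endo_def minus_endo_def uminus_endo_def times_endo_def
      app_Endo app_add app_diff)

instance
proof
  fix f g h :: "'a endo"
  show "f + g + h = f + (g + h)" "f + g = g + f" "0 + f = f" "- f + f = 0" "f - g = f + - g"
    "f * g * h = f * (g * h)" "(f + g) * h = f * h + g * h" "f * (g + h) = f * g + f * h"
    "1 * f = f" "f * 1 = f"
    by (simp_all add: endo_eqI app_endo_simps app_add add.assoc add.commute[of "app f _" "app g _"])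
qed

end

lemmas app_simps [simp] = app_endo_simps

lemma app_sum_left: "app (sum f A) x = (\<Sum>i\<in>A. app (f i) x)"
  by (induction A rule: infinite_finite_induct) auto

text \<open>A basis of \<open>N\<close> is sent to 0, while the other vectors of an extended basis
  are fixed. This gives an additive choice of representatives modulo \<open>N\<close>.\<close>

lemma (in vector_space) subspace_projection:
  assumes "subspace N"
  shows "\<exists>f. (\<forall>x y. f (x + y) = f x + f y) \<and> (\<forall>x. f x - x \<in> N) \<and> (\<forall>x\<in>N. f x = 0)"
proof -
  interpret vp: vector_space_pair scale scale ..
  obtain B where B: "B \<subseteq> N" "independent B" "N \<subseteq> span B"
    using maximal_independent_subset[of N] by metis
  have sB: "span B = N" using B assms by (metis span_minimal subset_antisym)
  obtain g where g: "Vector_Spaces.linear scale scale g" "\<forall>x\<in>extend_basis B. g x = (if x \<in> B then 0 else x)"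
    using vp.linear_independent_extend[OF independent_extend_basis[OF B(2)], of "\<lambda>x. if x \<in> B then 0 else x"]
    by blast
  interpret g: Vector_Spaces.linear scale scale g by (rule g(1))
  have BE: "B \<subseteq> extend_basis B" using extend_basis_superset[OF B(2)] .
  have "g b = 0" if "b \<in> B" for b using g(2) BE that by auto
  then have "g x = 0" if "x \<in> N" for x
    using vp.linear_eq_0_on_span[OF g(1), of B x] that sB by blast
  moreover have "g x - x \<in> N" for x
  proof -
    have "x \<in> span (extend_basis B)" using span_extend_basis[OF B(2)] by simp
    then show ?thesis
    proof (induction rule: span_induct_alt)
      case base
      show ?case using subspace_0[OF assms] by (simp add: g.zero)
    next
      case (step c b y)
      have b: "g b - b \<in> N" using g(2) step(1) B(1) subspace_0[OF assms] subspace_neg[OF assms] by auto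
      have "scale c (g b - b) + (g y - y) \<in> N"
        using subspace_add[OF assms subspace_scale[OF assms b] step(2)] .
      then show ?case by (simp add: g.add g.scale scale_right_diff_distrib algebra_simps)
    qed
  qed
  ultimately show ?thesis using g.add by blast
qed

section \<open>Ring records embedded into ring types\<close>

definition ideal_in :: "'r::ring set \<Rightarrow> 'r set \<Rightarrow> bool" where
  "ideal_in L I \<longleftrightarrow> I \<subseteq> L \<and> 0 \<in> I \<and> (\<forall>x\<in>I. \<forall>y\<in>I. x + y \<in> I) \<and> (\<forall>x\<in>I. - x \<in> I) \<and>
     (\<forall>x\<in>I. \<forall>y\<in>L. x * y \<in> I \<and> y * x \<in> I)"

locale ring_embedding =
  fixes R :: "('a, 'm) ring_scheme" (structure) and \<theta> :: "'a \<Rightarrow> 'r::ring" and L :: "'r set"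
  assumes bij: "bij_betw \<theta> (carrier R) L"
    and zero_carrier: "\<zero> \<in> carrier R" and \<theta>_zero: "\<theta> \<zero> = 0"
    and add_carrier: "x \<in> carrier R \<Longrightarrow> y \<in> carrier R \<Longrightarrow> x \<oplus> y \<in> carrier R"
    and \<theta>_add: "x \<in> carrier R \<Longrightarrow> y \<in> carrier R \<Longrightarrow> \<theta> (x \<oplus> y) = \<theta> x + \<theta> y"
    and mult_carrier: "x \<in> carrier R \<Longrightarrow> y \<in> carrier R \<Longrightarrow> x \<otimes> y \<in> carrier R"
    and \<theta>_mult: "x \<in> carrier R \<Longrightarrow> y \<in> carrier R \<Longrightarrow> \<theta> (x \<otimes> y) = \<theta> x * \<theta> y"
    and uminus_image: "z \<in> L \<Longrightarrow> - z \<in> L"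
begin

lemma \<theta>_inj: "x \<in> carrier R \<Longrightarrow> y \<in> carrier R \<Longrightarrow> \<theta> x = \<theta> y \<Longrightarrow> x = y"
  using bij by (auto simp: bij_betw_def inj_on_def)

lemma \<theta>_mem: "x \<in> carrier R \<Longrightarrow> \<theta> x \<in> L"
  using bij by (auto simp: bij_betw_def)

lemma \<theta>_surj: "z \<in> L \<Longrightarrow> \<exists>x\<in>carrier R. \<theta> x = z"
  using bij by (auto simp: bij_betw_def)

lemma is_abelian_group: "abelian_group R"
proof (rule abelian_groupI)
  fix x assume x: "x \<in> carrier R"
  obtain y where "y \<in> carrier R" "\<theta> y = - \<theta> x" using \<theta>_surj uminus_image \<theta>_mem x by blast
  then show "\<exists>y\<in>carrier R. y \<oplus> x = \<zero>" using x
    by (intro bexI[of _ y] \<theta>_inj) (auto simp: \<theta>_add \<theta>_zero add_carrier zero_carrier)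
qed (auto intro!: \<theta>_inj simp: \<theta>_add \<theta>_zero add_carrier zero_carrier add_ac)

lemma is_nonunital_ring: "nonunital_ring R"
proof -
  interpret abelian_group R by (rule is_abelian_group)
  show ?thesis
    by unfold_locales
      (auto intro!: \<theta>_inj simp: \<theta>_add \<theta>_mult add_carrier mult_carrier mult.assoc distrib_left distrib_right)
qed

sublocale nonunital_ring R by (rule is_nonunital_ring)

lemma \<theta>_uminus: "x \<in> carrier R \<Longrightarrow> \<theta> (\<ominus> x) = - \<theta> x"
  using \<theta>_add[of "\<ominus> x" x] l_neg[of x] a_inv_closed[of x] \<theta>_zero by (simp add: eq_neg_iff_add_eq_0)

lemma two_sided_ideal_iff:
  "two_sided_ideal J R \<longleftrightarrow> J \<subseteq> carrier R \<and> ideal_in L (\<theta> ` J)" (is "?l \<longleftrightarrow> ?r")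
proof
  assume ?l
  then interpret J: two_sided_ideal J R .
  have sub: "J \<subseteq> carrier R" by (rule J.a_subset)
  have "\<theta> x * z \<in> \<theta> ` J \<and> z * \<theta> x \<in> \<theta> ` J" if xz: "x \<in> J" "z \<in> L" for x z
  proof -
    obtain y where y: "y \<in> carrier R" "\<theta> y = z" using \<theta>_surj[OF xz(2)] by blast
    have x: "x \<in> carrier R" using sub xz by blast
    have "\<theta> x * z = \<theta> (x \<otimes> y)" "z * \<theta> x = \<theta> (y \<otimes> x)" using \<theta>_mult x y by auto
    then show ?thesis using J.mult_left_closed J.mult_right_closed xz y by blast
  qed
  moreover have "\<theta> x + \<theta> y \<in> \<theta> ` J" if "x \<in> J" "y \<in> J" for x y
    using that sub J.a_closed[OF that] \<theta>_add by (metis imageI subsetD)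
  moreover have "- \<theta> x \<in> \<theta> ` J" if "x \<in> J" for x
    using that sub J.a_inv_closed[OF that] \<theta>_uminus by (metis imageI subsetD)
  moreover have "0 \<in> \<theta> ` J" using J.zero_closed \<theta>_zero by (metis imageI)
  ultimately show ?r using sub \<theta>_mem unfolding ideal_in_def by auto
next
  assume r: ?r
  have mem: "x \<in> J" if "x \<in> carrier R" "\<theta> x \<in> \<theta> ` J" for x
    using that r \<theta>_inj by blast
  have "subgroup J (add_monoid R)"
  proof (rule group.subgroupI[OF a_group])
    show "J \<subseteq> carrier (add_monoid R)" using r by simp
    show "J \<noteq> {}" using r by (auto simp: ideal_in_def)
    fix x assume x: "x \<in> J"
    then have "\<ominus> x \<in> J" using r by (intro mem) (auto simp: \<theta>_uminus subset_iff ideal_in_def)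
    then show "inv\<^bsub>add_monoid R\<^esub> x \<in> J" by (simp add: a_inv_def)
    fix y assume y: "y \<in> J"
    show "x \<otimes>\<^bsub>add_monoid R\<^esub> y \<in> J" using r x y
      by (simp, intro mem) (auto simp: \<theta>_add subset_iff ideal_in_def)
  qed
  then interpret additive_subgroup J R by (rule additive_subgroupI)
  show ?l
  proof unfold_locales
    fix a x assume a: "a \<in> J" "x \<in> carrier R"
    then have "a \<in> carrier R" using r by blast
    then show "x \<otimes> a \<in> J" "a \<otimes> x \<in> J" using r a \<theta>_mem
      by (auto intro!: mem simp: \<theta>_mult ideal_in_def mult_carrier)
  qed
qed

lemma restrict_embedding:
  assumes "ideal_in L (\<theta> ` J)" "J \<subseteq> carrier R"
  shows "ring_embedding (R\<lparr>carrier := J\<rparr>) \<theta> (\<theta> ` J)"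
proof -
  have mem: "x \<in> J" if "x \<in> carrier R" "\<theta> x \<in> \<theta> ` J" for x
    using that assms \<theta>_inj by blast
  show ?thesis
    by unfold_locales
      (use assms bij in \<open>auto intro!: mem simp: bij_betw_def \<theta>_zero \<theta>_add \<theta>_mult ideal_in_def zero_carrier
        add_carrier mult_carrier inj_on_subset subset_iff\<close>)
qed

lemma principal_products_sum:
  assumes a: "a \<in> carrier R" and z: "z \<in> principal_products R a"
  shows "z \<in> carrier R \<and> (\<exists>n x y. (\<forall>i<n. x i \<in> L \<and> y i \<in> L) \<and> \<theta> z = (\<Sum>i<(n::nat). x i * \<theta> a * y i))"
  using z unfolding principal_products_def
proof (induction rule: generate.induct)
    case one
    show ?case using zero_carrier \<theta>_zero by (auto intro: exI[of _ 0])
  next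
    case (incl h)
    then obtain x y where h: "x \<in> carrier R" "y \<in> carrier R" "h = x \<otimes> a \<otimes> y" by blast
    show ?case
      by (intro conjI, simp add: h a mult_carrier, rule exI[of _ "1::nat"], rule exI[of _ "\<lambda>_. \<theta> x"],
          rule exI[of _ "\<lambda>_. \<theta> y"]) (simp add: h a mult_carrier \<theta>_mult \<theta>_mem)
  next
    case (inv h)
    then obtain x y where h: "x \<in> carrier R" "y \<in> carrier R" "h = x \<otimes> a \<otimes> y" by blast
    have "\<theta> (inv\<^bsub>add_monoid R\<^esub> h) = - \<theta> h" using \<theta>_uminus h a mult_carrier by (simp add: a_inv_def)
    \<comment> \<open>The sign goes into the left factor, so an inverse is again a single
      product.\<close>
    then have e: "\<theta> (inv\<^bsub>add_monoid R\<^esub> h) = (\<Sum>i<(1::nat). (- \<theta> x) * \<theta> a * \<theta> y)"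
      using h a by (simp add: mult_carrier \<theta>_mult)
    have c: "inv\<^bsub>add_monoid R\<^esub> h \<in> carrier R"
      using a_inv_closed[of h] h a mult_carrier by (simp add: a_inv_def)
    have L: "\<forall>i<1::nat. - \<theta> x \<in> L \<and> \<theta> y \<in> L" using h \<theta>_mem uminus_image by blast
    show ?case
      by (rule conjI[OF c], rule exI[of _ "1::nat"], rule exI[of _ "\<lambda>_. - \<theta> x"], rule exI[of _ "\<lambda>_. \<theta> y"],
          rule conjI[OF L e])
  next
    case (eng g h)
    then obtain n x y m x' y' where
      g: "\<forall>i<n. x i \<in> L \<and> y i \<in> L" "\<theta> g = (\<Sum>i<(n::nat). x i * \<theta> a * y i)" and
      h: "\<forall>i<m. x' i \<in> L \<and> y' i \<in> L" "\<theta> h = (\<Sum>i<(m::nat). x' i * \<theta> a * y' i)" by blast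
    have "\<theta> (g \<otimes>\<^bsub>add_monoid R\<^esub> h) = \<theta> g + \<theta> h" using eng \<theta>_add by simp
    also have "\<dots> = (\<Sum>i<n + m. (if i < n then x i else x' (i - n)) * \<theta> a * (if i < n then y i else y' (i - n)))"
    proof -
      let ?f = "\<lambda>i. (if i < n then x i else x' (i - n)) * \<theta> a * (if i < n then y i else y' (i - n))"
      have "sum ?f {..<n + m} = sum ?f {..<n} + sum ?f {n..<n + m}"
        by (metis (no_types, lifting) lessThan_atLeast0 le_add1 sum.atLeastLessThan_concat zero_le)
      also have "sum ?f {n..<n + m} = (\<Sum>i<m. x' i * \<theta> a * y' i)"
        using sum.shift_bounds_nat_ivl[of ?f 0 n m] by (simp add: lessThan_atLeast0 add.commute)
      finally show ?thesis using g h by simp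
    qed
    finally have e: "\<theta> (g \<otimes>\<^bsub>add_monoid R\<^esub> h) =
      (\<Sum>i<n + m. (if i < n then x i else x' (i - n)) * \<theta> a * (if i < n then y i else y' (i - n)))" .
    have L: "\<forall>i<n + m. (if i < n then x i else x' (i - n)) \<in> L \<and> (if i < n then y i else y' (i - n)) \<in> L"
      using g h by auto
    have c: "g \<otimes>\<^bsub>add_monoid R\<^esub> h \<in> carrier R" using eng add_carrier by simp
    show ?case by (rule conjI[OF c], rule exI, rule exI, rule exI, rule conjI[OF L e])
qed

lemma two_products:
  assumes "x \<in> carrier R" "y \<in> carrier R" "x' \<in> carrier R" "y' \<in> carrier R"
  shows "x \<otimes> a \<otimes> y \<oplus> x' \<otimes> a \<otimes> y' \<in> principal_products R a"
proof -
  have "x \<otimes> a \<otimes> y \<in> principal_products R a" "x' \<otimes> a \<otimes> y' \<in> principal_products R a"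
    unfolding principal_products_def using assms by (auto intro!: generate.incl)
  then show ?thesis unfolding principal_products_def using generate.eng by fastforce
qed

lemma division_ring_quotient_domain:
  assumes J: "two_sided_ideal J R" and D: "is_division_ring (R Quot J)"
  shows "J \<noteq> carrier R" "x \<in> carrier R \<Longrightarrow> y \<in> carrier R \<Longrightarrow> x \<otimes> y \<in> J \<Longrightarrow> x \<in> J \<or> y \<in> J"
proof -
  interpret J: two_sided_ideal J R by (rule J)
  interpret A: abelian_subgroup J R
    by (rule abelian_subgroupI3[OF J.additive_subgroup_axioms is_abelian_group])
  let ?Q = "R Quot J"
  obtain u where u: "ring (?Q\<lparr>one := u\<rparr>)" "Units (?Q\<lparr>one := u\<rparr>) = carrier ?Q - {\<zero>\<^bsub>?Q\<^esub>}"
    using D unfolding is_division_ring_def by blast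
  interpret Q: ring "?Q\<lparr>one := u\<rparr>" by (rule u(1))
  have z: "\<zero>\<^bsub>?Q\<^esub> = J" by (simp add: FactRing_def)
  have coset: "J +> x \<in> carrier ?Q" if "x \<in> carrier R" for x
    using that by (auto simp: FactRing_def A_RCOSETS_def')
  have J_iff: "J +> x = J \<longleftrightarrow> x \<in> J" if "x \<in> carrier R" for x
    using A.a_rcos_const A.a_rcos_self that by blast
  show "J \<noteq> carrier R"
  proof
    assume eq: "J = carrier R"
    have "u \<in> Units (?Q\<lparr>one := u\<rparr>)" using Q.Units_one_closed by simp
    then have "u \<in> carrier ?Q" "u \<noteq> J" using u(2) z by auto
    then obtain x where "x \<in> carrier R" "u = J +> x" by (auto simp: FactRing_def A_RCOSETS_def')
    then show False using J_iff eq \<open>u \<noteq> J\<close> by blast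
  qed
  show "x \<in> J \<or> y \<in> J" if x: "x \<in> carrier R" "y \<in> carrier R" "x \<otimes> y \<in> J"
  proof (rule ccontr)
    assume n: "\<not> (x \<in> J \<or> y \<in> J)"
    then have U: "J +> x \<in> Units (?Q\<lparr>one := u\<rparr>)" "J +> y \<in> Units (?Q\<lparr>one := u\<rparr>)"
      using x coset J_iff u(2) z by auto
    have "(J +> x) \<otimes>\<^bsub>?Q\<^esub> (J +> y) = J"
    proof -
      have "J +> (a \<otimes> b) = J" if ab: "a \<in> J +> x" "b \<in> J +> y" for a b
      proof -
        obtain j k where jk: "j \<in> J" "k \<in> J" "a = j \<oplus> x" "b = k \<oplus> y"
          using ab by (auto simp: a_r_coset_def')
        then have c: "j \<in> carrier R" "k \<in> carrier R" using J.a_subset by blast+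
        have "a \<otimes> b = (j \<otimes> k \<oplus> x \<otimes> k) \<oplus> (j \<otimes> y \<oplus> x \<otimes> y)"
          using jk c x by (simp add: distrib_left distrib_right mult_closed)
        also have "\<dots> \<in> J" using jk c x J.mult_left_closed J.mult_right_closed by (intro J.a_closed) auto
        finally show ?thesis using J_iff jk c x mult_closed by auto
      qed
      moreover have "x \<in> J +> x" "y \<in> J +> y" using x A.a_rcos_self by blast+
      ultimately show ?thesis by (auto simp: FactRing_def rcoset_mult_def)
    qed
    moreover have "(J +> x) \<otimes>\<^bsub>?Q\<lparr>one := u\<rparr>\<^esub> (J +> y) \<in> Units (?Q\<lparr>one := u\<rparr>)"
      using Q.Units_m_closed U by blast
    ultimately show False using u(2) z by simp
  qed
qed

end

text \<open>Since \<open>\<phi>\<close> is constant on the cosets of its kernel \<open>J\<close>,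
  the representative picked by \<open>SOME\<close> does not matter.\<close>

lemma quotient_embedding:
  fixes R (structure) and \<phi> :: "'a \<Rightarrow> 'r::ring"
  assumes R: "nonunital_ring R" and J: "two_sided_ideal J R"
    and add: "\<And>x y. x \<in> carrier R \<Longrightarrow> y \<in> carrier R \<Longrightarrow> \<phi> (x \<oplus> y) = \<phi> x + \<phi> y"
    and mult: "\<And>x y. x \<in> carrier R \<Longrightarrow> y \<in> carrier R \<Longrightarrow> \<phi> (x \<otimes> y) = \<phi> x * \<phi> y"
    and ker: "\<And>x. x \<in> carrier R \<Longrightarrow> x \<in> J \<longleftrightarrow> \<phi> x = 0"
  shows "ring_embedding (R Quot J) (\<lambda>C. \<phi> (SOME x. x \<in> C)) (\<phi> ` carrier R)"
    and "\<And>x. x \<in> carrier R \<Longrightarrow> \<phi> (SOME y. y \<in> J +> x) = \<phi> x"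
proof -
  interpret nonunital_ring R by (rule R)
  interpret J: two_sided_ideal J R by (rule J)
  let ?\<theta> = "\<lambda>C. \<phi> (SOME x. x \<in> C)"
  have zero: "\<phi> \<zero> = 0" using ker[OF zero_closed] J.zero_closed by simp
  have um: "\<phi> (\<ominus> x) = - \<phi> x" if "x \<in> carrier R" for x
    using add[of "\<ominus> x" x] that zero l_neg[OF that] by (simp add: eq_neg_iff_add_eq_0)
  have mem: "y \<in> J +> x \<longleftrightarrow> y \<in> carrier R \<and> \<phi> y = \<phi> x" if x: "x \<in> carrier R" for x y
  proof
    assume "y \<in> J +> x"
    then obtain j where j: "j \<in> J" "y = j \<oplus> x" by (auto simp: a_r_coset_def')
    then have jc: "j \<in> carrier R" using J.a_subset by blast
    then show "y \<in> carrier R \<and> \<phi> y = \<phi> x" using j x ker[OF jc] add[OF jc x] by simp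
  next
    assume y: "y \<in> carrier R \<and> \<phi> y = \<phi> x"
    then have "\<phi> (y \<ominus> x) = 0" using x by (simp add: a_minus_def add um)
    then have "y \<ominus> x \<in> J" using x y ker[of "y \<ominus> x"] by simp
    moreover have "y = (y \<ominus> x) \<oplus> x" using x y by (simp add: a_minus_def a_assoc l_neg)
    ultimately show "y \<in> J +> x" by (auto simp: a_r_coset_def')
  qed
  show val: "?\<theta> (J +> x) = \<phi> x" if "x \<in> carrier R" for x
    using someI[of "\<lambda>y. y \<in> J +> x" x] mem[OF that, of x] mem[OF that, of "SOME y. y \<in> J +> x"] that by simp
  have eq: "J +> x = J +> y" if "x \<in> carrier R" "y \<in> carrier R" "\<phi> x = \<phi> y" for x y
    using mem[OF that(1)] mem[OF that(2)] that(3) by auto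
  have car: "carrier (R Quot J) = {J +> x | x. x \<in> carrier R}"
    by (auto simp: FactRing_def A_RCOSETS_def')
  have z: "\<zero>\<^bsub>R Quot J\<^esub> = J +> \<zero>" using mem[OF zero_closed] ker J.a_subset zero
    by (auto simp: FactRing_def)
  have plus: "(J +> x) \<oplus>\<^bsub>R Quot J\<^esub> (J +> y) = J +> (x \<oplus> y)" if xy: "x \<in> carrier R" "y \<in> carrier R" for x y
  proof -
    have "c \<in> (J +> x) <+> (J +> y) \<longleftrightarrow> c \<in> J +> (x \<oplus> y)" for c
    proof
      assume "c \<in> (J +> x) <+> (J +> y)"
      then show "c \<in> J +> (x \<oplus> y)" using xy mem add by (auto simp: set_add_def')
    next
      assume c: "c \<in> J +> (x \<oplus> y)"
      then have c': "c \<in> carrier R" "\<phi> c = \<phi> x + \<phi> y" using mem xy add by auto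
      then have "c \<ominus> y \<in> J +> x" using xy mem add um by (auto simp: a_minus_def)
      moreover have "c = (c \<ominus> y) \<oplus> y" using c' xy by (simp add: a_minus_def a_assoc l_neg)
      moreover have "y \<in> J +> y" using mem xy by blast
      ultimately show "c \<in> (J +> x) <+> (J +> y)" by (auto simp: set_add_def')
    qed
    then show ?thesis by (auto simp: FactRing_def)
  qed
  have times: "(J +> x) \<otimes>\<^bsub>R Quot J\<^esub> (J +> y) = J +> (x \<otimes> y)" if xy: "x \<in> carrier R" "y \<in> carrier R" for x y
  proof -
    have ab: "J +> (a \<otimes> b) = J +> (x \<otimes> y)" if "a \<in> J +> x" "b \<in> J +> y" for a b
    proof -
      have "a \<in> carrier R" "\<phi> a = \<phi> x" "b \<in> carrier R" "\<phi> b = \<phi> y"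
        using mem[OF xy(1), of a] mem[OF xy(2), of b] that by simp_all
      then show ?thesis using xy by (intro eq mult_closed) (simp_all add: mult)
    qed
    have "x \<in> J +> x" "y \<in> J +> y" using mem[OF xy(1), of x] mem[OF xy(2), of y] xy by simp_all
    then have "(\<Union>a\<in>J +> x. \<Union>b\<in>J +> y. J +> (a \<otimes> b)) = J +> (x \<otimes> y)" using ab by blast
    then show ?thesis by (simp add: FactRing_def rcoset_mult_def)
  qed
  show "ring_embedding (R Quot J) ?\<theta> (\<phi> ` carrier R)"
  proof
    show "bij_betw ?\<theta> (carrier (R Quot J)) (\<phi> ` carrier R)"
      unfolding bij_betw_def
    proof
      show "inj_on ?\<theta> (carrier (R Quot J))"
      proof (rule inj_onI)
        fix C D assume CD: "C \<in> carrier (R Quot J)" "D \<in> carrier (R Quot J)" "?\<theta> C = ?\<theta> D"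
        from CD(1) obtain a where a: "a \<in> carrier R" "C = J +> a" unfolding car by blast
        from CD(2) obtain b where b: "b \<in> carrier R" "D = J +> b" unfolding car by blast
        have "\<phi> a = \<phi> b" using CD(3) val[OF a(1)] val[OF b(1)] unfolding a(2) b(2) by simp
        then show "C = D" unfolding a(2) b(2) by (rule eq[OF a(1) b(1)])
      qed
      have "?\<theta> ` carrier (R Quot J) = (\<lambda>x. ?\<theta> (J +> x)) ` carrier R" unfolding car by blast
      also have "\<dots> = \<phi> ` carrier R" using val by (intro image_cong) auto
      finally show "?\<theta> ` carrier (R Quot J) = \<phi> ` carrier R" .
    qed
    show "\<zero>\<^bsub>R Quot J\<^esub> \<in> carrier (R Quot J)" unfolding z car using zero_closed by blast
    show "?\<theta> \<zero>\<^bsub>R Quot J\<^esub> = 0" unfolding z using val[OF zero_closed] zero by simp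
    fix x y assume xy: "x \<in> carrier (R Quot J)" "y \<in> carrier (R Quot J)"
    from xy(1) obtain a where a: "a \<in> carrier R" "x = J +> a" unfolding car by blast
    from xy(2) obtain b where b: "b \<in> carrier R" "y = J +> b" unfolding car by blast
    note ab = a(1) b(1) a(2) b(2)
    show "x \<oplus>\<^bsub>R Quot J\<^esub> y \<in> carrier (R Quot J)" unfolding ab(3,4) plus[OF ab(1,2)] car using ab(1,2) a_closed by blast
    show "x \<otimes>\<^bsub>R Quot J\<^esub> y \<in> carrier (R Quot J)" unfolding ab(3,4) times[OF ab(1,2)] car using ab(1,2) mult_closed by blast
    show "?\<theta> (x \<oplus>\<^bsub>R Quot J\<^esub> y) = ?\<theta> x + ?\<theta> y" using ab plus val add by simp
    show "?\<theta> (x \<otimes>\<^bsub>R Quot J\<^esub> y) = ?\<theta> x * ?\<theta> y" using ab times val mult mult_closed by simp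
  next
    fix z assume "z \<in> \<phi> ` carrier R"
    then obtain x where x: "x \<in> carrier R" "z = \<phi> x" by blast
    have "- z = \<phi> (\<ominus> x)" using um[OF x(1)] x(2) by simp
    then show "- z \<in> \<phi> ` carrier R" using a_inv_closed[OF x(1)] by blast
  qed
qed

text \<open>The quotient is taken by the kernel of \<open>\<chi>\<close> composed with
  \<open>\<theta>\<close>; its unit is the coset corresponding to \<open>e\<close>, which acts as a
  unit on the image of \<open>\<chi>\<close> only.\<close>

lemma (in ring_embedding) division_ring_quotient:
  fixes \<chi> :: "'r \<Rightarrow> 'b::ring"
  assumes add: "\<And>x y. x \<in> L \<Longrightarrow> y \<in> L \<Longrightarrow> \<chi> (x + y) = \<chi> x + \<chi> y"
    and mult: "\<And>x y. x \<in> L \<Longrightarrow> y \<in> L \<Longrightarrow> \<chi> (x * y) = \<chi> x * \<chi> y"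
    and e: "e \<in> \<chi> ` L" "e \<noteq> 0" "\<And>s. s \<in> \<chi> ` L \<Longrightarrow> e * s = s \<and> s * e = s"
    and inv: "\<And>s. s \<in> \<chi> ` L \<Longrightarrow> s \<noteq> 0 \<Longrightarrow> \<exists>t\<in>\<chi> ` L. s * t = e \<and> t * s = e"
  shows "\<exists>J. two_sided_ideal J R \<and> is_division_ring (R Quot J)"
proof -
  let ?\<phi> = "\<lambda>x. \<chi> (\<theta> x)"
  define J where "J = {x \<in> carrier R. ?\<phi> x = 0}"
  have img: "?\<phi> ` carrier R = \<chi> ` L" using bij by (auto simp: bij_betw_def)
  have L0: "0 \<in> L" using \<theta>_mem[OF zero_carrier] \<theta>_zero by simp
  have \<chi>0: "\<chi> 0 = 0" using add[OF L0 L0] by simp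
  have \<chi>um: "\<chi> (- x) = - \<chi> x" if "x \<in> L" for x
    using add[OF that uminus_image[OF that]] \<chi>0 by (simp add: eq_neg_iff_add_eq_0 add.commute)
  have "two_sided_ideal J R" unfolding two_sided_ideal_iff ideal_in_def
  proof (intro conjI ballI)
    have memJ: "\<theta> x \<in> \<theta> ` J" if "x \<in> carrier R" "\<chi> (\<theta> x) = 0" for x using that by (auto simp: J_def)
    have J: "z \<in> \<theta> ` J \<longleftrightarrow> z \<in> L \<and> \<chi> z = 0" for z
      using \<theta>_surj[of z] \<theta>_mem by (auto simp: J_def)
    show "J \<subseteq> carrier R" by (auto simp: J_def)
    show "\<theta> ` J \<subseteq> L" using J by blast
    show "0 \<in> \<theta> ` J" using J L0 \<chi>0 by blast
    have Lc: "x + y \<in> L" "x * y \<in> L" if "x \<in> L" "y \<in> L" for x y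
      using \<theta>_surj[OF that(1)] \<theta>_surj[OF that(2)] \<theta>_mem \<theta>_add \<theta>_mult add_carrier mult_carrier by metis+
    show "x + y \<in> \<theta> ` J" if "x \<in> \<theta> ` J" "y \<in> \<theta> ` J" for x y using that J add Lc by simp
    show "- x \<in> \<theta> ` J" if "x \<in> \<theta> ` J" for x using that J \<chi>um uminus_image by simp
    show "x * y \<in> \<theta> ` J" "y * x \<in> \<theta> ` J" if "x \<in> \<theta> ` J" "y \<in> L" for x y using that J mult Lc by simp_all
  qed
  note J = this
  have emb: "ring_embedding (R Quot J) (\<lambda>C. ?\<phi> (SOME x. x \<in> C)) (?\<phi> ` carrier R)"
    by (rule quotient_embedding[OF is_nonunital_ring J])
      (auto simp: \<theta>_add \<theta>_mult add mult \<theta>_mem J_def)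
  let ?Q = "R Quot J" and ?\<theta> = "\<lambda>C. ?\<phi> (SOME x. x \<in> C)"
  interpret Q: ring_embedding ?Q ?\<theta> "?\<phi> ` carrier R" by (rule emb)
  obtain u where u: "u \<in> carrier ?Q" "?\<theta> u = e" using Q.\<theta>_surj e(1) img by metis
  have unit: "u \<otimes>\<^bsub>?Q\<^esub> x = x" "x \<otimes>\<^bsub>?Q\<^esub> u = x" if x: "x \<in> carrier ?Q" for x
  proof -
    have "?\<theta> x \<in> \<chi> ` L" using Q.\<theta>_mem[OF x] img by simp
    then have "?\<theta> (u \<otimes>\<^bsub>?Q\<^esub> x) = ?\<theta> x" "?\<theta> (x \<otimes>\<^bsub>?Q\<^esub> u) = ?\<theta> x"
      using e(3) Q.\<theta>_mult[OF u(1) x] Q.\<theta>_mult[OF x u(1)] u(2) by simp_all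
    then show "u \<otimes>\<^bsub>?Q\<^esub> x = x" "x \<otimes>\<^bsub>?Q\<^esub> u = x"
      using Q.\<theta>_inj Q.mult_carrier u(1) x by blast+
  qed
  have ring: "ring (?Q\<lparr>one := u\<rparr>)"
  proof (rule ringI)
    have A: "abelian_group ?Q" by (rule Q.is_abelian_group)
    show "abelian_group (?Q\<lparr>one := u\<rparr>)"
      using A by (simp add: abelian_group_def abelian_monoid_def abelian_group_axioms_def)
    show "monoid (?Q\<lparr>one := u\<rparr>)"
      by (rule monoidI) (auto simp: Q.mult_closed Q.mult_assoc u unit)
  qed (auto simp: Q.distrib_left Q.distrib_right)
  have "Units (?Q\<lparr>one := u\<rparr>) = carrier ?Q - {\<zero>\<^bsub>?Q\<^esub>}"
  proof (intro equalityI subsetI)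
    fix x assume "x \<in> Units (?Q\<lparr>one := u\<rparr>)"
    then obtain y where y: "x \<in> carrier ?Q" "y \<in> carrier ?Q" "x \<otimes>\<^bsub>?Q\<^esub> y = u" by (auto simp: Units_def)
    have "x \<noteq> \<zero>\<^bsub>?Q\<^esub>"
    proof
      assume "x = \<zero>\<^bsub>?Q\<^esub>"
      then have "e = 0" using Q.\<theta>_mult[OF y(1,2)] y(3) u Q.\<theta>_zero by simp
      then show False using e by simp
    qed
    then show "x \<in> carrier ?Q - {\<zero>\<^bsub>?Q\<^esub>}" using y by simp
  next
    fix x assume "x \<in> carrier ?Q - {\<zero>\<^bsub>?Q\<^esub>}"
    then have x: "x \<in> carrier ?Q" "?\<theta> x \<noteq> 0" using Q.\<theta>_inj[OF _ Q.zero_carrier] Q.\<theta>_zero by auto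
    then obtain t where t: "t \<in> \<chi> ` L" "?\<theta> x * t = e" "t * ?\<theta> x = e" using inv Q.\<theta>_mem img by metis
    then obtain y where y: "y \<in> carrier ?Q" "?\<theta> y = t" using Q.\<theta>_surj img by metis
    then have "?\<theta> (x \<otimes>\<^bsub>?Q\<^esub> y) = ?\<theta> u" "?\<theta> (y \<otimes>\<^bsub>?Q\<^esub> x) = ?\<theta> u"
      using t u Q.\<theta>_mult[OF x(1) y(1)] Q.\<theta>_mult[OF y(1) x(1)] by simp_all
    then have "x \<otimes>\<^bsub>?Q\<^esub> y = u" "y \<otimes>\<^bsub>?Q\<^esub> x = u"
      using Q.\<theta>_inj Q.mult_carrier u(1) x(1) y(1) by blast+
    then show "x \<in> Units (?Q\<lparr>one := u\<rparr>)" using x y by (auto simp: Units_def)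
  qed
  then show ?thesis using ring J unfolding is_division_ring_def by blast
qed

section \<open>Evaluation of noncommutative polynomials\<close>

definition eval_free :: "('k::field \<Rightarrow> 'b::{ring,monoid_mult}) \<Rightarrow> ('g \<Rightarrow> 'b) \<Rightarrow> ('g free_word \<Rightarrow>\<^sub>0 'k) \<Rightarrow> 'b" where
  "eval_free \<iota> f p = (\<Sum>w\<in>Poly_Mapping.keys p. \<iota> (Poly_Mapping.lookup p w) * prod_list (map f (letters w)))"

lemma letters_plus [simp]: "letters (u + v) = letters u @ letters v"
  by (simp add: plus_free_word_def)

lemma letters_zero [simp]: "letters 0 = []"
  by (simp add: zero_free_word_def)

lemma poly_mapping_decompose: "p = (\<Sum>w\<in>Poly_Mapping.keys p. Poly_Mapping.single w (Poly_Mapping.lookup p w))"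
  by (rule poly_mapping_eqI) (auto simp: lookup_sum lookup_single when_def not_in_keys_iff_lookup_eq_zero)

text \<open>In contrast to the carrier of \<open>free_algebra X\<close>, this contains the empty
  word and hence the scalars.\<close>

definition words_over :: "'g set \<Rightarrow> ('g free_word \<Rightarrow>\<^sub>0 'k::field) set" where
  "words_over X = {p. \<forall>w\<in>Poly_Mapping.keys p. set (letters w) \<subseteq> X}"

lemma words_over_mult: "p \<in> words_over X \<Longrightarrow> q \<in> words_over X \<Longrightarrow> p * q \<in> words_over X"
  unfolding words_over_def using keys_mult[of p q] by fastforce

lemma words_over_add: "p \<in> words_over X \<Longrightarrow> q \<in> words_over X \<Longrightarrow> p + q \<in> words_over X"
  unfolding words_over_def using keys_add[of p q] by blast

lemma single_zero_words_over: "Poly_Mapping.single 0 c \<in> words_over X"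
  by (auto simp: words_over_def)

lemma keys_uminus [simp]: "Poly_Mapping.keys (- p) = Poly_Mapping.keys (p :: _ \<Rightarrow>\<^sub>0 'k::ab_group_add)"
  by (auto simp: in_keys_iff)

lemma words_over_uminus: "p \<in> words_over X \<Longrightarrow> - p \<in> words_over X"
  by (simp add: words_over_def)

lemma words_over_diff: "p \<in> words_over X \<Longrightarrow> q \<in> words_over X \<Longrightarrow> p - q \<in> words_over X"
  using words_over_add[OF _ words_over_uminus, of p X q] by simp

lemma single_zero_central:
  fixes p :: "'g free_word \<Rightarrow>\<^sub>0 'k::field"
  shows "Poly_Mapping.single 0 c * p = p * Poly_Mapping.single 0 c"
  by (subst (1 2) poly_mapping_decompose[of p])
    (simp add: sum_distrib_left sum_distrib_right mult_single mult.commute)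

locale scalar_hom =
  fixes \<iota> :: "'k::field \<Rightarrow> 'b::{ring,monoid_mult}" and f :: "'g \<Rightarrow> 'b" and X :: "'g set"
  assumes scalar_add: "\<iota> (a + b) = \<iota> a + \<iota> b" and scalar_mult: "\<iota> (a * b) = \<iota> a * \<iota> b"
    and letter_comm: "g \<in> X \<Longrightarrow> f g * \<iota> k = \<iota> k * f g"
begin

lemma scalar_zero [simp]: "\<iota> 0 = 0"
  using scalar_add[of 0 0] by simp

lemma eval_add: "eval_free \<iota> f (p + q) = eval_free \<iota> f p + eval_free \<iota> f q"
  unfolding eval_free_def
  by (rule setsum_keys_plus_distrib) (simp_all add: scalar_add distrib_right)

lemma eval_zero [simp]: "eval_free \<iota> f 0 = 0"
  by (simp add: eval_free_def)

lemma eval_uminus: "eval_free \<iota> f (- p) = - eval_free \<iota> f p"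
  using eval_add[of p "- p"] by (simp add: eq_neg_iff_add_eq_0 add.commute)

lemma eval_diff: "eval_free \<iota> f (p - q) = eval_free \<iota> f p - eval_free \<iota> f q"
  using eval_add[of p "- q"] by (simp add: eval_uminus)

lemma eval_sum: "eval_free \<iota> f (sum p A) = (\<Sum>i\<in>A. eval_free \<iota> f (p i))"
  by (induction A rule: infinite_finite_induct) (auto simp: eval_add)

lemma eval_single: "eval_free \<iota> f (Poly_Mapping.single w k) = \<iota> k * prod_list (map f (letters w))"
  by (cases "k = 0") (auto simp: eval_free_def)

lemma prod_list_comm: "set gs \<subseteq> X \<Longrightarrow> prod_list (map f gs) * \<iota> k = \<iota> k * prod_list (map f gs)"
proof (induction gs)
  case (Cons g gs)
  then have "f g * (prod_list (map f gs) * \<iota> k) = \<iota> k * f g * prod_list (map f gs)"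
    using letter_comm[of g k] by (simp add: mult.assoc[symmetric])
  then show ?case by (simp add: mult.assoc)
qed simp

text \<open>Coefficients of \<open>q\<close> move past letters of \<open>p\<close>, never the other
  way round, whence the one-sided condition.\<close>

lemma eval_mult:
  assumes "p \<in> words_over X"
  shows "eval_free \<iota> f (p * q) = eval_free \<iota> f p * eval_free \<iota> f q"
proof -
  let ?K = "Poly_Mapping.keys" and ?l = "Poly_Mapping.lookup" and ?s = "Poly_Mapping.single"
  let ?m = "\<lambda>w. prod_list (map f (letters w))"
  have "p * q = (\<Sum>u\<in>?K p. \<Sum>v\<in>?K q. ?s (u + v) (?l p u * ?l q v))"
    by (subst poly_mapping_decompose[of p], subst poly_mapping_decompose[of q])
      (simp add: sum_product mult_single)
  then have "eval_free \<iota> f (p * q) = (\<Sum>u\<in>?K p. \<Sum>v\<in>?K q. \<iota> (?l p u * ?l q v) * (?m u * ?m v))"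
    by (simp add: eval_sum eval_single)
  also have "\<dots> = (\<Sum>u\<in>?K p. \<Sum>v\<in>?K q. (\<iota> (?l p u) * ?m u) * (\<iota> (?l q v) * ?m v))"
  proof (intro sum.cong refl)
    fix u v assume "u \<in> ?K p"
    then have "?m u * \<iota> (?l q v) = \<iota> (?l q v) * ?m u"
      using assms by (intro prod_list_comm) (auto simp: words_over_def)
    then show "\<iota> (?l p u * ?l q v) * (?m u * ?m v) = (\<iota> (?l p u) * ?m u) * (\<iota> (?l q v) * ?m v)"
      by (metis mult.assoc scalar_mult)
  qed
  also have "\<dots> = eval_free \<iota> f p * eval_free \<iota> f q"
    by (simp add: eval_free_def sum_product)
  finally show ?thesis .
qed

end

section \<open>Quotients of free algebras as rings of additive endomorphisms\<close>

lemma carrier_free_algebra: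
  "carrier (free_algebra X) = {p \<in> words_over X. Poly_Mapping.lookup p 0 = 0}"
proof -
  have "letters w = [] \<longleftrightarrow> w = 0" for w :: "'a free_word" by (cases w) (simp add: zero_free_word_def)
  then show ?thesis by (auto simp: free_algebra_def words_over_def in_keys_iff)
qed

lemma lookup_mult_zero:
  assumes "Poly_Mapping.lookup p 0 = 0 \<or> Poly_Mapping.lookup q 0 = 0"
  shows "Poly_Mapping.lookup (p * q :: 'g free_word \<Rightarrow>\<^sub>0 'k::field) 0 = 0"
proof (rule ccontr)
  assume "\<not> ?thesis"
  then have "0 \<in> Poly_Mapping.keys (p * q)" by (simp add: in_keys_iff)
  then obtain u v where "u \<in> Poly_Mapping.keys p" "v \<in> Poly_Mapping.keys q" "0 = u + v"
    using keys_mult[of p q] by blast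
  moreover from this have "letters u @ letters v = []" by (metis letters_plus letters_zero)
  then have "u = 0" "v = 0" by (cases u, cases v, simp add: zero_free_word_def)+
  ultimately show False using assms by (simp add: in_keys_iff)
qed

lemma free_algebra_fields:
  "\<zero>\<^bsub>free_algebra X\<^esub> = 0" "p \<oplus>\<^bsub>free_algebra X\<^esub> q = p + q" "p \<otimes>\<^bsub>free_algebra X\<^esub> q = p * q"
  "c \<odot>\<^bsub>free_algebra X\<^esub> p = Poly_Mapping.single 0 c * p"
  by (simp_all add: free_algebra_def)

lemma free_algebra_embedding:
  "ring_embedding (free_algebra X :: ('k::field, 'g free_word \<Rightarrow>\<^sub>0 'k) module) (\<lambda>p. p) (carrier (free_algebra X))"
  by unfold_locales
    (auto simp: carrier_free_algebra free_algebra_fields bij_betw_def inj_on_def words_over_mult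
      words_over_add words_over_uminus lookup_mult_zero lookup_add single_zero_words_over[of 0, simplified])

lemma two_sided_ideal_free_algebra:
  "two_sided_ideal (carrier (free_algebra X)) (free_algebra X :: ('k::field, 'g free_word \<Rightarrow>\<^sub>0 'k) module)"
  unfolding ring_embedding.two_sided_ideal_iff[OF free_algebra_embedding] ideal_in_def
  by (auto simp: carrier_free_algebra words_over_mult words_over_add words_over_uminus lookup_mult_zero
      lookup_add single_zero_words_over[of 0, simplified])

lemma two_sided_ideal_Inter_free_algebra:
  fixes F :: "('g free_word \<Rightarrow>\<^sub>0 'k::field) set set"
  assumes "F \<noteq> {}" "\<And>J. J \<in> F \<Longrightarrow> two_sided_ideal J (free_algebra X :: ('k, 'g free_word \<Rightarrow>\<^sub>0 'k) module)"
  shows "two_sided_ideal (\<Inter>F) (free_algebra X :: ('k, 'g free_word \<Rightarrow>\<^sub>0 'k) module)"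
proof -
  note iff = ring_embedding.two_sided_ideal_iff[OF free_algebra_embedding]
  let ?C = "carrier (free_algebra X :: ('k, 'g free_word \<Rightarrow>\<^sub>0 'k) module)"
  have I: "J \<subseteq> ?C" "0 \<in> J" "\<And>x y. x \<in> J \<Longrightarrow> y \<in> J \<Longrightarrow> x + y \<in> J" "\<And>x. x \<in> J \<Longrightarrow> - x \<in> J"
    "\<And>x y. x \<in> J \<Longrightarrow> y \<in> ?C \<Longrightarrow> x * y \<in> J" "\<And>x y. x \<in> J \<Longrightarrow> y \<in> ?C \<Longrightarrow> y * x \<in> J" if "J \<in> F" for J
    using assms(2)[OF that] unfolding iff ideal_in_def by auto
  show ?thesis unfolding iff ideal_in_def image_ident
  proof (intro conjI ballI)
    show "\<Inter>F \<subseteq> ?C" "\<Inter>F \<subseteq> ?C" using assms(1) I(1) by blast+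
  qed (use I in \<open>auto\<close>)
qed

locale free_quotient =
  fixes X :: "'g set" and N :: "('g free_word \<Rightarrow>\<^sub>0 'k::field) set"
  assumes N_ideal: "two_sided_ideal N (free_algebra X :: ('k, 'g free_word \<Rightarrow>\<^sub>0 'k) module)"
    and N_scale: "n \<in> N \<Longrightarrow> Poly_Mapping.single 0 c * n \<in> N"
begin

abbreviation "FA \<equiv> free_algebra X :: ('k, 'g free_word \<Rightarrow>\<^sub>0 'k) module"
abbreviation "W \<equiv> words_over X :: ('g free_word \<Rightarrow>\<^sub>0 'k) set"

lemma N_props:
  "N \<subseteq> carrier FA" "0 \<in> N" "n \<in> N \<Longrightarrow> m \<in> N \<Longrightarrow> n + m \<in> N" "n \<in> N \<Longrightarrow> - n \<in> N"
  "n \<in> N \<Longrightarrow> p \<in> carrier FA \<Longrightarrow> n * p \<in> N" "n \<in> N \<Longrightarrow> p \<in> carrier FA \<Longrightarrow> p * n \<in> N"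
  using N_ideal unfolding ring_embedding.two_sided_ideal_iff[OF free_algebra_embedding] ideal_in_def by auto

lemma carrier_W: "p \<in> carrier FA \<Longrightarrow> p \<in> W"
  by (simp add: carrier_free_algebra)

lemma N_W: "n \<in> N \<Longrightarrow> n \<in> W"
  using N_props(1) carrier_W by blast

lemma W_split: "p \<in> W \<Longrightarrow> p - Poly_Mapping.single 0 (Poly_Mapping.lookup p 0) \<in> carrier FA"
  by (simp add: carrier_free_algebra words_over_diff single_zero_words_over lookup_minus)

lemma N_mult_W: assumes "n \<in> N" "p \<in> W" shows "p * n \<in> N" "n * p \<in> N"
proof -
  let ?s = "Poly_Mapping.single 0 (Poly_Mapping.lookup p 0)"
  have "(p - ?s) * n + ?s * n \<in> N" "n * (p - ?s) + ?s * n \<in> N"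
    using assms W_split N_scale by (blast intro: N_props)+
  then show "p * n \<in> N" "n * p \<in> N"
    by (simp_all add: left_diff_distrib right_diff_distrib single_zero_central)
qed

text \<open>Composed with this map, a normal form takes values in \<open>W\<close> and remains
  additive on the whole type, as \<open>Endo\<close> demands.\<close>

definition restrict_words :: "('g free_word \<Rightarrow>\<^sub>0 'k) \<Rightarrow> ('g free_word \<Rightarrow>\<^sub>0 'k)" where
  "restrict_words p = Abs_poly_mapping (\<lambda>w. if set (letters w) \<subseteq> X then Poly_Mapping.lookup p w else 0)"

lemma lookup_restrict_words:
  "Poly_Mapping.lookup (restrict_words p) w = (if set (letters w) \<subseteq> X then Poly_Mapping.lookup p w else 0)"
proof -
  have "finite {w. (if set (letters w) \<subseteq> X then Poly_Mapping.lookup p w else 0) \<noteq> 0}"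
    by (rule finite_subset[OF _ finite_lookup[of p]]) auto
  then show ?thesis by (simp add: restrict_words_def)
qed

lemma restrict_words_add: "restrict_words (p + q) = restrict_words p + restrict_words q"
  by (rule poly_mapping_eqI) (simp add: lookup_restrict_words lookup_add)

lemma restrict_words_diff: "restrict_words (p - q) = restrict_words p - restrict_words q"
  by (rule poly_mapping_eqI) (simp add: lookup_restrict_words lookup_minus)

lemma restrict_words_W: "restrict_words p \<in> W"
  by (auto simp: words_over_def in_keys_iff lookup_restrict_words split: if_splits)

lemma restrict_words_id: "p \<in> W \<Longrightarrow> restrict_words p = p"
  by (rule poly_mapping_eqI) (auto simp: words_over_def in_keys_iff lookup_restrict_words)

lemma normal_form_exists:
  "\<exists>h. (\<forall>x y. h (x + y) = h x + h y) \<and> (\<forall>x. h x \<in> W) \<and> (\<forall>x\<in>W. h x - x \<in> N) \<and> (\<forall>x\<in>N. h x = 0)"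
proof -
  interpret vs: vector_space "\<lambda>c (p :: 'g free_word \<Rightarrow>\<^sub>0 'k). Poly_Mapping.single 0 c * p"
    by unfold_locales (simp_all add: distrib_left distrib_right single_add mult.assoc[symmetric] mult_single)
  have "vs.subspace N" by (rule vs.subspaceI) (simp_all add: N_props N_scale)
  from vs.subspace_projection[OF this] obtain h where h: "\<forall>x y. h (x + y) = h x + h y"
    "\<forall>x. h x - x \<in> N" "\<forall>x\<in>N. h x = 0" by blast
  have "restrict_words (h (restrict_words x)) - x \<in> N" if "x \<in> W" for x
  proof -
    have hx: "h x - x \<in> N" using h(2) by (rule spec)
    have "restrict_words (h x - x) = h x - x" by (rule restrict_words_id[OF N_W[OF hx]])
    then have "restrict_words (h x) - x = h x - x" using restrict_words_id[OF that] by (simp add: restrict_words_diff)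
    then show ?thesis using hx restrict_words_id[OF that] by simp
  qed
  moreover have "restrict_words (h (restrict_words x)) = 0" if "x \<in> N" for x
    using h(3) that restrict_words_id[OF N_W[OF that]] restrict_words_id[OF N_W[OF N_props(2)]] by simp
  ultimately show ?thesis using h(1) restrict_words_add restrict_words_W
    by (intro exI[of _ "\<lambda>x. restrict_words (h (restrict_words x))"]) simp
qed

definition "nf = (SOME h. (\<forall>x y. h (x + y) = h x + h y) \<and> (\<forall>x. h x \<in> W) \<and> (\<forall>x\<in>W. h x - x \<in> N) \<and> (\<forall>x\<in>N. h x = 0))"

lemma nf: "nf (x + y) = nf x + nf y" "nf x \<in> W" "x \<in> W \<Longrightarrow> nf x - x \<in> N" "x \<in> N \<Longrightarrow> nf x = 0"
  using someI_ex[OF normal_form_exists, folded nf_def] by blast+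

lemma nf_diff: "nf (x - y) = nf x - nf y"
  using nf(1)[of "x - y" y] by simp

lemma nf_cong: "x - y \<in> N \<Longrightarrow> nf x = nf y"
  using nf(4)[of "x - y"] by (simp add: nf_diff)

text \<open>Modulo \<open>N\<close>, the operator of left multiplication by \<open>x\<close>. It acts on normal forms, so that
  elements of the quotient become elements of a type of class \<open>ring\<close>.\<close>

definition T :: "('g free_word \<Rightarrow>\<^sub>0 'k) \<Rightarrow> ('g free_word \<Rightarrow>\<^sub>0 'k) endo" where
  "T x = Endo (\<lambda>y. nf (x * nf y))"

lemma app_T: "app (T x) y = nf (x * nf y)"
  unfolding T_def by (subst app_Endo) (simp_all add: nf distrib_left)

lemma T_add: "T (x + y) = T x + T y"
  by (rule endo_eqI) (simp add: app_T distrib_right nf)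

lemma T_diff: "T (x - y) = T x - T y"
  by (rule endo_eqI) (simp add: app_T left_diff_distrib nf_diff)

lemma T_zero [simp]: "T 0 = 0"
  using T_add[of 0 0] by simp

lemma T_sum: "T (sum g A) = (\<Sum>i\<in>A. T (g i))"
  by (induction A rule: infinite_finite_induct) (auto simp: T_add)

lemma T_mult:
  assumes "x \<in> W" "y \<in> W"
  shows "T (x * y) = T x * T y"
proof (rule endo_eqI)
  fix z
  let ?w = "y * nf z"
  have w: "?w \<in> W" using assms(2) nf(2) by (rule words_over_mult)
  have "nf ?w - ?w \<in> N" using nf(3)[OF w] .
  then have "nf (nf ?w) = nf ?w" by (rule nf_cong)
  moreover have "nf (x * nf ?w) = nf (x * ?w)"
    using N_mult_W(1)[OF \<open>nf ?w - ?w \<in> N\<close> assms(1)] by (intro nf_cong) (simp add: right_diff_distrib)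
  ultimately show "app (T (x * y)) z = app (T x * T y) z" by (simp add: app_T mult.assoc)
qed

text \<open>The operators act on polynomials with constant term, so \<open>T x\<close> can be
  applied to 1 and returns \<open>x\<close> modulo \<open>N\<close>. A ring without unit may fail to
  act faithfully on itself.\<close>

lemma T_eq_zero_iff:
  assumes "x \<in> W"
  shows "T x = 0 \<longleftrightarrow> x \<in> N"
proof
  assume "x \<in> N"
  then show "T x = 0" by (intro endo_eqI) (simp add: app_T nf(4) N_mult_W(2)[OF _ nf(2)])
next
  assume "T x = 0"
  then have 0: "nf (x * nf 1) = 0" by (metis app_T app_simps(1))
  have "(1::'g free_word \<Rightarrow>\<^sub>0 'k) \<in> W" using single_zero_words_over[of 1] by simp
  then have "x * (nf 1 - 1) \<in> N" using N_mult_W(1)[OF nf(3) assms] by blast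
  then have "nf (x * nf 1) = nf x" by (intro nf_cong) (simp add: right_diff_distrib)
  then have "nf x - x = - x" using 0 by simp
  then have "- x \<in> N" using nf(3)[OF assms] by simp
  then show "x \<in> N" using N_props(4) by fastforce
qed

lemma T_eq_iff: "x \<in> W \<Longrightarrow> y \<in> W \<Longrightarrow> T x = T y \<longleftrightarrow> x - y \<in> N"
  using T_eq_zero_iff[OF words_over_diff, of x y] by (simp add: T_diff)

lemma quotient_algebra_embedding:
  "ring_embedding (quotient_algebra FA N) (\<lambda>C. T (SOME x. x \<in> C)) (T ` carrier FA)"
  and T_coset: "x \<in> carrier FA \<Longrightarrow> T (SOME y. y \<in> N +>\<^bsub>FA\<^esub> x) = T x"
  and coset_carrier: "x \<in> carrier FA \<Longrightarrow> N +>\<^bsub>FA\<^esub> x \<in> carrier (quotient_algebra FA N)"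
proof -
  have e: "ring_embedding (FA Quot N) (\<lambda>C. T (SOME x. x \<in> C)) (T ` carrier FA)"
    and c: "\<And>x. x \<in> carrier FA \<Longrightarrow> T (SOME y. y \<in> N +>\<^bsub>FA\<^esub> x) = T x"
    using quotient_embedding[OF ring_embedding.is_nonunital_ring[OF free_algebra_embedding] N_ideal, of T]
      T_eq_zero_iff by (auto simp: free_algebra_fields T_add T_mult carrier_W)
  from e show "ring_embedding (quotient_algebra FA N) (\<lambda>C. T (SOME x. x \<in> C)) (T ` carrier FA)"
    unfolding ring_embedding_def by (simp add: quotient_algebra_def ring.defs)
  show "x \<in> carrier FA \<Longrightarrow> T (SOME y. y \<in> N +>\<^bsub>FA\<^esub> x) = T x" by (rule c)
  show "x \<in> carrier FA \<Longrightarrow> N +>\<^bsub>FA\<^esub> x \<in> carrier (quotient_algebra FA N)"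
    by (auto simp: quotient_algebra_def ring.defs FactRing_def A_RCOSETS_def')
qed

end

section \<open>The Leavitt path algebra and its universal property\<close>

context wf_digraph
begin

abbreviation lpa_FA :: "('k::field, ('a, 'b, 'k) lpa_free) module" where
  "lpa_FA \<equiv> free_algebra (lpa_letters G)"

lemma letter_carrier: "g \<in> lpa_letters G \<Longrightarrow> letter g \<in> carrier lpa_FA"
  by (auto simp: free_algebra_def)

lemma carrier_closed:
  "p \<in> carrier (lpa_FA :: ('k::field, ('a, 'b, 'k) lpa_free) module) \<Longrightarrow> q \<in> carrier lpa_FA \<Longrightarrow> p * q \<in> carrier lpa_FA"
  "p \<in> carrier (lpa_FA :: ('k::field, ('a, 'b, 'k) lpa_free) module) \<Longrightarrow> q \<in> carrier lpa_FA \<Longrightarrow> p - q \<in> carrier lpa_FA"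
  "p \<in> carrier (lpa_FA :: ('k::field, ('a, 'b, 'k) lpa_free) module) \<Longrightarrow> q \<in> carrier lpa_FA \<Longrightarrow> p + q \<in> carrier lpa_FA"
  "p \<in> carrier (lpa_FA :: ('k::field, ('a, 'b, 'k) lpa_free) module) \<Longrightarrow> Poly_Mapping.single 0 c * p \<in> carrier lpa_FA"
  "0 \<in> carrier (lpa_FA :: ('k::field, ('a, 'b, 'k) lpa_free) module)"
  by (simp_all add: carrier_free_algebra words_over_mult words_over_add words_over_diff lookup_mult_zero lookup_add
      lookup_minus single_zero_words_over single_zero_words_over[of 0, simplified])

lemma carrier_sum: "(\<And>i. i \<in> A \<Longrightarrow> p i \<in> carrier lpa_FA) \<Longrightarrow> sum p A \<in> carrier lpa_FA"
  by (induction A rule: infinite_finite_induct) (auto intro: carrier_closed)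

lemma letters_mem:
  "v \<in> verts G \<Longrightarrow> Vertex v \<in> lpa_letters G" "e \<in> arcs G \<Longrightarrow> Edge e \<in> lpa_letters G"
  "e \<in> arcs G \<Longrightarrow> Ghost e \<in> lpa_letters G"
  by (auto simp: lpa_letters_def)

lemma lpa_relations_carrier: "lpa_relations G \<subseteq> carrier lpa_FA"
  unfolding lpa_relations_def
  by (auto simp: regular_vertex_def intro!: carrier_closed carrier_sum letter_carrier letters_mem)

lemma lpa_relation_ideal_least:
  assumes "two_sided_ideal J lpa_FA" "\<And>c x. x \<in> J \<Longrightarrow> Poly_Mapping.single 0 c * x \<in> J" "lpa_relations G \<subseteq> J"
  shows "lpa_relation_ideal G \<subseteq> J"
  using assms unfolding lpa_relation_ideal_def generated_algebra_ideal_def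
  by (auto simp: free_algebra_fields)

lemma lpa_relations_ideal: "lpa_relations G \<subseteq> lpa_relation_ideal G"
  unfolding lpa_relation_ideal_def generated_algebra_ideal_def by blast

lemma free_quotient_lpa: "free_quotient (lpa_letters G) (lpa_relation_ideal G :: ('a, 'b, 'k::field) lpa_free set)"
proof -
  let ?F = "{J. two_sided_ideal J lpa_FA \<and> (\<forall>c. \<forall>x\<in>J. c \<odot>\<^bsub>lpa_FA\<^esub> x \<in> J) \<and> lpa_relations G \<subseteq> J} :: ('a, 'b, 'k) lpa_free set set"
  have "carrier lpa_FA \<in> ?F"
    by (intro CollectI conjI two_sided_ideal_free_algebra lpa_relations_carrier)
      (simp add: free_algebra_fields carrier_closed(4))
  then have "?F \<noteq> {}" by blast
  then have "two_sided_ideal (\<Inter>?F) lpa_FA" by (rule two_sided_ideal_Inter_free_algebra) simp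
  moreover have "Poly_Mapping.single 0 c * n \<in> \<Inter>?F" if "n \<in> \<Inter>?F" for c n
    using that by (simp add: free_algebra_fields)
  ultimately show ?thesis
    unfolding lpa_relation_ideal_def generated_algebra_ideal_def by (intro free_quotient.intro) 
qed

end

locale lpa_presentation = wf_digraph G for G :: "('v, 'e) pre_digraph" +
  fixes K :: "'k::field itself"

sublocale lpa_presentation \<subseteq> FQ: free_quotient "lpa_letters G" "lpa_relation_ideal G :: ('v, 'e, 'k) lpa_free set"
  by (rule free_quotient_lpa)

context lpa_presentation
begin

definition Sc :: "'k \<Rightarrow> ('v, 'e, 'k) lpa_free endo" where "Sc k = FQ.T (Poly_Mapping.single 0 k)"
definition Vx :: "'v \<Rightarrow> ('v, 'e, 'k) lpa_free endo" where "Vx v = FQ.T (letter (Vertex v))"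
definition Ex :: "'e \<Rightarrow> ('v, 'e, 'k) lpa_free endo" where "Ex e = FQ.T (letter (Edge e))"
definition Gx :: "'e \<Rightarrow> ('v, 'e, 'k) lpa_free endo" where "Gx e = FQ.T (letter (Ghost e))"

lemma letter_W: "g \<in> lpa_letters G \<Longrightarrow> letter g \<in> FQ.W"
  using letter_carrier FQ.carrier_W by blast

lemma T_relation:
  assumes "p - q \<in> lpa_relations G"
  shows "FQ.T p = FQ.T (q :: ('v, 'e, 'k) lpa_free)"
proof -
  have m: "p - q \<in> lpa_relation_ideal G" using assms lpa_relations_ideal by blast
  then have "FQ.T (p - q) = 0" using FQ.T_eq_zero_iff FQ.N_W by blast
  then show ?thesis by (simp add: FQ.T_diff)
qed

lemma T_letters: "g \<in> lpa_letters G \<Longrightarrow> h \<in> lpa_letters G \<Longrightarrow>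
    FQ.T (letter g) * FQ.T (letter h) = FQ.T (letter g * letter h)"
  by (simp add: FQ.T_mult letter_W)

lemma lpa_family_presentation: "lpa_family G Sc Vx Ex Gx"
proof
  note mem = letters_mem
  show "Sc (a + b) = Sc a + Sc b" for a b by (simp add: Sc_def single_add FQ.T_add)
  show "Sc (a * b) = Sc a * Sc b" for a b
    by (simp add: Sc_def FQ.T_mult[symmetric] single_zero_words_over mult_single)
  have comm: "FQ.T (letter g) * Sc a = Sc a * FQ.T (letter g)" if "g \<in> lpa_letters G" for g a
    using that by (simp add: Sc_def FQ.T_mult[symmetric] single_zero_words_over letter_W single_zero_central)
  show "Vx v * Sc a = Sc a * Vx v" if "v \<in> verts G" for v a using comm mem that by (simp add: Vx_def)
  show "Ex e * Sc a = Sc a * Ex e" "Gx e * Sc a = Sc a * Gx e" if "e \<in> arcs G" for e a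
    using comm mem that by (simp_all add: Ex_def Gx_def)
  show "Sc 1 * Vx v = Vx v" if "v \<in> verts G" for v
    using that mem by (simp add: Sc_def Vx_def FQ.T_mult[symmetric] single_zero_words_over letter_W del: single_one)
      (simp add: mult_single)
  show "Vx v * Vx w = (if v = w then Vx v else 0)" if v: "v \<in> verts G" "w \<in> verts G" for v w
  proof -
    have "letter (Vertex v) * letter (Vertex w) - (if v = w then letter (Vertex v) else 0) \<in> lpa_relations G"
      using v unfolding lpa_relations_def by blast
    from T_relation[OF this] show ?thesis using v mem by (simp add: Vx_def T_letters)
  qed
  fix e assume e: "e \<in> arcs G"
  have "letter (Vertex (tail G e)) * letter (Edge e) - letter (Edge e) \<in> lpa_relations G"
    using e unfolding lpa_relations_def by blast
  from T_relation[OF this] show "Vx (tail G e) * Ex e = Ex e" using e mem by (simp add: Vx_def Ex_def T_letters)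
  have "letter (Edge e) * letter (Vertex (head G e)) - letter (Edge e) \<in> lpa_relations G"
    using e unfolding lpa_relations_def by blast
  from T_relation[OF this] show "Ex e * Vx (head G e) = Ex e" using e mem by (simp add: Vx_def Ex_def T_letters)
  have "letter (Vertex (head G e)) * letter (Ghost e) - letter (Ghost e) \<in> lpa_relations G"
    using e unfolding lpa_relations_def by blast
  from T_relation[OF this] show "Vx (head G e) * Gx e = Gx e" using e mem by (simp add: Vx_def Gx_def T_letters)
  have "letter (Ghost e) * letter (Vertex (tail G e)) - letter (Ghost e) \<in> lpa_relations G"
    using e unfolding lpa_relations_def by blast
  from T_relation[OF this] show "Gx e * Vx (tail G e) = Gx e" using e mem by (simp add: Vx_def Gx_def T_letters)
  fix f assume f: "f \<in> arcs G"
  have "letter (Ghost e) * letter (Edge f) - (if e = f then letter (Vertex (head G e)) else 0) \<in> lpa_relations G"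
    using e f unfolding lpa_relations_def by blast
  from T_relation[OF this] show "Gx e * Ex f = (if e = f then Vx (head G e) else 0)"
    using e f mem by (simp add: Vx_def Ex_def Gx_def T_letters)
next
  fix v assume v: "regular_vertex G v"
  then have "letter (Vertex v) - (\<Sum>e \<in> out_arcs G v. letter (Edge e) * letter (Ghost e)) \<in> lpa_relations G"
    unfolding lpa_relations_def by blast
  from T_relation[OF this] have "Vx v = (\<Sum>e \<in> out_arcs G v. FQ.T (letter (Edge e) * letter (Ghost e)))"
    by (simp add: Vx_def FQ.T_sum)
  also have "\<dots> = (\<Sum>e \<in> out_arcs G v. Ex e * Gx e)"
    by (intro sum.cong refl) (simp add: Ex_def Gx_def T_letters letters_mem)
  finally show "Vx v = (\<Sum>e \<in> out_arcs G v. Ex e * Gx e)" .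
qed

end

sublocale lpa_presentation \<subseteq> lpa_family G Sc Vx Ex Gx
  by (rule lpa_family_presentation)

locale lpa_hom = src: lpa_family G sc V Ed Gh + tgt: lpa_family G sc' V' Ed' Gh'
  for G :: "('v, 'e) pre_digraph"
    and sc :: "'k::field \<Rightarrow> 'r::{ring,monoid_mult}" and V Ed Gh
    and sc' :: "'k \<Rightarrow> 's::{ring,monoid_mult}" and V' Ed' Gh' +
  fixes \<rho> :: "'r \<Rightarrow> 's"
  assumes \<rho>_add: "x \<in> src.L \<Longrightarrow> y \<in> src.L \<Longrightarrow> \<rho> (x + y) = \<rho> x + \<rho> y"
    and \<rho>_mult: "x \<in> src.L \<Longrightarrow> y \<in> src.L \<Longrightarrow> \<rho> (x * y) = \<rho> x * \<rho> y"
    and \<rho>_sc: "x \<in> src.L \<Longrightarrow> \<rho> (sc k * x) = sc' k * \<rho> x"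
    and \<rho>_V: "v \<in> verts G \<Longrightarrow> \<rho> (V v) = V' v"
    and \<rho>_Ed: "e \<in> arcs G \<Longrightarrow> \<rho> (Ed e) = Ed' e"
    and \<rho>_Gh: "e \<in> arcs G \<Longrightarrow> \<rho> (Gh e) = Gh' e"
begin

lemma \<rho>_zero [simp]: "\<rho> 0 = 0"
  using \<rho>_add[OF src.lspan_zero src.lspan_zero] by simp

lemma \<rho>_uminus: "x \<in> src.L \<Longrightarrow> \<rho> (- x) = - \<rho> x"
  using \<rho>_add[of "- x" x] src.lspan_uminus by (simp add: eq_neg_iff_add_eq_0)

lemma \<rho>_diff: "x \<in> src.L \<Longrightarrow> y \<in> src.L \<Longrightarrow> \<rho> (x - y) = \<rho> x - \<rho> y"
  using \<rho>_add[of x "- y"] \<rho>_uminus src.lspan_uminus by simp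

lemma \<rho>_sum: "(\<And>i. i \<in> A \<Longrightarrow> f i \<in> src.L) \<Longrightarrow> \<rho> (sum f A) = (\<Sum>i\<in>A. \<rho> (f i))"
  by (induction A rule: infinite_finite_induct) (auto simp: \<rho>_add src.lspan_sum)

lemma \<rho>_path: "src.awalk v p x \<Longrightarrow> \<rho> (src.path v p) = tgt.path v p"
  by (induction p arbitrary: v)
    (auto simp: src.awalk_Nil_iff src.awalk_Cons_iff \<rho>_V \<rho>_Ed \<rho>_mult src.Ed_L src.path_L)

lemma \<rho>_ghost: "src.awalk v p x \<Longrightarrow> \<rho> (src.ghost v p) = tgt.ghost v p"
  by (induction p arbitrary: v)
    (auto simp: src.awalk_Nil_iff src.awalk_Cons_iff \<rho>_V \<rho>_Gh \<rho>_mult src.Gh_L src.ghost_L)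

lemma \<rho>_monomial:
  assumes "src.awalk v p x" "src.awalk w q x"
  shows "\<rho> (sc k * src.path v p * src.ghost w q) = sc' k * tgt.path v p * tgt.ghost w q"
  using assms by (simp add: \<rho>_sc \<rho>_mult src.path_L src.ghost_L src.sc_path_L \<rho>_path \<rho>_ghost)

lemma \<rho>_L: "z \<in> src.L \<Longrightarrow> \<rho> z \<in> tgt.L"
proof (induction rule: src.lspan_induct_mono)
  case (add x y) then show ?case by (simp add: \<rho>_add tgt.lspan_add)
next
  case (monomial k v p x w q)
  then show ?case by (simp add: \<rho>_monomial tgt.lspan_monomial)
qed (simp add: tgt.lspan_zero)

lemma \<rho>_gap: "v \<in> verts G \<Longrightarrow> \<rho> (src.gap H v) = tgt.gap H v"
proof -
  assume v: "v \<in> verts G"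
  have L: "Ed e * Gh e \<in> src.L" if "e \<in> src.outer_arcs H v" for e
    using that by (intro src.L_mult src.Ed_L src.Gh_L) (auto simp: src.outer_arcs_def)
  have "\<rho> (\<Sum>e\<in>src.outer_arcs H v. Ed e * Gh e) = (\<Sum>e\<in>src.outer_arcs H v. \<rho> (Ed e * Gh e))"
    by (rule \<rho>_sum[OF L])
  also have "\<dots> = (\<Sum>e\<in>tgt.outer_arcs H v. Ed' e * Gh' e)"
    by (rule sum.cong) (auto simp: src.outer_arcs_def tgt.outer_arcs_def \<rho>_mult \<rho>_Ed \<rho>_Gh src.Ed_L src.Gh_L)
  finally have sum: "\<rho> (\<Sum>e\<in>src.outer_arcs H v. Ed e * Gh e) = (\<Sum>e\<in>tgt.outer_arcs H v. Ed' e * Gh' e)" .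
  have "(\<Sum>e\<in>src.outer_arcs H v. Ed e * Gh e) \<in> src.L" by (rule src.lspan_sum[OF L])
  then show ?thesis
    unfolding src.gap_def tgt.gap_def sum[symmetric] using \<rho>_diff[OF src.V_L[OF v]] v by (simp add: \<rho>_V)
qed

lemma \<rho>_evp: "src.awalk u c u \<Longrightarrow> \<rho> (src.evp u c f) = tgt.evp u c f"
  unfolding src.evp_def tgt.evp_def
  by (subst \<rho>_sum) (auto simp: \<rho>_sc \<rho>_path[OF src.awalk_pow_path] src.sc_path_L[OF src.awalk_pow_path]
      src.path_L[OF src.awalk_pow_path] intro!: sum.cong)

end

context lpa_presentation
begin

lemma letter_L:
  assumes "g \<in> lpa_letters G" shows "FQ.T (letter g) \<in> L"
proof -
  from assms consider v where "g = Vertex v" "v \<in> verts G" | e where "g = Edge e" "e \<in> arcs G"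
    | e where "g = Ghost e" "e \<in> arcs G" by (auto simp: lpa_letters_def)
  then show ?thesis
    by cases (simp_all add: V_L Ed_L Gh_L flip: Vx_def Ex_def Gx_def)
qed

lemma L_eq_image: "L = FQ.T ` carrier lpa_FA"
proof
  show "L \<subseteq> FQ.T ` carrier lpa_FA"
  proof
    fix z assume "z \<in> L"
    then show "z \<in> FQ.T ` carrier lpa_FA"
    proof (induction rule: L_induct)
      case zero
      show ?case using carrier_closed(5) FQ.T_zero by (metis imageI)
    next
      case (add x y)
      then obtain p q where "p \<in> carrier lpa_FA" "q \<in> carrier lpa_FA" "x = FQ.T p" "y = FQ.T q" by blast
      then show ?case using carrier_closed(3) FQ.T_add by (metis imageI)
    next
      case (sc_mult k x)
      then obtain p where p: "p \<in> carrier lpa_FA" "x = FQ.T p" by blast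
      then have "Sc k * x = FQ.T (Poly_Mapping.single 0 k * p)"
        by (simp add: Sc_def FQ.T_mult single_zero_words_over FQ.carrier_W)
      then show ?case using carrier_closed(4) p by blast
    next
      case (mult x y)
      then obtain p q where "p \<in> carrier lpa_FA" "q \<in> carrier lpa_FA" "x = FQ.T p" "y = FQ.T q" by blast
      then show ?case using carrier_closed(1) FQ.T_mult FQ.carrier_W by (metis imageI)
    qed (auto simp: Vx_def Ex_def Gx_def intro!: imageI letter_carrier letters_mem)
  qed
  have word: "FQ.T (Poly_Mapping.single (Word gs) 1) \<in> L" if "gs \<noteq> []" "set gs \<subseteq> lpa_letters G" for gs
    using that
  proof (induction gs rule: list_nonempty_induct)
    case (single g)
    then show ?case using letter_L by simp
  next
    case (cons g gs)
    have "FQ.T (letter g) \<in> L" using letter_L cons by simp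
    moreover have "Poly_Mapping.single (Word (g # gs)) 1 = letter g * Poly_Mapping.single (Word gs) (1::'k)"
      by (simp add: mult_single plus_free_word_def)
    moreover have "Poly_Mapping.single (Word gs) (1::'k) \<in> FQ.W" using cons by (simp add: words_over_def)
    ultimately show ?case using cons letter_W by (simp add: FQ.T_mult L_mult)
  qed
  show "FQ.T ` carrier lpa_FA \<subseteq> L"
  proof
    fix z assume "z \<in> FQ.T ` carrier lpa_FA"
    then obtain p where p: "p \<in> carrier lpa_FA" "z = FQ.T p" by blast
    have "z = (\<Sum>w\<in>Poly_Mapping.keys p. FQ.T (Poly_Mapping.single w (Poly_Mapping.lookup p w)))"
      unfolding p(2) by (subst poly_mapping_decompose[of p]) (rule FQ.T_sum)
    also have "\<dots> \<in> L"
    proof (rule lspan_sum)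
      fix w assume w: "w \<in> Poly_Mapping.keys p"
      then have w': "letters w \<noteq> []" "set (letters w) \<subseteq> lpa_letters G" using p(1) by (auto simp: free_algebra_def)
      have "Poly_Mapping.single w (Poly_Mapping.lookup p w) =
        Poly_Mapping.single 0 (Poly_Mapping.lookup p w) * Poly_Mapping.single (Word (letters w)) 1"
        by (simp add: mult_single)
      moreover have "Poly_Mapping.single (Word (letters w)) (1::'k) \<in> FQ.W" using w' by (simp add: words_over_def)
      ultimately have "FQ.T (Poly_Mapping.single w (Poly_Mapping.lookup p w)) =
          Sc (Poly_Mapping.lookup p w) * FQ.T (Poly_Mapping.single (Word (letters w)) 1)"
        by (simp only: FQ.T_mult single_zero_words_over Sc_def)
      then show "FQ.T (Poly_Mapping.single w (Poly_Mapping.lookup p w)) \<in> L"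
        using word[OF w'] sc_lspan by simp
    qed
    finally show "z \<in> L" .
  qed
qed

text \<open>Evaluation at the target family kills the relations, hence the ideal generated by them,
  and so descends to \<open>L\<close>.\<close>

theorem universal_property:
  fixes sc' :: "'k \<Rightarrow> 's::{ring,monoid_mult}"
  assumes "lpa_family G sc' V' Ed' Gh'"
  shows "\<exists>\<rho>. lpa_hom G Sc Vx Ex Gx sc' V' Ed' Gh' \<rho>"
proof -
  interpret tgt: lpa_family G sc' V' Ed' Gh' by (rule assms)
  define f where "f = (\<lambda>g. case g of Vertex v \<Rightarrow> V' v | Edge e \<Rightarrow> Ed' e | Ghost e \<Rightarrow> Gh' e)"
  interpret ev: scalar_hom sc' f "lpa_letters G"
    by unfold_locales
      (auto simp: tgt.sc_add tgt.sc_mult f_def lpa_letters_def tgt.sc_V tgt.sc_Ed tgt.sc_Gh)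
  let ?ev = "eval_free sc' f"
  have ev_mult: "?ev (p * q) = ?ev p * ?ev q" if "p \<in> FQ.W" for p q using ev.eval_mult that .
  have sc1: "sc' 1 * Ed' e = Ed' e" "sc' 1 * Gh' e = Gh' e" if "e \<in> arcs G" for e
    using that tgt.sc_one tgt.V_Ed tgt.V_Gh by (metis mult.assoc tail_in_verts head_in_verts)+
  have ev_letter: "v \<in> verts G \<Longrightarrow> ?ev (letter (Vertex v)) = V' v" "e \<in> arcs G \<Longrightarrow> ?ev (letter (Edge e)) = Ed' e"
    "e \<in> arcs G \<Longrightarrow> ?ev (letter (Ghost e)) = Gh' e" for v e
    by (simp_all add: ev.eval_single) (simp_all add: f_def tgt.sc_one sc1)
  define J where "J = {p \<in> carrier lpa_FA. ?ev p = 0}"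
  have "lpa_relation_ideal G \<subseteq> J"
  proof (rule lpa_relation_ideal_least)
    show "two_sided_ideal J lpa_FA"
      unfolding ring_embedding.two_sided_ideal_iff[OF free_algebra_embedding] ideal_in_def image_ident
      by (auto simp: J_def carrier_closed ev.eval_add ev.eval_uminus ev_mult FQ.carrier_W)
        (simp add: carrier_free_algebra words_over_uminus)
    show "Poly_Mapping.single 0 c * x \<in> J" if "x \<in> J" for c x
      using that by (simp add: J_def carrier_closed ev_mult single_zero_words_over)
    show "lpa_relations G \<subseteq> J"
    proof
      fix r :: "('v, 'e, 'k) lpa_free" assume r: "r \<in> lpa_relations G"
      have "?ev r = 0" using r unfolding lpa_relations_def
        by (elim UnE CollectE exE conjE; simp add: ev.eval_diff ev_mult letter_W letters_mem ev_letter tgt.V_V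
            tgt.V_Ed tgt.Ed_V tgt.V_Gh tgt.Gh_V tgt.Gh_Ed ev.eval_sum tgt.V_regular)
          (simp_all add: regular_vertex_def ev_letter tgt.V_regular[unfolded regular_vertex_def])
      then show "r \<in> J" using r lpa_relations_carrier by (auto simp: J_def)
    qed
  qed
  then have wd: "?ev p = ?ev q" if "p \<in> FQ.W" "q \<in> FQ.W" "FQ.T p = FQ.T q" for p q
    using that FQ.T_eq_iff[of p q] ev.eval_diff[of p q] by (auto simp: J_def)
  \<comment> \<open>By \<open>wd\<close> the value does not depend on the polynomial chosen.\<close>
  define \<rho> where "\<rho> z = ?ev (SOME p. p \<in> carrier lpa_FA \<and> FQ.T p = z)" for z
  have \<rho>: "\<rho> (FQ.T p) = ?ev p" if p: "p \<in> carrier lpa_FA" for p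
  proof -
    have "(SOME q. q \<in> carrier lpa_FA \<and> FQ.T q = FQ.T p) \<in> carrier lpa_FA \<and>
      FQ.T (SOME q. q \<in> carrier lpa_FA \<and> FQ.T q = FQ.T p) = FQ.T p"
      by (rule someI[of _ p]) (use p in simp)
    then show ?thesis unfolding \<rho>_def using wd p FQ.carrier_W by blast
  qed
  have rep: "\<exists>p. p \<in> carrier lpa_FA \<and> z = FQ.T p" if "z \<in> L" for z using that L_eq_image by blast
  have "lpa_hom G Sc Vx Ex Gx sc' V' Ed' Gh' \<rho>"
  proof
    fix x y assume "x \<in> L" "y \<in> L"
    then obtain p q where pq: "p \<in> carrier lpa_FA" "x = FQ.T p" "q \<in> carrier lpa_FA" "y = FQ.T q" using rep by meson
    then show "\<rho> (x + y) = \<rho> x + \<rho> y"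
      using \<rho>[OF carrier_closed(3)[OF pq(1,3)]] \<rho> by (simp add: FQ.T_add ev.eval_add)
    show "\<rho> (x * y) = \<rho> x * \<rho> y"
      using pq \<rho>[OF carrier_closed(1)[OF pq(1,3)]] \<rho> by (simp add: FQ.T_mult FQ.carrier_W ev_mult)
  next
    fix x k assume "x \<in> L"
    then obtain p where p: "p \<in> carrier lpa_FA" "x = FQ.T p" using rep by meson
    then have "Sc k * x = FQ.T (Poly_Mapping.single 0 k * p)"
      by (simp add: Sc_def FQ.T_mult single_zero_words_over FQ.carrier_W)
    then show "\<rho> (Sc k * x) = sc' k * \<rho> x"
      using p \<rho>[OF carrier_closed(4)[OF p(1)], of k] \<rho> by (simp add: ev_mult single_zero_words_over ev.eval_single)
  qed (simp_all add: Vx_def Ex_def Gx_def \<rho> letter_carrier letters_mem ev_letter)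
  then show ?thesis by blast
qed

end

section \<open>Boundary path representations\<close>

lemma sum_fun_apply: "(\<Sum>i\<in>A. f i :: 'x \<Rightarrow> 'b::ab_group_add) x = (\<Sum>i\<in>A. f i x)"
  by (induction A rule: infinite_finite_induct) auto

text \<open>
  A point \<open>(v, p)\<close> stands for the boundary path that starts with the path \<open>p\<close> from \<open>v\<close> outside \<open>H\<close> and then
  follows the arcs chosen by \<open>nxt\<close> as long as there are any. It is reduced if \<open>p\<close> does not itself
  end with a chosen arc, so distinct reduced points stand for distinct boundary paths.
\<close>

locale boundary_rep = wf_digraph G for G :: "('v, 'e) pre_digraph" +
  fixes H :: "'v set" and nxt :: "'v \<Rightarrow> 'e option" and \<iota> :: "'k::field \<Rightarrow> 'f::field" and wt :: "'e \<Rightarrow> 'f"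
  assumes H: "hereditary G H"
    and nxt: "nxt v = Some e \<Longrightarrow> e \<in> arcs G \<and> tail G e = v \<and> head G e \<notin> H"
    and nxt_regular: "regular_vertex G v \<Longrightarrow> v \<notin> H \<Longrightarrow> nxt v \<noteq> None"
    and scalar_hom: "\<iota> (a + b) = \<iota> a + \<iota> b" "\<iota> (a * b) = \<iota> a * \<iota> b" "\<iota> 1 = 1"
    and wt: "wt e \<noteq> 0"
begin

definition points :: "('v \<times> 'e list) set" where
  "points = {(v, p). (\<exists>w. awalk v p w \<and> w \<notin> H) \<and> (p \<noteq> [] \<longrightarrow> nxt (tail G (last p)) \<noteq> Some (last p))}"

text \<open>\<open>strip e\<close> removes \<open>e\<close> if the boundary path begins with it; at
  \<open>(v, [])\<close> the first arc is the chosen one. Conversely, \<open>prepend\<close>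
  swallows a chosen arc before an empty list, to keep points reduced.\<close>

fun strip :: "'e \<Rightarrow> 'v \<times> 'e list \<Rightarrow> ('v \<times> 'e list) option" where
  "strip e (v, []) = (if nxt v = Some e then Some (head G e, []) else None)"
| "strip e (v, f # q) = (if f = e then Some (head G e, q) else None)"

fun prepend :: "'e \<Rightarrow> 'v \<times> 'e list \<Rightarrow> 'v \<times> 'e list" where
  "prepend e (v, p) = (if p = [] \<and> nxt (tail G e) = Some e then (tail G e, []) else (tail G e, e # p))"

lemma points_start: "x \<in> points \<Longrightarrow> fst x \<in> verts G - H"
proof -
  assume "x \<in> points"
  then obtain w where w: "awalk (fst x) (snd x) w" "w \<notin> H" by (cases x) (auto simp: points_def)
  then show ?thesis using hereditary_awalk[OF H _ w(1)] awalk_hd_in_verts by blast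
qed

lemma points_Nil: "(v, []) \<in> points \<longleftrightarrow> v \<in> verts G - H"
  by (auto simp: points_def awalk_Nil_iff)

lemma strip_point:
  assumes "x \<in> points" "strip e x = Some y"
  shows "e \<in> arcs G" "y \<in> points" "fst y = head G e" "fst x = tail G e" "prepend e y = x"
proof -
  obtain v p where x: "x = (v, p)" by (cases x)
  have "e \<in> arcs G \<and> y \<in> points \<and> fst y = head G e \<and> fst x = tail G e \<and> prepend e y = x"
  proof (cases p)
    case Nil
    then have n: "nxt v = Some e" "y = (head G e, [])" using assms x by (auto split: if_splits)
    then have "e \<in> arcs G" "tail G e = v" "head G e \<notin> H" using nxt by auto
    then show ?thesis using n x Nil by (auto simp: points_Nil)
  next
    case (Cons f q)
    then have f: "f = e" "y = (head G e, q)" using assms x by (auto split: if_splits)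
    obtain w where w: "awalk v (e # q) w" "w \<notin> H" "nxt (tail G (last (e # q))) \<noteq> Some (last (e # q))"
      using assms(1) x Cons f by (auto simp: points_def)
    then have "e \<in> arcs G" "v = tail G e" "awalk (head G e) q w" by (auto simp: awalk_Cons_iff)
    then show ?thesis using w f x Cons by (auto simp: points_def)
  qed
  then show "e \<in> arcs G" "y \<in> points" "fst y = head G e" "fst x = tail G e" "prepend e y = x" by auto
qed

lemma prepend_point:
  assumes "x \<in> points" "fst x = head G e" "e \<in> arcs G"
  shows "prepend e x \<in> points" "fst (prepend e x) = tail G e" "strip e (prepend e x) = Some x"
proof -
  obtain p where x: "x = (head G e, p)" using assms by (cases x) auto
  obtain w where w: "awalk (head G e) p w" "w \<notin> H" "p \<noteq> [] \<longrightarrow> nxt (tail G (last p)) \<noteq> Some (last p)"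
    using assms x by (auto simp: points_def)
  have "awalk (tail G e) (e # p) w" using w assms by (simp add: awalk_Cons_iff)
  moreover have "tail G e \<notin> H"
    using hereditary_awalk[OF H _ \<open>awalk (tail G e) (e # p) w\<close>] w by blast
  ultimately show "prepend e x \<in> points" "fst (prepend e x) = tail G e" "strip e (prepend e x) = Some x"
    using w x assms by (auto simp: points_def awalk_Nil_iff)
qed

lemma strip_unique: "strip e x = Some y \<Longrightarrow> strip f x = Some z \<Longrightarrow> e = f"
  by (cases x; cases "snd x") (auto split: if_splits)

lemma strip_regular:
  assumes "x \<in> points" "regular_vertex G (fst x)"
  shows "\<exists>e\<in>out_arcs G (fst x). \<exists>y. strip e x = Some y"
proof -
  obtain v p where x: "x = (v, p)" by (cases x)
  show ?thesis
  proof (cases p)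
    case Nil
    then obtain e where e: "nxt v = Some e" using nxt_regular points_start assms x by fastforce
    then show ?thesis using nxt[OF e] x Nil by (intro bexI[of _ e]) auto
  next
    case (Cons f q)
    then show ?thesis using assms x by (intro bexI[of _ f]) (auto simp: points_def awalk_Cons_iff)
  qed
qed

text \<open>Functions live on all pairs, but \<open>opV\<close>, \<open>opE\<close> and
  \<open>opG\<close> yield functions that vanish off \<open>points\<close>. The weights in
  \<open>opE\<close> and \<open>opG\<close> are mutually inverse, so the relations hold for any
  nonzero weights.\<close>

definition opS :: "'k \<Rightarrow> ('v \<times> 'e list \<Rightarrow> 'f) endo" where
  "opS k = Endo (\<lambda>f x. \<iota> k * f x)"
definition opV :: "'v \<Rightarrow> ('v \<times> 'e list \<Rightarrow> 'f) endo" where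
  "opV v = Endo (\<lambda>f x. if x \<in> points \<and> fst x = v then f x else 0)"
definition opE :: "'e \<Rightarrow> ('v \<times> 'e list \<Rightarrow> 'f) endo" where
  "opE e = Endo (\<lambda>f x. if x \<in> points then (case strip e x of None \<Rightarrow> 0 | Some y \<Rightarrow> wt e * f y) else 0)"
definition opG :: "'e \<Rightarrow> ('v \<times> 'e list \<Rightarrow> 'f) endo" where
  "opG e = Endo (\<lambda>f x. if x \<in> points \<and> fst x = head G e then inverse (wt e) * f (prepend e x) else 0)"

lemma app_ops:
  "app (opS k) f x = \<iota> k * f x"
  "app (opV v) f x = (if x \<in> points \<and> fst x = v then f x else 0)"
  "app (opE e) f x = (if x \<in> points then (case strip e x of None \<Rightarrow> 0 | Some y \<Rightarrow> wt e * f y) else 0)"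
  "app (opG e) f x = (if x \<in> points \<and> fst x = head G e then inverse (wt e) * f (prepend e x) else 0)"
  unfolding opS_def opV_def opE_def opG_def
  by (subst app_Endo; auto simp: fun_eq_iff algebra_simps split: option.split)+

lemma endo_fun_eqI: "(\<And>f x. app a f x = app b f x) \<Longrightarrow> a = (b :: ('x \<Rightarrow> 'f) endo)"
  by (intro endo_eqI) auto

lemma lpa_family_boundary: "lpa_family G opS opV opE opG"
proof
  show "opS (a + b) = opS a + opS b" "opS (a * b) = opS a * opS b" for a b
    by (rule endo_fun_eqI, simp add: app_ops scalar_hom algebra_simps)+
  show "opV v * opS a = opS a * opV v" "opS 1 * opV v = opV v" for v a
    by (rule endo_fun_eqI, simp add: app_ops scalar_hom)+
  show "opV v * opV w = (if v = w then opV v else 0)" for v w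
    by (rule endo_fun_eqI) (auto simp: app_ops)
  fix e :: 'e and a
  show "opE e * opS a = opS a * opE e" "opG e * opS a = opS a * opG e"
    by (rule endo_fun_eqI, simp add: app_ops split: option.split)+
next
  fix e assume e: "e \<in> arcs G"
  show "opV (tail G e) * opE e = opE e"
    by (rule endo_fun_eqI) (auto simp: app_ops strip_point split: option.split dest: strip_point(2-4))
  show "opE e * opV (head G e) = opE e"
    by (rule endo_fun_eqI) (auto simp: app_ops strip_point split: option.split dest: strip_point(2-4))
  show "opV (head G e) * opG e = opG e"
    by (rule endo_fun_eqI) (auto simp: app_ops)
  show "opG e * opV (tail G e) = opG e"
    using e by (intro endo_fun_eqI) (auto simp: app_ops prepend_point)
  fix f assume f: "f \<in> arcs G"
  show "opG e * opE f = (if e = f then opV (head G e) else 0)"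
  proof (rule endo_fun_eqI)
    fix g x
    show "app (opG e * opE f) g x = app (if e = f then opV (head G e) else 0) g x"
    proof (cases "x \<in> points \<and> fst x = head G e")
      case True
      then have p: "prepend e x \<in> points" "strip e (prepend e x) = Some x" using prepend_point e by auto
      then have "e \<noteq> f \<Longrightarrow> strip f (prepend e x) = None" using strip_unique by (metis option.exhaust)
      then show ?thesis using p True wt[of e] by (auto simp: app_ops)
    qed (auto simp: app_ops)
  qed
next
  fix v assume v: "regular_vertex G v"
  show "opV v = (\<Sum>e\<in>out_arcs G v. opE e * opG e)"
  proof (rule endo_fun_eqI)
    fix g x
    have s: "app (\<Sum>e\<in>out_arcs G v. opE e * opG e) g x = (\<Sum>e\<in>out_arcs G v. app (opE e) (app (opG e) g) x)"
      by (simp add: app_sum_left sum_fun_apply)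
    show "app (opV v) g x = app (\<Sum>e\<in>out_arcs G v. opE e * opG e) g x"
    proof (cases "x \<in> points \<and> fst x = v")
      case True
      then obtain e y where e: "e \<in> out_arcs G v" "strip e x = Some y" using strip_regular v by blast
      note y = strip_point[OF _ e(2)]
      have "app (opE f) (app (opG f) g) x = (if f = e then g x else 0)" for f
      proof (cases "f = e")
        case True
        then show ?thesis using \<open>x \<in> points \<and> fst x = v\<close> e y wt[of e] by (simp add: app_ops)
      next
        case False
        then have "strip f x = None" using strip_unique[OF e(2)] by (metis option.exhaust)
        then show ?thesis using False by (simp add: app_ops)
      qed
      then show ?thesis unfolding s using True e v by (simp add: app_ops regular_vertex_def)
    next
      case False
      have "app (opE f) (app (opG f) g) x = 0" if "f \<in> out_arcs G v" for f
        using False that strip_point(4)[of x f] by (auto simp: app_ops split: option.split)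
      then have "(\<Sum>f\<in>out_arcs G v. app (opE f) (app (opG f) g) x) = 0" by (intro sum.neutral ballI)
      then show ?thesis unfolding s using False by (auto simp: app_ops(2))
    qed
  qed
qed

sublocale lpa_family G opS opV opE opG
  by (rule lpa_family_boundary)

end

section \<open>Operators on functions on finitely many points\<close>

definition linear_endo :: "('x \<Rightarrow> 'f::field) endo \<Rightarrow> bool" where
  "linear_endo z \<longleftrightarrow> (\<forall>c f. app z (\<lambda>x. c * f x) = (\<lambda>x. c * app z f x))"

text \<open>Such an operator acts on the quotient by the functions vanishing on \<open>Y\<close>,
  which is the space of functions on \<open>Y\<close>.\<close>

definition stable_on :: "'x set \<Rightarrow> ('x \<Rightarrow> 'f::field) endo \<Rightarrow> bool" where
  "stable_on Y z \<longleftrightarrow> (\<forall>f. (\<forall>y\<in>Y. f y = 0) \<longrightarrow> (\<forall>y\<in>Y. app z f y = 0))"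

lemma stable_on_cong:
  assumes "stable_on Y z" "\<And>y. y \<in> Y \<Longrightarrow> f y = g y" "y \<in> Y"
  shows "app z f y = app z g y"
proof -
  have "app z (f - g) y = 0" using assms unfolding stable_on_def by simp
  then show ?thesis by (simp add: app_diff)
qed

definition delta :: "'x \<Rightarrow> 'x \<Rightarrow> 'f::field" where "delta y = (\<lambda>x. if x = y then 1 else 0)"

lemma stable_on_expand:
  assumes Y: "finite Y" and z: "stable_on Y z" "linear_endo z" and y: "y \<in> Y"
  shows "app z f y = (\<Sum>x\<in>Y. app z (delta x) y * f x)"
proof -
  have "app z f y = app z (\<Sum>x\<in>Y. (\<lambda>t. f x * delta x t)) y"
  proof (rule stable_on_cong[OF z(1) _ y])
    fix t assume "t \<in> Y"
    then show "f t = (\<Sum>x\<in>Y. (\<lambda>t. f x * delta x t)) t"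
      using Y by (simp add: sum_fun_apply delta_def if_distrib cong: if_cong)
  qed
  also have "\<dots> = (\<Sum>x\<in>Y. app z (\<lambda>t. f x * delta x t) y)" by (simp add: app_sum sum_fun_apply)
  also have "\<dots> = (\<Sum>x\<in>Y. app z (delta x) y * f x)"
    using z(2) unfolding linear_endo_def by (intro sum.cong refl) simp
  finally show ?thesis .
qed

text \<open>On a nonzero space of finite dimension, \<open>x \<oplus> x \<lesssim> x\<close> is impossible for an invertible scalar \<open>x\<close>;
  determinants show it.\<close>

lemma no_doubling_finite_dim:
  fixes A B A' B' x :: "('x \<Rightarrow> 'f::field) endo"
  assumes Y: "finite Y" "Y \<noteq> {}"
    and st: "stable_on Y A" "stable_on Y B" "stable_on Y A'" "stable_on Y B'"
    and lin: "linear_endo A" "linear_endo B" "linear_endo A'" "linear_endo B'"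
    and s: "s \<noteq> 0" "\<And>f y. y \<in> Y \<Longrightarrow> app x f y = s * f y"
    and e: "A * x * B = q" "A' * x * B' = q" "A * x * B' = 0"
    and q: "c \<noteq> 0" "\<And>f y. y \<in> Y \<Longrightarrow> app q f y = c * f y"
  shows False
proof -
  define n where "n = card Y"
  have n: "n > 0" using Y by (simp add: n_def card_gt_0_iff)
  obtain h where h: "bij_betw h {..<n} Y"
    using ex_bij_betw_nat_finite[OF Y(1)] unfolding n_def lessThan_atLeast0 by blast
  have hY: "i < n \<Longrightarrow> h i \<in> Y" for i using h by (auto simp: bij_betw_def)
  have hinj: "i < n \<Longrightarrow> j < n \<Longrightarrow> h i = h j \<longleftrightarrow> i = j" for i j using h by (auto simp: bij_betw_def inj_on_def)
  define \<mu> where "\<mu> z = mat n n (\<lambda>(i, j). app z (delta (h j)) (h i))" for z :: "('x \<Rightarrow> 'f) endo"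
  have \<mu>c: "\<mu> z \<in> carrier_mat n n" for z by (simp add: \<mu>_def)
  have prod: "(\<mu> a * \<mu> b) $$ (i, j) = inverse s * app (a * x * b) (delta (h j)) (h i)"
    if a: "stable_on Y a" "linear_endo a" and ij: "i < n" "j < n" for a b i j
  proof -
    have "(\<mu> a * \<mu> b) $$ (i, j) = (\<Sum>k<n. app a (delta (h k)) (h i) * app b (delta (h j)) (h k))"
      using ij by (simp add: \<mu>_def scalar_prod_def lessThan_atLeast0)
    also have "\<dots> = (\<Sum>y\<in>Y. app a (delta y) (h i) * app b (delta (h j)) y)"
      by (rule sum.reindex_bij_betw[OF h])
    also have "\<dots> = app a (app b (delta (h j))) (h i)"
      by (rule stable_on_expand[OF Y(1) a hY[OF ij(1)], symmetric])
    finally have M: "(\<mu> a * \<mu> b) $$ (i, j) = app a (app b (delta (h j))) (h i)" .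
    have "s * app a (app b (delta (h j))) (h i) = app a (\<lambda>t. s * app b (delta (h j)) t) (h i)"
      using a(2) by (simp add: linear_endo_def)
    also have "\<dots> = app a (app x (app b (delta (h j)))) (h i)"
      using s(2) by (intro stable_on_cong[OF a(1) _ hY[OF ij(1)]]) simp
    finally have "app a (app b (delta (h j))) (h i) = inverse s * app (a * x * b) (delta (h j)) (h i)"
      using s(1) by (simp add: field_simps)
    with M show ?thesis by (rule trans)
  qed
  have one: "\<mu> a * \<mu> b = (inverse s * c) \<cdot>\<^sub>m 1\<^sub>m n" if "stable_on Y a" "linear_endo a" "a * x * b = q" for a b
  proof (rule eq_matI)
    fix i j assume "i < dim_row ((inverse s * c) \<cdot>\<^sub>m 1\<^sub>m n)" "j < dim_col ((inverse s * c) \<cdot>\<^sub>m 1\<^sub>m n)"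
    then have ij: "i < n" "j < n" by auto
    have "(\<mu> a * \<mu> b) $$ (i, j) = inverse s * app (a * x * b) (delta (h j)) (h i)" by (rule prod[OF that(1,2) ij])
    also have "\<dots> = ((inverse s * c) \<cdot>\<^sub>m 1\<^sub>m n) $$ (i, j)"
      unfolding that(3) q(2)[OF hY[OF ij(1)]] using ij hinj[OF ij] by (simp add: delta_def)
    finally show "(\<mu> a * \<mu> b) $$ (i, j) = ((inverse s * c) \<cdot>\<^sub>m 1\<^sub>m n) $$ (i, j)" .
  qed (simp_all add: \<mu>_def)
  have zero: "\<mu> A * \<mu> B' = 0\<^sub>m n n"
  proof (rule eq_matI)
    fix i j assume "i < dim_row (0\<^sub>m n n)" "j < dim_col (0\<^sub>m n n)"
    then have ij: "i < n" "j < n" by auto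
    have "(\<mu> A * \<mu> B') $$ (i, j) = inverse s * app (A * x * B') (delta (h j)) (h i)"
      by (rule prod[OF st(1) lin(1) ij])
    also have "\<dots> = 0\<^sub>m n n $$ (i, j)" unfolding e(3) using ij by simp
    finally show "(\<mu> A * \<mu> B') $$ (i, j) = 0\<^sub>m n n $$ (i, j)" .
  qed (simp_all add: \<mu>_def)
  \<comment> \<open>As \<open>x\<close> acts on \<open>Y\<close> as the scalar \<open>s\<close>, the
    products in \<open>e\<close> become matrix products up to \<open>s\<close>. The matrices of
    \<open>A\<close> and \<open>B'\<close> are then invertible but have product 0.\<close>
  have "det (\<mu> A) * det (\<mu> B) \<noteq> 0" "det (\<mu> A') * det (\<mu> B') \<noteq> 0"
    using arg_cong[OF one[OF st(1) lin(1) e(1)], of det] arg_cong[OF one[OF st(3) lin(3) e(2)], of det] s(1) q(1)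
    by (simp_all add: det_mult[OF \<mu>c \<mu>c])
  moreover have "det (\<mu> A) * det (\<mu> B') = 0" using arg_cong[OF zero, of det] det_zero[OF n] by (simp add: det_mult[OF \<mu>c \<mu>c])
  ultimately show False by simp
qed

section \<open>Multiplication operators modulo a polynomial\<close>

text \<open>A nonconstant divisor of least degree is irreducible, so the residues modulo
  \<open>g\<close> form a field, as the last clause expresses. The inverses come from an element of
  least degree in the ideal generated by \<open>g\<close> and \<open>h\<close>.\<close>

lemma irreducible_divisor_exists:
  fixes q :: "'k::field poly"
  assumes q: "degree q \<ge> 1"
  shows "\<exists>g. degree g \<ge> 1 \<and> g dvd q \<and> (\<forall>h. \<not> g dvd h \<longrightarrow> (\<exists>h'. g dvd h * h' - 1))"
proof -
  obtain g where g: "g dvd q" "degree g \<ge> 1" and min: "\<And>d. d dvd q \<Longrightarrow> degree d \<ge> 1 \<Longrightarrow> degree g \<le> degree d"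
    using exists_least_iff[of "\<lambda>n. \<exists>g. g dvd q \<and> degree g \<ge> 1 \<and> degree g = n"] q by (metis dvd_refl not_less)
  have "\<exists>h'. g dvd h * h' - 1" if h: "\<not> g dvd h" for h
  proof -
    define I where "I = {d. \<exists>a b. d = a * g + b * h}"
    have gI: "g \<in> I" "h \<in> I" unfolding I_def
      by (auto intro: exI[of _ 1] exI[of _ 0])
    have "g \<noteq> 0" using g by auto
    obtain d where d: "d \<in> I" "d \<noteq> 0" and dmin: "\<And>e. e \<in> I \<Longrightarrow> e \<noteq> 0 \<Longrightarrow> degree d \<le> degree e"
      using exists_least_iff[of "\<lambda>n. \<exists>d. d \<in> I \<and> d \<noteq> 0 \<and> degree d = n"] gI \<open>g \<noteq> 0\<close> by (metis not_less)
    obtain a b where ab: "d = a * g + b * h" using d by (auto simp: I_def)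
    have dvd: "d dvd e" if e: "e \<in> I" for e
    proof (rule ccontr)
      assume n: "\<not> d dvd e"
      obtain a' b' where "e = a' * g + b' * h" using e by (auto simp: I_def)
      then have "e mod d = (a' - e div d * a) * g + (b' - e div d * b) * h"
        using minus_div_mult_eq_mod[of e d] ab by (simp add: algebra_simps)
      then have "e mod d \<in> I" unfolding I_def by blast
      moreover have "e mod d \<noteq> 0" using n by (simp add: mod_eq_0_iff_dvd)
      ultimately show False using dmin[of "e mod d"] degree_mod_less[of d e] d(2) by auto
    qed
    \<comment> \<open>A nonconstant \<open>d\<close> divides \<open>g\<close> and so
      \<open>q\<close>; by minimality it is a scalar multiple of \<open>g\<close>, and
      \<open>g\<close> would divide \<open>h\<close>.\<close>
    have "degree d = 0"
    proof (rule ccontr)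
      assume n: "degree d \<noteq> 0"
      obtain e where e: "g = d * e" using dvd[OF gI(1)] by blast
      have "d dvd q" using dvd[OF gI(1)] g(1) dvd_trans by blast
      then have "degree g \<le> degree d" using min n by simp
      then have "degree e = 0" using e \<open>g \<noteq> 0\<close> by (simp add: degree_mult_eq)
      then obtain k where k: "e = [:k:]" using degree_eq_zeroE by blast
      then have "k \<noteq> 0" using e \<open>g \<noteq> 0\<close> by auto
      then have "d = g * [:inverse k:]" using e k by (simp add: smult_smult[symmetric] del: smult_smult) simp
      then have "g dvd h" using dvd[OF gI(2)] by (metis dvd_mult_left)
      then show False using h by simp
    qed
    then obtain k where k: "d = [:k:]" using degree_eq_zeroE by blast
    then have "k \<noteq> 0" using d by auto
    have "[:inverse k:] * (a * g + b * h) = 1" unfolding ab[symmetric] k using \<open>k \<noteq> 0\<close> by simp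
    then have "h * ([:inverse k:] * b) - 1 = g * (- ([:inverse k:] * a))" by (simp add: algebra_simps)
    then show ?thesis by (metis dvd_triv_left)
  qed
  then show ?thesis using g by blast
qed

text \<open>For fixed \<open>g\<close>, these operators form a copy of K[X]/(g) in a ring type
  independent of \<open>g\<close>. The unit of the copy is \<open>mod_op g 1\<close>, which in
  general is not the identity.\<close>

definition mod_op :: "'k::field poly \<Rightarrow> 'k poly \<Rightarrow> 'k poly endo" where
  "mod_op g h = Endo (\<lambda>p. (h * p) mod g)"

lemma app_mod_op: "app (mod_op g h) p = (h * p) mod g"
  unfolding mod_op_def by (subst app_Endo) (simp_all add: distrib_left poly_mod_add_left)

lemma mod_op_mult: "mod_op g h * mod_op g h' = mod_op g (h * h')"
  by (rule endo_eqI) (simp add: app_mod_op mod_mult_right_eq mult.assoc)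

lemma mod_op_add: "mod_op g h + mod_op g h' = mod_op g (h + h')"
  by (rule endo_eqI) (simp add: app_mod_op poly_mod_add_left distrib_right)

lemma mod_op_zero [simp]: "mod_op g 0 = 0"
  by (rule endo_eqI) (simp add: app_mod_op)

lemma mod_op_eq_iff: "mod_op g h = mod_op g h' \<longleftrightarrow> g dvd h - h'"
proof
  assume "mod_op g h = mod_op g h'"
  then have "app (mod_op g h) 1 = app (mod_op g h') 1" by simp
  then show "g dvd h - h'" by (simp add: app_mod_op mod_eq_dvd_iff)
next
  assume "g dvd h - h'"
  then have "g dvd h * p - h' * p" for p by (metis dvd_mult2 left_diff_distrib)
  then show "mod_op g h = mod_op g h'" by (intro endo_eqI) (simp add: app_mod_op mod_eq_dvd_iff)
qed

lemma mod_op_sum: "(\<Sum>i\<in>A. mod_op g (f i)) = mod_op g (sum f A)"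
  by (induction A rule: infinite_finite_induct) (auto simp: mod_op_add)

section \<open>Purely infinite ideals lie in the ideal generated by \<open>P_ppi\<close>\<close>

context lpa_family
begin

lemma V_evp: "awalk u c u \<Longrightarrow> V u * evp u c f = evp u c f"
  unfolding evp_def sum_distrib_left
proof (intro sum.cong refl)
  fix i assume c: "awalk u c u"
  have "V u * (sc (coeff f i) * path u (pow_path c i)) = sc (coeff f i) * (V u * path u (pow_path c i))"
    using sc_V[OF awalk_hd_in_verts[OF c]] by (metis mult.assoc)
  then show "V u * (sc (coeff f i) * path u (pow_path c i)) = sc (coeff f i) * path u (pow_path c i)"
    using V_path[OF awalk_pow_path[OF c]] by simp
qed

lemma evp_V: "awalk u c u \<Longrightarrow> evp u c f * V u = evp u c f"
  unfolding evp_def sum_distrib_right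
  by (intro sum.cong refl) (simp add: mult.assoc path_V[OF awalk_pow_path])

lemma evp_L: "awalk u c u \<Longrightarrow> evp u c f \<in> L"
  unfolding evp_def by (intro lspan_sum sc_path_L[OF awalk_pow_path])

lemma evp_1: "u \<in> verts G \<Longrightarrow> evp u c 1 = V u"
  by (simp add: evp_def sc_one)

end

lemma stable_on_add: "stable_on Y x \<Longrightarrow> stable_on Y y \<Longrightarrow> stable_on Y (x + y)"
  and stable_on_mult: "stable_on Y x \<Longrightarrow> stable_on Y y \<Longrightarrow> stable_on Y (x * y)"
  unfolding stable_on_def by simp_all

context boundary_rep
begin

lemma linear_L: "z \<in> L \<Longrightarrow> linear_endo z"
proof (induction rule: L_induct)
  case (mult x y)
  then show ?case by (simp add: linear_endo_def)
qed (auto simp: linear_endo_def app_ops fun_eq_iff algebra_simps split: option.split)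

definition arc_points :: "'e set \<Rightarrow> ('v \<times> 'e list) set" where
  "arc_points D = {x \<in> points. set (snd x) \<subseteq> D}"

text \<open>Only \<open>opG e\<close> evaluates a function at a longer path, obtained by prepending
  \<open>e\<close>. The set \<open>D\<close> collects the finitely many such arcs in an expression
  for \<open>z\<close>.\<close>

lemma stable_on_arc_points: "z \<in> L \<Longrightarrow> \<exists>D. finite D \<and> (\<forall>D'. D \<subseteq> D' \<longrightarrow> stable_on (arc_points D') z)"
proof (induction rule: L_induct)
  case zero
  show ?case by (intro exI[of _ "{}"]) (simp add: stable_on_def)
next
  case (add x y)
  then obtain D D' where "finite D" "\<forall>E. D \<subseteq> E \<longrightarrow> stable_on (arc_points E) x"
    "finite D'" "\<forall>E. D' \<subseteq> E \<longrightarrow> stable_on (arc_points E) y" by blast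
  then show ?case by (intro exI[of _ "D \<union> D'"]) (simp add: stable_on_add)
next
  case (sc_mult k x)
  then obtain D where "finite D" "\<forall>E. D \<subseteq> E \<longrightarrow> stable_on (arc_points E) x" by blast
  then show ?case by (intro exI[of _ D]) (simp add: stable_on_def app_ops)
next
  case (V v)
  show ?case by (intro exI[of _ "{}"]) (simp add: stable_on_def app_ops)
next
  case (Ed e)
  have "y \<in> arc_points D" if "x \<in> arc_points D" "strip e x = Some y" for x y D
    using that strip_point(2)[of x e y] by (cases x; cases "snd x") (auto simp: arc_points_def split: if_splits)
  then show ?case by (intro exI[of _ "{}"]) (auto simp: stable_on_def app_ops split: option.split)
next
  case (Gh e)
  have "prepend e x \<in> arc_points D" if "x \<in> arc_points D" "fst x = head G e" "e \<in> D" for x D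
    using that prepend_point(1)[of x e] Gh by (cases x) (auto simp: arc_points_def)
  then show ?case by (intro exI[of _ "{e}"]) (auto simp: stable_on_def app_ops)
next
  case (mult x y)
  then obtain D D' where "finite D" "\<forall>E. D \<subseteq> E \<longrightarrow> stable_on (arc_points E) x"
    "finite D'" "\<forall>E. D' \<subseteq> E \<longrightarrow> stable_on (arc_points E) y" by blast
  then show ?case by (intro exI[of _ "D \<union> D'"]) (simp add: stable_on_mult)
qed

lemma path_along_nxt:
  "awalk w d u \<Longrightarrow> u \<notin> H \<Longrightarrow> (\<And>e. e \<in> set d \<Longrightarrow> nxt (tail G e) = Some e) \<Longrightarrow>
    app (path w d) f (w, []) = prod_list (map wt d) * f (u, [])"
proof (induction d arbitrary: w)
  case Nil
  then show ?case by (auto simp: app_ops awalk_Nil_iff points_Nil)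
next
  case (Cons e d)
  then have w: "e \<in> arcs G" "w = tail G e" "awalk (head G e) d u" "nxt w = Some e" by (auto simp: awalk_Cons_iff)
  have "w \<notin> H" using hereditary_awalk[OF H _ Cons.prems(1)] Cons.prems(2) by blast
  then have "(w, []) \<in> points" using w by (simp add: points_Nil)
  then show ?case using Cons.IH[OF w(3)] Cons.prems w by (simp add: app_ops)
qed

end

text \<open>Sums of two products are enough to double an element, and characters with values in
  \<open>'k poly endo\<close> are enough because the fields that arise have the form
  K[X]/(g).\<close>

locale pi_ideal = lpa_presentation G K for G :: "('v, 'e) pre_digraph" and K :: "'k::field itself" +
  fixes J :: "('v, 'e, 'k) lpa_free endo set"
  assumes J: "lideal J"
    and products: "\<lbrakk>a \<in> J; x \<in> J; y \<in> J; x' \<in> J; y' \<in> J\<rbrakk> \<Longrightarrow> \<exists>s\<in>J. \<exists>t\<in>J. x * a * y + x' * a * y' = s * a * t"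
    and no_division: "\<And>(\<chi> :: _ \<Rightarrow> 'k poly endo) e.
      \<lbrakk>\<And>x y. x \<in> J \<Longrightarrow> y \<in> J \<Longrightarrow> \<chi> (x + y) = \<chi> x + \<chi> y; \<And>x y. x \<in> J \<Longrightarrow> y \<in> J \<Longrightarrow> \<chi> (x * y) = \<chi> x * \<chi> y;
       e \<in> \<chi> ` J; e \<noteq> 0; \<And>s. s \<in> \<chi> ` J \<Longrightarrow> e * s = s \<and> s * e = s;
       \<And>s. s \<in> \<chi> ` J \<Longrightarrow> s \<noteq> 0 \<Longrightarrow> \<exists>t\<in>\<chi> ` J. s * t = e \<and> t * s = e\<rbrakk> \<Longrightarrow> False"
begin

lemma J_L: "x \<in> J \<Longrightarrow> x \<in> L"
  using lideal_L[OF J] .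

text \<open>Since \<open>i\<close> and the range of \<open>e i\<close> are orthogonal and equivalent, \<open>x \<oplus> x \<lesssim> x\<close> inside \<open>i L i\<close>.\<close>

lemma doubling:
  assumes x: "x \<in> J" "i * x = x" "x * i = x" and i: "i \<in> L"
    and e: "e \<in> arcs G" "i * Ex e = 0" "Gx e * i = 0" "Vx (head G e) * i = i" "i * Vx (head G e) = i"
  obtains A B A' B' where "A \<in> L" "B \<in> L" "A' \<in> L" "B' \<in> L"
    "(i * A * i) * x * (i * B * i) = x * x * x" "(i * A' * i) * x * (i * B' * i) = x * x * x"
    "(i * A * i) * x * (i * B' * i) = 0"
proof -
  have ex: "Ex e * x \<in> J" "x * Gx e \<in> J"
    using lideal_left[OF J x(1)] lideal_right[OF J x(1)] Ed_L Gh_L e(1) by auto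
  \<comment> \<open>The sum consists of two orthogonal copies of \<open>x * x * x\<close>, one in
    the corner of \<open>i\<close> and one carried off by \<open>e\<close>. Compressing the single
    product by \<open>i\<close>, or first moving the second copy back by \<open>Gh e\<close> and
    \<open>Ed e\<close>, separates the copies again.\<close>
  obtain y z where yz: "y \<in> J" "z \<in> J" "x * x * x + (Ex e * x) * x * (x * Gx e) = y * x * z"
    using products[OF x(1) x(1) x(1) ex] by blast
  have a: "\<And>a b c t. a * b = (c :: ('v, 'e, 'k) lpa_free endo) \<Longrightarrow> a * (b * t) = c * t" by (metis mult.assoc)
  have xe: "x * Ex e = 0" "Gx e * x = 0"
    using e(2,3) x(2,3) mult.assoc[of x i "Ex e"] mult.assoc[of "Gx e" i x] by simp_all
  have hx: "Vx (head G e) * x = x" "x * Vx (head G e) = x" 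
    using e(4,5) x(2,3) mult.assoc[of "Vx (head G e)" i x] mult.assoc[of x i "Vx (head G e)"] by simp_all
  have gg: "Gx e * Ex e = Vx (head G e)" using Gh_Ed[OF e(1) e(1)] by simp
  have b: "y * (x * z) = x * (x * x) + Ex e * (x * (x * (x * Gx e)))" using yz(3) by (simp add: mult.assoc)
  note s = x(2,3) x(2,3)[THEN a] e(2-5) e(2-5)[THEN a] xe xe[THEN a] hx hx[THEN a] gg gg[THEN a]
  have b': "y * (x * (z * t)) = (x * (x * x) + Ex e * (x * (x * (x * Gx e)))) * t" for t
    using b by (metis mult.assoc)
  show ?thesis
  proof (rule that[of y z "Gx e * y" "z * Ex e"])
    show "y \<in> L" "z \<in> L" "Gx e * y \<in> L" "z * Ex e \<in> L"
      using yz J_L Gh_L Ed_L e(1) L_mult by auto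
  qed (simp_all add: mult.assoc s b b' distrib_left distrib_right)
qed

text \<open>The set \<open>Y\<close> may depend on \<open>Z\<close>: infinitely many boundary paths
  can start at a vertex, while the four elements from \<open>doubling\<close> involve only finitely
  many arcs.\<close>

lemma contradiction_by_representation:
  fixes \<iota> :: "'k \<Rightarrow> 'f::field" and wt :: "'e \<Rightarrow> 'f"
  assumes rep: "boundary_rep G H nxt \<iota> wt"
    and hom: "lpa_hom G Sc Vx Ex Gx (boundary_rep.opS \<iota>) (boundary_rep.opV G H nxt)
      (boundary_rep.opE G H nxt wt) (boundary_rep.opG G H nxt wt) \<rho>"
    and x: "x \<in> J" "i * x = x" "x * i = x" and i: "i \<in> L"
    and e: "e \<in> arcs G" "i * Ex e = 0" "Gx e * i = 0" "Vx (head G e) * i = i" "i * Vx (head G e) = i"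
    and s: "s \<noteq> 0"
    and Y: "\<And>Z. finite Z \<Longrightarrow> Z \<subseteq> L \<Longrightarrow> \<exists>Y. finite Y \<and> Y \<noteq> {} \<and> (\<forall>z\<in>Z. stable_on Y (\<rho> (i * z * i))) \<and>
        (\<forall>f. \<forall>y\<in>Y. app (\<rho> x) f y = s * f y)"
  shows False
proof -
  interpret R: boundary_rep G H nxt \<iota> wt by (rule rep)
  interpret hom: lpa_hom G Sc Vx Ex Gx R.opS R.opV R.opE R.opG \<rho> by (rule hom)
  obtain A B A' B' where AB: "A \<in> L" "B \<in> L" "A' \<in> L" "B' \<in> L"
    "(i * A * i) * x * (i * B * i) = x * x * x" "(i * A' * i) * x * (i * B' * i) = x * x * x"
    "(i * A * i) * x * (i * B' * i) = 0" using doubling[OF x i e] by blast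
  from Y[of "{A, B, A', B'}"] AB obtain Y where Y: "finite Y" "Y \<noteq> {}"
    "\<And>z. z \<in> {A, B, A', B'} \<Longrightarrow> stable_on Y (\<rho> (i * z * i))" "\<And>f y. y \<in> Y \<Longrightarrow> app (\<rho> x) f y = s * f y" by auto
  have L: "i * z * i \<in> L" if "z \<in> L" for z using that i L_mult by blast
  have xL: "x \<in> L" using J_L x by blast
  have lin: "linear_endo (\<rho> (i * z * i))" if "z \<in> L" for z using R.linear_L[OF hom.\<rho>_L[OF L[OF that]]] .
  have m: "\<rho> (i * a * i) * \<rho> x * \<rho> (i * b * i) = \<rho> ((i * a * i) * x * (i * b * i))" if "a \<in> L" "b \<in> L" for a b
    using that L xL L_mult by (simp add: hom.\<rho>_mult)
  show False
  proof (rule no_doubling_finite_dim[where A = "\<rho> (i * A * i)" and B = "\<rho> (i * B * i)" and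
      A' = "\<rho> (i * A' * i)" and B' = "\<rho> (i * B' * i)" and x = "\<rho> x" and q = "\<rho> (x * x * x)" and c = "s * s * s"])
    show "app (\<rho> (x * x * x)) f y = s * s * s * f y" if "y \<in> Y" for f y
      using Y(4)[OF that] xL L_mult by (simp add: hom.\<rho>_mult)
  qed (use Y s AB lin m in \<open>auto\<close>)
qed

end

section \<open>Chosen arcs, vertices above a cycle, and closures\<close>

context wf_digraph
begin

definition outer_choice :: "'a set \<Rightarrow> 'a \<Rightarrow> 'b option" where
  "outer_choice H v = (if \<exists>e\<in>out_arcs G v. head G e \<notin> H
     then Some (SOME e. e \<in> out_arcs G v \<and> head G e \<notin> H) else None)"

lemma outer_choice: "outer_choice H v = Some e \<Longrightarrow> e \<in> arcs G \<and> tail G e = v \<and> head G e \<notin> H"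
proof -
  assume a: "outer_choice H v = Some e"
  then have ex: "\<exists>e. e \<in> out_arcs G v \<and> head G e \<notin> H" by (auto simp: outer_choice_def split: if_splits)
  have "e = (SOME e. e \<in> out_arcs G v \<and> head G e \<notin> H)" using a by (auto simp: outer_choice_def split: if_splits)
  then show ?thesis using someI_ex[OF ex] by simp
qed

lemma outer_choice_None: "outer_choice H v = None \<longleftrightarrow> \<not> (\<exists>e\<in>out_arcs G v. head G e \<notin> H)"
  by (simp add: outer_choice_def)

lemma outer_choice_regular:
  assumes "saturated G H" "regular_vertex G v" "v \<notin> H"
  shows "outer_choice H v \<noteq> None"
  using regular_arc_outside[OF assms] unfolding outer_choice_None by (metis in_out_arcs_conv)

text \<open>Modulo this set only vertices leading to \<open>u\<close> are left, so a cycle that is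
  the only closed simple path at \<open>u\<close> loses its exits.\<close>

definition not_above :: "'a \<Rightarrow> 'a set" where
  "not_above u = {x \<in> verts G. u \<notin> descendants G x}"

lemma hereditary_not_above: "hereditary G (not_above u)"
proof (rule hereditaryI)
  fix e assume e: "e \<in> arcs G" "tail G e \<in> not_above u"
  have "head G e \<in> descendants G (tail G e)" using arc_implies_awalk[OF e(1)] descendants_iff by blast
  then show "head G e \<in> not_above u" using e descendants_trans by (auto simp: not_above_def)
qed (auto simp: not_above_def)

text \<open>The cycle is used at \<open>v = u\<close>: its first arc has its head outside
  \<open>not_above u\<close>, so the premise of saturation fails there.\<close>

lemma saturated_not_above:
  assumes "c \<in> CSP u"
  shows "saturated G (not_above u)"
  unfolding saturated_def
proof (intro conjI allI impI)
  fix v assume v: "regular_vertex G v" "head G ` out_arcs G v \<subseteq> not_above u"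
  obtain e p where c: "c = e # p" using CSP_nonempty[OF assms] by (cases c) auto
  have e: "e \<in> out_arcs G u" "u \<in> descendants G (head G e)"
    using CSP_awalk[OF assms] c descendants_iff by (auto simp: awalk_Cons_iff)
  have "u \<notin> descendants G v"
  proof
    assume "u \<in> descendants G v"
    then consider "u = v" | f where "f \<in> out_arcs G v" "u \<in> descendants G (head G f)"
      using descendants_unfold by blast
    moreover have "u \<notin> descendants G (head G f)" if "f \<in> out_arcs G v" for f
      using subsetD[OF v(2) imageI[OF that]] by (simp add: not_above_def)
    ultimately show False using e by cases blast+
  qed
  then show "v \<in> not_above u" using v(1) by (simp add: not_above_def regular_vertex_def)
qed (auto simp: not_above_def)

lemma set_pow_path: "set (pow_path c m) \<subseteq> set c"
  by (induction m) (auto simp: pow_path_Suc)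

text \<open>The chosen arc \<open>f\<close> leads back to \<open>u\<close>, so the beginning of
  \<open>c\<close> before \<open>e\<close> followed by \<open>f\<close> extends to a closed walk.
  That walk starts with \<open>c\<close>, the only closed simple path, and comparison gives
  \<open>f = e\<close>.\<close>

lemma outer_choice_cycle:
  assumes c: "CSP u = {c}" and e: "e \<in> set c"
  shows "outer_choice (not_above u) (tail G e) = Some e"
proof -
  have cu: "c \<in> CSP u" using c by simp
  obtain p q where pq: "c = p @ e # q" using e by (metis split_list)
  obtain x where x: "awalk u p x" "awalk x (e # q) u" using CSP_awalk[OF cu] pq awalk_append_ex by auto
  then have ex: "e \<in> arcs G" "x = tail G e" "awalk (head G e) q u" by (auto simp: awalk_Cons_iff)
  then have "head G e \<notin> not_above u" using descendants_iff by (auto simp: not_above_def)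
  then have "outer_choice (not_above u) (tail G e) \<noteq> None" using ex outer_choice_None by auto
  then obtain f where f: "outer_choice (not_above u) (tail G e) = Some f" by blast
  then have f': "f \<in> arcs G" "tail G f = tail G e" "head G f \<notin> not_above u" using outer_choice by blast+
  then obtain r where r: "awalk (head G f) r u" using descendants_iff by (auto simp: not_above_def)
  have w: "awalk u (p @ f # r) u" using x ex f' r by (auto simp: awalk_append_ex awalk_Cons_iff)
  have "p @ f # r \<noteq> []" by simp
  then obtain c' s where "c' \<in> CSP u" "p @ f # r = c' @ s" by (rule closed_walk_CSP_prefix[OF w])
  then have "p @ f # r = p @ e # q @ s" using c pq by simp
  then show ?thesis using f by simp
qed

abbreviation "hs_closure X \<equiv> hereditary_saturated_closure G X"

lemma hs_closure_least: "hereditary G H \<Longrightarrow> saturated G H \<Longrightarrow> X \<subseteq> H \<Longrightarrow> hs_closure X \<subseteq> H"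
  unfolding hereditary_saturated_closure_def by blast

lemma hs_closure_superset: "X \<subseteq> hs_closure X"
  unfolding hereditary_saturated_closure_def by blast

lemma hs_closure_sub: "X \<subseteq> verts G \<Longrightarrow> hs_closure X \<subseteq> verts G"
  by (rule hs_closure_least[OF hereditary_verts saturated_verts])

lemma hereditary_hs_closure: "X \<subseteq> verts G \<Longrightarrow> hereditary G (hs_closure X)"
  using hs_closure_sub[of X] unfolding hereditary_def hereditary_saturated_closure_def by blast

lemma saturated_hs_closure: "X \<subseteq> verts G \<Longrightarrow> saturated G (hs_closure X)"
  using hs_closure_sub[of X] unfolding saturated_def hereditary_saturated_closure_def by blast

lemma hs_closure_mono: "X \<subseteq> Y \<Longrightarrow> hs_closure X \<subseteq> hs_closure Y"
  unfolding hereditary_saturated_closure_def by blast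

text \<open>What finite subsets of \<open>X\<close> reach is already hereditary and saturated, as
  regular vertices emit finitely many arcs. Proper infiniteness asks for a finite set, while the
  natural candidate is infinite in general.\<close>

lemma hs_closure_finitary:
  assumes X: "X \<subseteq> verts G" and v: "v \<in> hs_closure X"
  shows "\<exists>W. finite W \<and> W \<subseteq> X \<and> v \<in> hs_closure W"
proof -
  define C where "C = {v. \<exists>W. finite W \<and> W \<subseteq> X \<and> v \<in> hs_closure W}"
  have Cv: "C \<subseteq> verts G" using hs_closure_sub X unfolding C_def by blast
  have "hereditary G C"
  proof (rule hereditaryI[OF Cv])
    fix e assume e: "e \<in> arcs G" "tail G e \<in> C"
    then obtain W where W: "finite W" "W \<subseteq> X" "tail G e \<in> hs_closure W" unfolding C_def by blast
    have "head G e \<in> hs_closure W" using hereditary_arc[OF hereditary_hs_closure e(1) W(3)] W X by blast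
    then show "head G e \<in> C" using W unfolding C_def by blast
  qed
  moreover have "saturated G C" unfolding saturated_def
  proof (intro conjI allI impI Cv)
    fix v assume v: "regular_vertex G v" "head G ` out_arcs G v \<subseteq> C"
    then have "\<forall>e\<in>out_arcs G v. \<exists>W. finite W \<and> W \<subseteq> X \<and> head G e \<in> hs_closure W"
      unfolding C_def by blast
    then obtain W where W: "\<And>e. e \<in> out_arcs G v \<Longrightarrow> finite (W e) \<and> W e \<subseteq> X \<and> head G e \<in> hs_closure (W e)"
      by metis
    let ?W = "\<Union>e\<in>out_arcs G v. W e"
    have "finite (out_arcs G v)" using v(1) by (simp add: regular_vertex_def)
    then have fin: "finite ?W" by (rule finite_UN_I) (use W in blast)
    have WX: "?W \<subseteq> X" using W by blast
    have "head G e \<in> hs_closure ?W" if "e \<in> out_arcs G v" for e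
      using W[OF that] hs_closure_mono[of "W e" ?W] that by blast
    then have "v \<in> hs_closure ?W"
      using saturated_hs_closure[of ?W] WX X v(1) unfolding saturated_def by blast
    then show "v \<in> C" using fin WX unfolding C_def by blast
  qed
  moreover have "X \<subseteq> C"
  proof
    fix x assume "x \<in> X"
    then show "x \<in> C" unfolding C_def using hs_closure_superset[of "{x}"] by blast
  qed
  ultimately have "hs_closure X \<subseteq> C" by (rule hs_closure_least)
  then show ?thesis using v unfolding C_def by blast
qed

end

text \<open>If at most a single loop enters \<open>u\<close>, all other vertices may be sent to 0.
  The loop becomes multiplication by X and its ghost multiplication by \<open>f\<close>, which is
  inverse to X modulo \<open>g\<close>.\<close>

lemma lpa_family_character:
  fixes g f :: "'k::field poly" and G :: "('v, 'e) pre_digraph"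
  assumes G: "wf_digraph G" and u: "u \<in> verts G"
    and loops: "\<And>e. e \<in> arcs G \<Longrightarrow> head G e = u \<Longrightarrow> tail G e = u"
      "\<And>e e'. e \<in> arcs G \<Longrightarrow> e' \<in> arcs G \<Longrightarrow> head G e = u \<Longrightarrow> head G e' = u \<Longrightarrow> e = e'"
      "regular_vertex G u \<Longrightarrow> \<exists>e\<in>arcs G. head G e = u"
    and g: "g dvd [:0, 1:] * f - 1"
  shows "lpa_family G (\<lambda>k. mod_op g [:k:]) (\<lambda>v. if v = u then mod_op g 1 else 0)
    (\<lambda>e. if head G e = u then mod_op g [:0, 1:] else 0) (\<lambda>e. if head G e = u then mod_op g f else 0)"
proof -
  interpret wf_digraph G by (rule G)
  have inv: "mod_op g ([:0, 1:] * f) = mod_op g 1" "mod_op g (f * [:0, 1:]) = mod_op g 1"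
    using g by (simp_all only: mod_op_eq_iff mult.commute)
  show ?thesis
  proof
    fix v assume v: "regular_vertex G v"
    show "(if v = u then mod_op g 1 else 0) = (\<Sum>e\<in>out_arcs G v. (if head G e = u then mod_op g [:0, 1:] else 0) *
      (if head G e = u then mod_op g f else 0))" (is "_ = sum ?t _")
    proof (cases "v = u")
      case True
      then obtain e where e: "e \<in> arcs G" "head G e = u" "tail G e = u" using loops(1,3) v by blast
      have "sum ?t (out_arcs G v) = (\<Sum>e'\<in>out_arcs G v. if e' = e then mod_op g 1 else 0)"
        using e loops(2) by (intro sum.cong) (auto simp: mod_op_mult inv simp del: mult_pCons_left mult_pCons_right)
      then show ?thesis using True e v by (simp add: regular_vertex_def)
    next
      case False
      then have "sum ?t (out_arcs G v) = 0" using loops(1) by (intro sum.neutral) auto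
      then show ?thesis using False by simp
    qed
  next
    fix e e' assume "e \<in> arcs G" "e' \<in> arcs G"
    then show "(if head G e = u then mod_op g f else 0) * (if head G e' = u then mod_op g [:0, 1:] else 0) =
      (if e = e' then if head G e = u then mod_op g 1 else 0 else 0)"
      using loops(2)[of e e'] by (auto simp: mod_op_mult inv simp del: mult_pCons_left mult_pCons_right)
  qed (auto simp: mod_op_mult mod_op_add mult.commute one_pCons[symmetric] dest: loops(1))
qed

section \<open>Excluding the obstructions\<close>

context pi_ideal
begin

text \<open>Modulo X f - 1, the value \<open>f\<close> of \<open>x\<close> has the inverse X, so the
  image of \<open>J\<close> contains all residues; an irreducible factor \<open>g\<close> makes them
  a field. The upper bound on the degree is for \<open>f = 1\<close>, where that field is K.\<close>

lemma no_field_character: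
  assumes u: "u \<in> verts G"
    and loops: "\<And>e. e \<in> arcs G \<Longrightarrow> head G e = u \<Longrightarrow> tail G e = u"
      "\<And>e e'. e \<in> arcs G \<Longrightarrow> e' \<in> arcs G \<Longrightarrow> head G e = u \<Longrightarrow> head G e' = u \<Longrightarrow> e = e'"
      "regular_vertex G u \<Longrightarrow> \<exists>e\<in>arcs G. head G e = u"
    and f: "f \<noteq> 0" and x: "x \<in> J"
    and val: "\<And>g \<rho>. degree g \<ge> 1 \<Longrightarrow> degree g \<le> Suc (degree f) \<Longrightarrow>
      lpa_hom G Sc Vx Ex Gx (\<lambda>k. mod_op g [:k:]) (\<lambda>v. if v = u then mod_op g 1 else 0)
        (\<lambda>e. if head G e = u then mod_op g [:0, 1:] else 0) (\<lambda>e. if head G e = u then mod_op g f else 0) \<rho> \<Longrightarrow>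
      \<rho> x = mod_op g f \<and> (\<forall>h. \<exists>w\<in>L. \<rho> w = mod_op g h)"
  shows False
proof -
  define q where "q = pCons (- 1) f"
  have q: "q = [:0, 1:] * f - 1" by (simp add: q_def one_pCons)
  have "degree q = Suc (degree f)" using f by (simp add: q_def)
  then obtain g where g: "degree g \<ge> 1" "g dvd q" "\<And>h. \<not> g dvd h \<Longrightarrow> \<exists>h'. g dvd h * h' - 1"
    using irreducible_divisor_exists[of q] by auto
  have deg: "degree g \<le> Suc (degree f)"
    using dvd_imp_degree_le[OF g(2)] \<open>degree q = Suc (degree f)\<close> by (metis degree_0 nat.simps(3))
  from universal_property[OF lpa_family_character[OF wf_digraph_axioms u loops g(2)[unfolded q]]]
  obtain \<rho> where hom: "lpa_hom G Sc Vx Ex Gx (\<lambda>k. mod_op g [:k:]) (\<lambda>v. if v = u then mod_op g 1 else 0)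
        (\<lambda>e. if head G e = u then mod_op g [:0, 1:] else 0) (\<lambda>e. if head G e = u then mod_op g f else 0) \<rho>" by blast
  interpret hom: lpa_hom G Sc Vx Ex Gx "\<lambda>k. mod_op g [:k:]" "\<lambda>v. if v = u then mod_op g 1 else 0"
    "\<lambda>e. if head G e = u then mod_op g [:0, 1:] else 0" "\<lambda>e. if head G e = u then mod_op g f else 0" \<rho> by (rule hom)
  have val': "\<rho> x = mod_op g f" "\<And>h. \<exists>w\<in>L. \<rho> w = mod_op g h" using val[OF g(1) deg hom] by auto
  have img: "\<exists>h. \<rho> z = mod_op g h" if "z \<in> L" for z using that
  proof (induction rule: L_induct)
    case zero then show ?case by (metis hom.\<rho>_zero mod_op_zero)
  next
    case (add x y) then show ?case by (metis hom.\<rho>_add mod_op_add)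
  next
    case (sc_mult k x) then show ?case by (metis hom.\<rho>_sc mod_op_mult)
  next
    case (V v) then show ?case by (metis hom.\<rho>_V mod_op_zero)
  next
    case (Ed e) then show ?case by (metis hom.\<rho>_Ed mod_op_zero)
  next
    case (Gh e) then show ?case by (metis hom.\<rho>_Gh mod_op_zero)
  next
    case (mult x y) then show ?case by (metis hom.\<rho>_mult mod_op_mult)
  qed
  have all: "mod_op g h \<in> \<rho> ` J" for h
  proof -
    obtain w where w: "w \<in> L" "\<rho> w = mod_op g ([:0, 1:] * h)" using val' by blast
    have "\<rho> (x * w) = mod_op g (f * ([:0, 1:] * h))" using w x J_L val' by (simp only: hom.\<rho>_mult mod_op_mult)
    also have "\<dots> = mod_op g h"
    proof -
      have "f * ([:0, 1:] * h) - h = q * h" by (simp only: q) (simp add: algebra_simps)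
      then show ?thesis using g(2) by (simp only: mod_op_eq_iff) simp
    qed
    finally show ?thesis using lideal_right[OF J x w(1)] by (metis imageI)
  qed
  have form: "\<exists>h. s = mod_op g h" if "s \<in> \<rho> ` J" for s using that img J_L by blast
  show False
  proof (rule no_division[of \<rho> "mod_op g 1"])
    show "\<rho> (x + y) = \<rho> x + \<rho> y" "\<rho> (x * y) = \<rho> x * \<rho> y" if "x \<in> J" "y \<in> J" for x y
      using that J_L hom.\<rho>_add hom.\<rho>_mult by auto
    show "mod_op g 1 \<in> \<rho> ` J" by (rule all)
    have "\<not> g dvd 1" using g(1) dvd_imp_degree_le[of g 1] by auto
    then show "mod_op g 1 \<noteq> 0" using mod_op_eq_iff[of g 1 0] by simp
    show "mod_op g 1 * s = s \<and> s * mod_op g 1 = s" if "s \<in> \<rho> ` J" for s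
      using form[OF that] by (auto simp: mod_op_mult)
    show "\<exists>t\<in>\<rho> ` J. s * t = mod_op g 1 \<and> t * s = mod_op g 1" if s: "s \<in> \<rho> ` J" "s \<noteq> 0" for s
    proof -
      obtain h where h: "s = mod_op g h" using form s(1) by blast
      then have "\<not> g dvd h" using s(2) mod_op_eq_iff[of g h 0] by simp
      then obtain h' where "g dvd h * h' - 1" using g(3) by blast
      then have "mod_op g (h * h') = mod_op g 1" by (simp add: mod_op_eq_iff)
      then show ?thesis using h all[of h'] by (intro bexI[of _ "mod_op g h'"]) (simp_all add: mod_op_mult mult.commute)
    qed
  qed
qed

lemma boundary_hom:
  fixes \<iota> :: "'k \<Rightarrow> 'f::field"
  assumes "boundary_rep G H nxt \<iota> wt"
  obtains \<rho> where "lpa_hom G Sc Vx Ex Gx (boundary_rep.opS \<iota>) (boundary_rep.opV G H nxt)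
      (boundary_rep.opE G H nxt wt) (boundary_rep.opG G H nxt wt) \<rho>"
  using universal_property[OF boundary_rep.lpa_family_boundary[OF assms]] by blast

lemma gap_notin:
  assumes H: "hereditary G H" "saturated G H" and v: "v \<in> verts G" "v \<notin> H" "\<not> regular_vertex G v"
    and fin: "finite (outer_arcs H v)"
  shows "gap H v \<notin> J"
proof
  assume x: "gap H v \<in> J"
  let ?x = "gap H v"
  show False
  proof (cases "\<exists>e\<in>arcs G. head G e = v")
    case True
    then obtain e where e: "e \<in> arcs G" "head G e = v" by blast
    have ie: "?x * Ex e = 0" "Gx e * ?x = 0"
    proof -
      \<comment> \<open>A loop at \<open>v\<close> is an outer arc because \<open>v\<close> lies
        outside \<open>H\<close>, so the gap kills it; an arc from another vertex is killed by
        \<open>Vx v\<close>.\<close>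
      have "?x * Ex e = 0 \<and> Gx e * ?x = 0"
      proof (cases "tail G e = v")
        case True
        then show ?thesis using e v gap_Ed[OF fin, of e] Gh_gap[OF fin, of e] by (auto simp: outer_arcs_def)
      next
        case False
        have "?x * Ex e = ?x * (Vx v * Ex e)" "Gx e * ?x = (Gx e * Vx v) * ?x"
          using gap_V[OF v(1), of H] V_gap[OF v(1), of H] mult.assoc[of ?x "Vx v" "Ex e"] mult.assoc[of "Gx e" "Vx v" ?x]
          by simp_all
        then show ?thesis using e v False by (simp add: V_Ed_if Gh_V_if)
      qed
      then show "?x * Ex e = 0" "Gx e * ?x = 0" by auto
    qed
    \<comment> \<open>With no arc chosen at \<open>v\<close>, the point \<open>(v, [])\<close> is
      the boundary path that ends in \<open>v\<close>. The gap then acts as the projection onto this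
      one point.\<close>
    let ?nxt = "(outer_choice H)(v := None)"
    have rep: "boundary_rep G H ?nxt (\<lambda>k::'k. k) (\<lambda>_. 1)"
      by unfold_locales (use H v outer_choice outer_choice_regular in \<open>auto split: if_splits\<close>)
    interpret R: boundary_rep G H ?nxt "\<lambda>k::'k. k" "\<lambda>_. 1" by (rule rep)
    obtain \<rho> where hom: "lpa_hom G Sc Vx Ex Gx R.opS R.opV R.opE R.opG \<rho>" using boundary_hom[OF rep] by blast
    interpret hom: lpa_hom G Sc Vx Ex Gx R.opS R.opV R.opE R.opG \<rho> by (rule hom)
    have pt: "(v, []) \<in> R.points" using v by (simp add: R.points_Nil)
    have app_gap: "app (R.gap H v) f y = (if y = (v, []) then f y else 0)" for f y
    proof -
      have a: "app (R.gap H v) f y = app (R.opV v) f y - (\<Sum>e\<in>outer_arcs H v. app (R.opE e) (app (R.opG e) f) y)"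
        by (simp add: R.gap_def R.outer_arcs_def outer_arcs_def app_sum_left sum_fun_apply)
      show ?thesis
      proof (cases "y \<in> R.points \<and> fst y = v \<and> snd y \<noteq> []")
        case True
        then obtain e p where y: "y = (v, e # p)" by (cases y; cases "snd y") auto
        then obtain w where w: "awalk v (e # p) w" "w \<notin> H" using True by (auto simp: R.points_def)
        then have e: "e \<in> arcs G" "tail G e = v" "awalk (head G e) p w" by (auto simp: awalk_Cons_iff)
        then have "head G e \<notin> H" using hereditary_awalk[OF H(1) _ e(3)] w(2) by blast
        then have eo: "e \<in> outer_arcs H v" using e by (simp add: outer_arcs_def)
        have st: "R.strip e y = Some (head G e, p)" by (simp add: y)
        have yp: "y \<in> R.points" using True by simp
        note sp = R.strip_point(2,5)[OF yp st]
        have t: "app (R.opE e') (app (R.opG e') f) y = (if e' = e then f y else 0)" for e'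
        proof (cases "e' = e")
          case True
          then show ?thesis using yp st sp by (simp add: R.app_ops)
        next
          case False
          then have "R.strip e' y = None" using y by auto
          then show ?thesis using False by (simp add: R.app_ops)
        qed
        have "(\<Sum>e'\<in>outer_arcs H v. app (R.opE e') (app (R.opG e') f) y) = (\<Sum>e'\<in>outer_arcs H v. if e' = e then f y else 0)"
          by (rule sum.cong[OF refl t])
        also have "\<dots> = f y" using fin eo by simp
        finally show ?thesis unfolding a using True y by (simp add: R.app_ops(2))
      next
        case False
        have "app (R.opE e) (app (R.opG e) f) y = 0" if "e \<in> outer_arcs H v" for e
        proof -
          have "y \<in> R.points \<Longrightarrow> R.strip e y = None"
          proof (rule ccontr)
            assume yp: "y \<in> R.points" "R.strip e y \<noteq> None"
            then obtain z where z: "R.strip e y = Some z" by blast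
            have "fst y = v" using R.strip_point(4)[OF yp(1) z] that by (simp add: outer_arcs_def)
            then have "y = (v, [])" using False yp by (cases y) auto
            then show False using z by simp
          qed
          then show ?thesis by (simp add: R.app_ops)
        qed
        then have "(\<Sum>e\<in>outer_arcs H v. app (R.opE e) (app (R.opG e) f) y) = 0" by (intro sum.neutral ballI)
        then show ?thesis unfolding a using False pt by (cases y) (auto simp: R.app_ops)
      qed
    qed
    show False
    proof (rule contradiction_by_representation[OF rep hom x, where i = ?x and e = e and s = 1])
      show "?x * ?x = ?x" "?x * ?x = ?x" using gap_idem[OF fin v(1)] by auto
      show "?x \<in> L" using gap_L[OF v(1)] .
      show "Vx (head G e) * ?x = ?x" "?x * Vx (head G e) = ?x" using V_gap[OF v(1)] gap_V[OF v(1)] e by auto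
      fix Z assume Z: "finite Z" "Z \<subseteq> L"
      have "stable_on {(v, [])} (\<rho> (?x * z * ?x))" if "z \<in> L" for z
      proof -
        have r: "\<rho> (?x * z * ?x) = R.gap H v * \<rho> z * R.gap H v"
          using that gap_L[OF v(1)] L_mult by (simp add: hom.\<rho>_mult hom.\<rho>_gap[OF v(1)])
        have "app (R.gap H v) f = 0" if "f (v, []) = 0" for f using that by (auto simp: fun_eq_iff app_gap)
        then show ?thesis unfolding r stable_on_def by simp
      qed
      then show "\<exists>Y. finite Y \<and> Y \<noteq> {} \<and> (\<forall>z\<in>Z. stable_on Y (\<rho> (?x * z * ?x))) \<and>
        (\<forall>f. \<forall>y\<in>Y. app (\<rho> ?x) f y = 1 * f y)"
        using Z by (intro exI[of _ "{(v, [])}"]) (auto simp: hom.\<rho>_gap[OF v(1)] app_gap)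
    qed (use e ie in auto)
  next
    case False
    \<comment> \<open>No arc enters \<open>v\<close>. For the polynomial 1 the bounds force
      \<open>g\<close> to have degree 1, so the scalar multiples of \<open>Vx v\<close> already
      represent all residues.\<close>
    show False
    proof (rule no_field_character[OF v(1), of 1 ?x])
      fix g :: "'k poly" and \<rho>
      assume g: "degree g \<ge> 1" "degree g \<le> Suc (degree (1 :: 'k poly))"
      assume "lpa_hom G Sc Vx Ex Gx (\<lambda>k. mod_op g [:k:]) (\<lambda>w. if w = v then mod_op g 1 else 0)
        (\<lambda>e. if head G e = v then mod_op g [:0, 1:] else 0) (\<lambda>e. if head G e = v then mod_op g 1 else 0) \<rho>"
      then interpret hom: lpa_hom G Sc Vx Ex Gx "\<lambda>k. mod_op g [:k:]" "\<lambda>w. if w = v then mod_op g 1 else 0"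
        "\<lambda>e. if head G e = v then mod_op g [:0, 1:] else 0" "\<lambda>e. if head G e = v then mod_op g 1 else 0" \<rho> .
      have "\<rho> ?x = mod_op g 1"
        unfolding hom.\<rho>_gap[OF v(1)] hom.tgt.gap_def using False by (auto simp: hom.tgt.outer_arcs_def intro!: sum.neutral)
      moreover have "\<exists>w\<in>L. \<rho> w = mod_op g h" for h
      proof -
        have "g \<noteq> 0" using g by auto
        then have "degree (h mod g) = 0" using degree_mod_less[of g h] g by auto
        then obtain k where k: "h mod g = [:k:]" using degree_eq_zeroE by blast
        have "mod_op g h = mod_op g [:k:]" unfolding mod_op_eq_iff k[symmetric] by (simp add: minus_mod_eq_mult_div)
        also have "\<dots> = \<rho> (Sc k * Vx v)" using v V_L by (simp add: hom.\<rho>_sc hom.\<rho>_V mod_op_mult)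
        finally show ?thesis using sc_V_L[OF v(1)] by metis
      qed
      ultimately show "\<rho> ?x = mod_op g 1 \<and> (\<forall>h. \<exists>w\<in>L. \<rho> w = mod_op g h)" by blast
    qed (use False v x in auto)
  qed
qed

lemma evp_notin:
  assumes c: "CSP u = {c}" and f: "f \<noteq> 0"
  shows "evp u c f \<notin> J"
proof
  assume x: "evp u c f \<in> J"
  let ?x = "evp u c f"
  have cu: "c \<in> CSP u" using c by simp
  note wc = CSP_awalk[OF cu]
  have u: "u \<in> verts G" using awalk_hd_in_verts[OF wc] .
  obtain e1 c' where c1: "c = e1 # c'" using CSP_nonempty[OF cu] by (cases c) auto
  show False
  proof (cases "\<exists>e\<in>arcs G. head G e = u \<and> c \<noteq> [e]")
    case True
    then obtain e where e: "e \<in> arcs G" "head G e = u" "c \<noteq> [e]" by blast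
    have te: "tail G e \<noteq> u"
    proof
      assume "tail G e = u"
      then have "[e] \<in> CSP u" using e u by (auto simp: closed_simple_paths_def awalk_Cons_iff awalk_Nil_iff)
      then show False using c e(3) by simp
    qed
    \<comment> \<open>The weight X on one arc of the cycle makes \<open>c\<close> act on
      \<open>(u, [])\<close> as X and \<open>evp u c f\<close> as \<open>f\<close>, a nonzero
      element of the fraction field.\<close>
    let ?H = "not_above u" and ?wt = "\<lambda>e. if e = e1 then to_fract [:0, 1::'k:] else 1"
    have rep: "boundary_rep G ?H (outer_choice ?H) (\<lambda>k. to_fract [:k:]) ?wt"
    proof unfold_locales
      show "to_fract [:a + b:] = to_fract [:a:] + to_fract [:b:]" for a b :: 'k by (simp flip: to_fract_add)
      show "to_fract [:a * b:] = to_fract [:a:] * to_fract [:b:]" for a b :: 'k by (simp flip: to_fract_mult)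
      show "to_fract [:1::'k:] = 1" by (simp flip: one_pCons)
    qed (use hereditary_not_above outer_choice outer_choice_regular[OF saturated_not_above[OF cu]] in \<open>auto\<close>)
    interpret R: boundary_rep G ?H "outer_choice ?H" "\<lambda>k. to_fract [:k:]" ?wt by (rule rep)
    obtain \<rho> where hom: "lpa_hom G Sc Vx Ex Gx R.opS R.opV R.opE R.opG \<rho>" using boundary_hom[OF rep] by blast
    interpret hom: lpa_hom G Sc Vx Ex Gx R.opS R.opV R.opE R.opG \<rho> by (rule hom)
    have uH: "u \<notin> ?H" using self_descendant[OF u] by (simp add: not_above_def)
    have pt: "(u, []) \<in> R.points" using u uH by (simp add: R.points_Nil)
    \<comment> \<open>Every walk from \<open>u\<close> that ends outside \<open>not_above u\<close>
      can be completed to a power of \<open>c\<close>. All arcs of \<open>c\<close> are chosen, so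
      no nonempty path from \<open>u\<close> is reduced.\<close>
    have only: "p = []" if up: "(u, p) \<in> R.points" for p
    proof (rule ccontr)
      assume p: "p \<noteq> []"
      obtain w where w: "awalk u p w" "w \<notin> ?H" "outer_choice ?H (tail G (last p)) \<noteq> Some (last p)"
        using up p by (auto simp: R.points_def)
      then obtain r where r: "awalk w r u" using awalk_last_in_verts[OF w(1)] descendants_iff by (auto simp: not_above_def)
      obtain m where "p @ r = pow_path c m" using closed_walk_unique_CSP[OF c awalk_appendI[OF w(1) r]] by blast
      then have "last p \<in> set (pow_path c m)" using p by (metis last_in_set Un_iff set_append)
      then have "last p \<in> set c" using set_pow_path by (metis subsetD)
      then show False using outer_choice_cycle[OF c] w(3) by blast
    qed
    have wts: "prod_list (map ?wt c) = to_fract [:0, 1:]"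
    proof -
      have "e1 \<notin> set c'"
      proof
        assume "e1 \<in> set c'"
        then have "tail G e1 \<noteq> u" using cu c1 by (simp add: closed_simple_paths_def)
        then show False using wc c1 by (simp add: awalk_Cons_iff)
      qed
      then have "map ?wt c' = map (\<lambda>_. 1) c'" by (intro map_cong) auto
      then have "prod_list (map ?wt c') = 1" by (simp add: map_replicate_const prod_list_replicate)
      then show ?thesis by (simp add: c1)
    qed
    have pw: "app (R.path u (pow_path c i)) h (u, []) = to_fract [:0, 1:] ^ i * h (u, [])" for h i
    proof (induction i arbitrary: h)
      case 0
      then show ?case using pt by (simp add: R.app_ops)
    next
      case (Suc i)
      have "app (R.path u (pow_path c (Suc i))) h (u, []) = app (R.path u c) (app (R.path u (pow_path c i)) h) (u, [])"
        by (simp add: R.path_pow_path[OF wc])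
      also have "\<dots> = to_fract [:0, 1:] * app (R.path u (pow_path c i)) h (u, [])"
        by (subst R.path_along_nxt[OF wc uH outer_choice_cycle[OF c]]) (simp_all add: wts)
      finally show ?case using Suc by simp
    qed
    have act: "app (\<rho> ?x) h (u, []) = to_fract f * h (u, [])" for h
    proof -
      have "app (\<rho> ?x) h (u, []) = (\<Sum>i\<le>degree f. to_fract [:coeff f i:] * (to_fract [:0, 1:] ^ i * h (u, [])))"
        by (simp add: hom.\<rho>_evp[OF wc] R.evp_def app_sum_left sum_fun_apply R.app_ops pw)
      also have "\<dots> = (\<Sum>i\<le>degree f. to_fract (monom (coeff f i) i)) * h (u, [])"
      proof -
        have pow: "to_fract [:0, 1::'k:] ^ i = to_fract ([:0, 1:] ^ i)" for i by (induction i) (simp_all del: mult_pCons_left)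
        have "[:a:] * [:0, 1::'k:] ^ i = monom a i" for a i by (simp add: monom_altdef)
        then show ?thesis by (simp add: sum_distrib_right pow mult.assoc[symmetric] del: mult_pCons_left flip: to_fract_mult)
      qed
      also have "(\<Sum>i\<le>degree f. to_fract (monom (coeff f i) i)) = to_fract f"
        by (simp add: poly_as_sum_of_monoms flip: to_fract_sum)
      finally show ?thesis .
    qed
    show False
    proof (rule contradiction_by_representation[OF rep hom x, where i = "Vx u" and e = e and s = "to_fract f"])
      show "Vx u * ?x = ?x" "?x * Vx u = ?x" using V_evp[OF wc] evp_V[OF wc] by auto
      show "Vx u \<in> L" using V_L u by blast
      show "Vx u * Ex e = 0" "Gx e * Vx u = 0" using e u te by (auto simp: V_Ed_if Gh_V_if)
      show "Vx (head G e) * Vx u = Vx u" "Vx u * Vx (head G e) = Vx u" using e u by (auto simp: V_V)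
      fix Z assume Z: "finite Z" "Z \<subseteq> L"
      have "stable_on {(u, [])} (\<rho> (Vx u * z * Vx u))" if "z \<in> L" for z
      proof -
        have r: "\<rho> (Vx u * z * Vx u) = R.opV u * \<rho> z * R.opV u"
          using that V_L u L_mult by (simp add: hom.\<rho>_mult hom.\<rho>_V)
        have "app (R.opV u) h = 0" if "h (u, []) = 0" for h
          using that only by (auto simp: fun_eq_iff R.app_ops)
        then show ?thesis unfolding r stable_on_def by simp
      qed
      then show "\<exists>Y. finite Y \<and> Y \<noteq> {} \<and> (\<forall>z\<in>Z. stable_on Y (\<rho> (Vx u * z * Vx u))) \<and>
        (\<forall>h. \<forall>y\<in>Y. app (\<rho> ?x) h y = to_fract f * h y)"
        using Z act by (intro exI[of _ "{(u, [])}"]) auto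
    qed (use e f in auto)
  next
    case False
    \<comment> \<open>The last arc of \<open>c\<close> ends at \<open>u\<close>; by the case
      assumption \<open>c\<close> is therefore a loop and the only arc into
      \<open>u\<close>.\<close>
    have "awalk u (butlast c @ [last c]) u" using wc CSP_nonempty[OF cu] by simp
    then have l: "last c \<in> arcs G" "head G (last c) = u" by (auto simp: awalk_append_ex awalk_Cons_iff awalk_Nil_iff)
    then have cl: "c = [last c]" using False by blast
    define e0 where "e0 = last c"
    have e0: "c = [e0]" "e0 \<in> arcs G" "head G e0 = u" using l cl by (auto simp: e0_def)
    have t0: "tail G e0 = u" using wc e0 by (simp add: awalk_Cons_iff)
    have uniq: "e = e0" if "e \<in> arcs G" "head G e = u" for e using False that e0 by auto
    show False
    proof (rule no_field_character[OF u, of f ?x])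
      show "tail G e = u" if "e \<in> arcs G" "head G e = u" for e using uniq[OF that] t0 by simp
      show "e = e'" if "e \<in> arcs G" "e' \<in> arcs G" "head G e = u" "head G e' = u" for e e' using uniq that by metis
      show "\<exists>e\<in>arcs G. head G e = u" using e0 by blast
      fix g :: "'k poly" and \<rho>
      assume "lpa_hom G Sc Vx Ex Gx (\<lambda>k. mod_op g [:k:]) (\<lambda>w. if w = u then mod_op g 1 else 0)
        (\<lambda>e. if head G e = u then mod_op g [:0, 1:] else 0) (\<lambda>e. if head G e = u then mod_op g f else 0) \<rho>"
      then interpret hom: lpa_hom G Sc Vx Ex Gx "\<lambda>k. mod_op g [:k:]" "\<lambda>w. if w = u then mod_op g 1 else 0"
        "\<lambda>e. if head G e = u then mod_op g [:0, 1:] else 0" "\<lambda>e. if head G e = u then mod_op g f else 0" \<rho> .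
      have pw: "hom.tgt.path u (pow_path c i) = mod_op g ([:0, 1:] ^ i)" for i
        by (induction i) (simp_all add: pow_path_Suc e0 mod_op_mult del: mult_pCons_left)
      have ev: "\<rho> (evp u c h) = mod_op g h" for h
      proof -
        have "\<rho> (evp u c h) = (\<Sum>i\<le>degree h. mod_op g ([:coeff h i:] * [:0, 1:] ^ i))"
          by (simp only: hom.\<rho>_evp[OF wc] hom.tgt.evp_def pw mod_op_mult)
        also have "\<dots> = mod_op g (\<Sum>i\<le>degree h. monom (coeff h i) i)"
          by (simp add: mod_op_sum monom_altdef)
        finally show ?thesis by (simp add: poly_as_sum_of_monoms)
      qed
      then show "\<rho> ?x = mod_op g f \<and> (\<forall>h. \<exists>w\<in>L. \<rho> w = mod_op g h)" using evp_L[OF wc] by blast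
    qed (use f x in auto)
  qed
qed

text \<open>Without cycles, no arc is repeated in a point starting at \<open>u = head G e\<close>,
  so finitely many arcs admit only finitely many points. The vertex \<open>u\<close> acts on them as
  the identity, while the arc \<open>e\<close> doubles it.\<close>

lemma vertex_acyclic_notin:
  assumes H: "hereditary G H" "saturated G H" and e: "e \<in> arcs G" "head G e \<notin> H"
    and acyclic: "\<And>u. u \<in> descendants G (tail G e) \<Longrightarrow> u \<notin> H \<Longrightarrow> CSP u = {}"
  shows "Vx (head G e) \<notin> J"
proof
  assume x: "Vx (head G e) \<in> J"
  define u where "u = head G e"
  have u: "u \<in> verts G" "u \<notin> H" using e by (auto simp: u_def)
  have tH: "tail G e \<notin> H" using hereditary_arc[OF H(1) e(1)] e(2) by blast
  have du: "w \<in> descendants G (tail G e)" if "w \<in> descendants G u" for w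
    using that descendants_trans arc_implies_awalk[OF e(1)] descendants_iff unfolding u_def by blast
  have nocyc: "d = []" if "awalk w d w" "w \<notin> H" "w \<in> descendants G (tail G e)" for w d
    using closed_walk_CSP_prefix[OF that(1)] acyclic[OF that(3,2)] by blast
  have te: "tail G e \<noteq> u"
  proof
    assume "tail G e = u"
    then have "awalk u [e] u" using e by (simp add: u_def awalk_Cons_iff awalk_Nil_iff)
    then show False using nocyc[of u "[e]"] u du self_descendant by blast
  qed
  have rep: "boundary_rep G H (outer_choice H) (\<lambda>k::'k. k) (\<lambda>_. 1)"
    by unfold_locales (use H outer_choice outer_choice_regular in auto)
  interpret R: boundary_rep G H "outer_choice H" "\<lambda>k::'k. k" "\<lambda>_. 1" by (rule rep)
  obtain \<rho> where hom: "lpa_hom G Sc Vx Ex Gx R.opS R.opV R.opE R.opG \<rho>" using boundary_hom[OF rep] by blast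
  interpret hom: lpa_hom G Sc Vx Ex Gx R.opS R.opV R.opE R.opG \<rho> by (rule hom)
  show False
  proof (rule contradiction_by_representation[OF rep hom x[folded u_def], where i = "Vx u" and e = e and s = 1])
    show "Vx u * Vx u = Vx u" "Vx u * Vx u = Vx u" using u V_V by auto
    show "Vx u \<in> L" using u V_L by blast
    show "Vx u * Ex e = 0" "Gx e * Vx u = 0" using e u te by (auto simp: V_Ed_if Gh_V_if)
    show "Vx (head G e) * Vx u = Vx u" "Vx u * Vx (head G e) = Vx u" using u V_V by (auto simp: u_def)
    fix Z :: "('v, 'e, 'k) lpa_free endo set" assume Z: "finite Z" "Z \<subseteq> L"
    have "\<forall>z\<in>Z. \<exists>D. finite D \<and> (\<forall>D'. D \<subseteq> D' \<longrightarrow> stable_on (R.arc_points D') (\<rho> z))"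
      using Z hom.\<rho>_L R.stable_on_arc_points by blast
    then obtain D where D: "\<And>z. z \<in> Z \<Longrightarrow> finite (D z)"
      "\<And>z D'. z \<in> Z \<Longrightarrow> D z \<subseteq> D' \<Longrightarrow> stable_on (R.arc_points D') (\<rho> z)" by metis
    define D' where "D' = (\<Union>z\<in>Z. D z)"
    have D'fin: "finite D'" unfolding D'_def using Z(1) D(1) by (rule finite_UN_I)
    define Y where "Y = {y \<in> R.arc_points D'. fst y = u}"
    have "distinct p" if up: "(u, p) \<in> R.points" for p
    proof (rule ccontr)
      assume "\<not> distinct p"
      then obtain as f bs cs where p: "p = as @ [f] @ bs @ [f] @ cs" using not_distinct_decomp by blast
      obtain w where w: "awalk u p w" "w \<notin> H" using up by (auto simp: R.points_def)
      have "p = as @ (f # bs) @ (f # cs)" using p by simp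
      then obtain y z where yz: "awalk u as y" "awalk y (f # bs) z" "awalk z (f # cs) w"
        using w(1) by (auto simp only: awalk_append_ex)
      then have "y = tail G f" "z = tail G f" by (auto simp: awalk_Cons_iff)
      then have "awalk y (f # bs) y" using yz(2) by simp
      moreover have "y \<notin> H" using hereditary_awalk[OF H(1) _ yz(3)] w(2) \<open>y = tail G f\<close> \<open>z = tail G f\<close> by blast
      moreover have "y \<in> descendants G (tail G e)" using yz(1) du descendants_iff by blast
      ultimately show False using nocyc by blast
    qed
    then have sub: "Y \<subseteq> Pair u ` {p. set p \<subseteq> D' \<and> length p \<le> card D'}"
      using D'fin by (auto simp: Y_def R.arc_points_def image_iff) (metis card_mono distinct_card)
    have fin: "finite Y"
      by (rule finite_subset[OF sub]) (intro finite_imageI finite_lists_length_le[OF D'fin])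
    have ne: "(u, []) \<in> Y" using u by (simp add: Y_def R.arc_points_def R.points_Nil)
    have "stable_on Y (\<rho> (Vx u * z * Vx u))" if z: "z \<in> Z" for z
    proof -
      have zL: "z \<in> L" using Z z by blast
      have r: "\<rho> (Vx u * z * Vx u) = R.opV u * (\<rho> z * R.opV u)"
        using zL V_L u L_mult by (simp add: hom.\<rho>_mult hom.\<rho>_V mult.assoc)
      have st: "stable_on (R.arc_points D') (\<rho> z)" using D(2)[OF z] z by (auto simp: D'_def)
      show ?thesis unfolding r stable_on_def
      proof (intro allI impI ballI)
        fix h y assume h: "\<forall>y\<in>Y. h y = (0::'k)" and y: "y \<in> Y"
        have "\<forall>y\<in>R.arc_points D'. app (R.opV u) h y = 0" using h by (auto simp: R.app_ops Y_def)
        then have "\<forall>y\<in>R.arc_points D'. app (\<rho> z) (app (R.opV u) h) y = 0" using st unfolding stable_on_def by blast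
        then show "app (R.opV u * (\<rho> z * R.opV u)) h y = 0" using y by (simp add: R.app_ops Y_def)
      qed
    qed
    moreover have "app (\<rho> (Vx u)) h y = 1 * h y" if "y \<in> Y" for h y
      using that u by (simp add: hom.\<rho>_V R.app_ops Y_def R.arc_points_def)
    ultimately show "\<exists>Y. finite Y \<and> Y \<noteq> {} \<and> (\<forall>z\<in>Z. stable_on Y (\<rho> (Vx u * z * Vx u))) \<and>
        (\<forall>h. \<forall>y\<in>Y. app (\<rho> (Vx u)) h y = 1 * h y)"
      using fin ne by blast
  qed (use e in auto)
qed

lemma vertices_descend: "Vx v \<in> J \<Longrightarrow> awalk v p w \<Longrightarrow> Vx w \<in> J"
proof -
  assume v: "Vx v \<in> J" and w: "awalk v p w"
  have "ghost v p * Vx v * path v p \<in> J"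
    using v lideal_left[OF J _ ghost_L[OF w]] lideal_right[OF J _ path_L[OF w]] by blast
  then show ?thesis using ghost_path[OF w] ghost_V[OF w] by simp
qed

text \<open>If \<open>v\<close> escaped the closure, no descendant outside it would have a closed
  simple path, since \<open>evp_notin\<close> with the polynomial 1 speaks of vertices. Then either
  an arc from \<open>v\<close> stays outside the closure, which \<open>vertex_acyclic_notin\<close>
  excludes, or \<open>v\<close> is singular and its own gap.\<close>

lemma vertex_properly_infinite:
  assumes v: "v \<in> verts G" "Vx v \<in> J"
  shows "v \<in> properly_infinite_vertices G"
proof -
  define W where "W = {w \<in> descendants G v. infinite (CSP w) \<or> card (CSP w) \<ge> 2}"
  have Wv: "W \<subseteq> verts G" by (auto simp: W_def descendants_def)
  let ?H = "hs_closure W"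
  note hH = hereditary_hs_closure[OF Wv] and sH = saturated_hs_closure[OF Wv]
  have "v \<in> ?H"
  proof (rule ccontr)
    assume nv: "v \<notin> ?H"
    have dJ: "Vx u \<in> J" if "u \<in> descendants G v" for u
      using that vertices_descend[OF v(2)] descendants_iff by blast
    have acyclic: "CSP u = {}" if u: "u \<in> descendants G v" "u \<notin> ?H" for u
    proof (rule ccontr)
      assume "CSP u \<noteq> {}"
      moreover have "u \<notin> W" using u(2) hs_closure_superset[of W] by blast
      then have "finite (CSP u)" "card (CSP u) \<le> 1" using u(1) by (auto simp: W_def)
      ultimately have "card (CSP u) = 1" by (metis card_0_eq le_neq_implies_less less_one)
      then obtain c where "CSP u = {c}" by (auto simp: card_1_singleton_iff)
      moreover have "u \<in> verts G" using u(1) by (simp add: descendants_def)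
      ultimately show False using evp_notin[of u c 1] evp_1[of u c] dJ[OF u(1)] by simp
    qed
    show False
    proof (cases "\<exists>e\<in>out_arcs G v. head G e \<notin> ?H")
      case True
      then obtain e where e: "e \<in> arcs G" "tail G e = v" "head G e \<notin> ?H" by auto
      have "head G e \<in> descendants G v" using arc_implies_awalk[OF e(1)] e(2) descendants_iff by blast
      then show False using vertex_acyclic_notin[OF hH sH e(1,3)] acyclic e(2) dJ by blast
    next
      case False
      then have "\<not> regular_vertex G v" using sH nv unfolding saturated_def by blast
      moreover have o: "outer_arcs ?H v = {}" using False by (auto simp: outer_arcs_def)
      ultimately have "gap ?H v \<notin> J" using gap_notin[OF hH sH v(1) nv] by simp
      then show False using v(2) o by (simp add: gap_def)
    qed
  qed
  then obtain W' where "finite W'" "W' \<subseteq> W" "v \<in> hs_closure W'" using hs_closure_finitary[OF Wv] by blast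
  then show ?thesis unfolding properly_infinite_vertices_def using v(1) by (auto simp: W_def)
qed

lemma vertex_not_breaking:
  assumes v: "Vx v \<in> J"
  shows "v \<notin> breaking_vertices G"
proof
  assume "v \<in> breaking_vertices G"
  then obtain H where H: "hereditary G H" "saturated G H" "v \<in> breaking_vertices_of G H"
    unfolding breaking_vertices_def by blast
  then have h: "v \<in> verts G" "v \<notin> H" "\<not> regular_vertex G v" "finite (outer_arcs H v)"
    by (auto simp: breaking_vertices_of_def infinite_emitter_def regular_vertex_def outer_arcs_def)
  have "gap H v = Vx v * gap H v" using V_gap[OF h(1)] by simp
  then have "gap H v \<in> J" using lideal_right[OF J v gap_L[OF h(1), of H]] by simp
  then show False using gap_notin[OF H(1,2) h] by blast
qed

lemma vertex_P_ppi:
  assumes "v \<in> verts G" "Vx v \<in> J"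
  shows "v \<in> P_ppi G"
proof -
  have "u \<in> properly_infinite_vertices G" "u \<notin> breaking_vertices G" if "u \<in> descendants G v" for u
    using that vertices_descend[OF assms(2)] descendants_iff vertex_properly_infinite vertex_not_breaking
      awalk_last_in_verts by blast+
  then show ?thesis unfolding P_ppi_def using assms by blast
qed

theorem pi_ideal_subset: "J \<subseteq> lspan (P_ppi G)"
proof
  fix a assume a: "a \<in> J"
  define H where "H = {v \<in> verts G. Vx v \<in> J}"
  have hH: "hereditary G H"
    by (rule hereditaryI) (use vertices_descend arc_implies_awalk in \<open>auto simp: H_def\<close>)
  have sH: "saturated G H" unfolding saturated_def
  proof (intro conjI allI impI)
    fix v assume v: "regular_vertex G v" "head G ` out_arcs G v \<subseteq> H"
    have "Ex e * Vx (head G e) * Gx e \<in> J" if "e \<in> out_arcs G v" for e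
    proof -
      have "Vx (head G e) \<in> J" using subsetD[OF v(2) imageI[OF that]] by (simp add: H_def)
      then show ?thesis using that Ed_L Gh_L lideal_left[OF J] lideal_right[OF J] by simp
    qed
    then have "Vx v \<in> J" unfolding V_regular_conj[OF v(1)] by (rule lideal_sum[OF J])
    then show "v \<in> H" using v(1) by (simp add: H_def regular_vertex_def)
  qed (auto simp: H_def)
  have "z \<in> J" if "z \<in> lspan H" for z by (rule lspan_least[OF J _ that]) (simp add: H_def)
  then have HJ: "lspan H \<subseteq> J" by blast
  have "a \<in> lspan H"
  proof (rule ccontr)
    assume na: "a \<notin> lspan H"
    from reduction[OF hH sH hereditary_verts J_L[OF a] na] obtain z z' t where
      z: "z \<in> L" "z' \<in> L" "z * a * z' - t \<in> lspan H" and t: "terminal (verts G) H t"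
      unfolding reduces_def by blast
    have "z * a * z' \<in> J" using a z lideal_left[OF J] lideal_right[OF J] by blast
    then have tJ: "t \<in> J" using lideal_minus_iff[OF J, of "z * a * z'" t] z(3) HJ by blast
    from t consider v where "v \<in> verts G - H" "t = Vx v"
      | v where "v \<in> verts G - H" "\<not> regular_vertex G v" "finite (outer_arcs H v)" "t = gap H v"
      | u c f where "u \<in> verts G - H" "c \<in> CSP u" "f \<noteq> 0" "no_exit H u c" "t = evp u c f"
      unfolding terminal_def by blast
    then show False
    proof cases
      case 1
      then show False using tJ by (simp add: H_def)
    next
      case 2
      then show False using gap_notin[OF hH sH] tJ by blast
    next
      case 3
      \<comment> \<open>In the absence of exits, \<open>d\<close> runs along a power of
        \<open>c\<close> and is comparable with it; this gives the uniqueness that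
        \<open>evp_notin\<close> demands.\<close>
      have "d = c" if d: "d \<in> CSP u" for d
      proof -
        obtain m where m: "prefix d (pow_path c m)"
          using 3 CSP_awalk[OF d] unfolding no_exit_def by blast
        then have "m \<noteq> 0" using CSP_nonempty[OF d] by (cases m) auto
        then have "prefix c (pow_path c m)" by (cases m) (auto simp: pow_path_Suc)
        then show ?thesis using prefix_same_cases[OF m] CSP_prefix_eq 3(2) d by metis
      qed
      then have "CSP u = {c}" using 3(2) by blast
      then show False using evp_notin 3(3,5) tJ by blast
    qed
  qed
  moreover have "H \<subseteq> P_ppi G" using vertex_P_ppi by (auto simp: H_def)
  ultimately show "a \<in> lspan (P_ppi G)" using lspan_mono by blast
qed

end

section \<open>Transfer to the algebra given by generators and relations\<close>

context lpa_presentation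
begin

abbreviation "Q \<equiv> leavitt_path_algebra K G"

definition embed :: "('v, 'e, 'k) lpa_free set \<Rightarrow> ('v, 'e, 'k) lpa_free endo" where
  "embed C = FQ.T (SOME x. x \<in> C)"

lemma embedding: "ring_embedding Q embed L"
  using FQ.quotient_algebra_embedding
  unfolding leavitt_path_algebra_def embed_def[abs_def] L_eq_image .

sublocale emb: ring_embedding Q embed L
  by (rule embedding)

lemma lpa_vertex_carrier: "v \<in> verts G \<Longrightarrow> lpa_vertex K G v \<in> carrier Q"
  unfolding lpa_vertex_def leavitt_path_algebra_def
  by (rule FQ.coset_carrier[OF letter_carrier[OF letters_mem(1)]])

lemma embed_vertex: "v \<in> verts G \<Longrightarrow> embed (lpa_vertex K G v) = Vx v"
  unfolding lpa_vertex_def embed_def Vx_def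
  by (rule FQ.T_coset[OF letter_carrier[OF letters_mem(1)]])

lemma lideal_iff: "lideal I \<longleftrightarrow> ideal_in L I"
  by (simp add: lideal_def ideal_in_def)

lemma two_sided_ideal_Q: "two_sided_ideal J Q \<longleftrightarrow> J \<subseteq> carrier Q \<and> lideal (embed ` J)"
  by (simp add: emb.two_sided_ideal_iff lideal_iff)

lemma embed_preimage: "I \<subseteq> L \<Longrightarrow> embed ` {C \<in> carrier Q. embed C \<in> I} = I"
  using emb.\<theta>_surj by (auto simp: subset_iff image_iff)

text \<open>The preimage of \<open>lspan P\<close> is an ideal containing the vertices of
  \<open>P\<close>, and \<open>lspan_least\<close> places it inside every other such ideal.\<close>

lemma vertex_ideal_eq:
  assumes P: "hereditary G P"
  shows "vertex_ideal K G P = {C \<in> carrier Q. embed C \<in> lspan P}"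
proof -
  let ?J = "{C \<in> carrier Q. embed C \<in> lspan P}"
  have Pv: "P \<subseteq> verts G" using hereditary_sub[OF P] .
  have "two_sided_ideal ?J Q"
  proof -
    have "lspan P \<subseteq> L" using lspan_mono[OF Pv] by blast
    from embed_preimage[OF this] show ?thesis unfolding two_sided_ideal_Q using lideal_lspan[OF P] by auto
  qed
  moreover have "lpa_vertex K G ` P \<subseteq> ?J"
    using Pv lpa_vertex_carrier embed_vertex V_lspan by auto
  ultimately have "vertex_ideal K G P \<subseteq> ?J"
    unfolding vertex_ideal_def generated_ideal_def by blast
  moreover have "?J \<subseteq> J" if J: "two_sided_ideal J Q" "lpa_vertex K G ` P \<subseteq> J" for J
  proof
    fix C assume C: "C \<in> ?J"
    have "Vx v \<in> embed ` J" if "v \<in> P" for v using J(2) embed_vertex Pv that by (metis image_eqI image_subset_iff subsetD)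
    then have "embed C \<in> embed ` J"
      using lspan_least[of "embed ` J" P "embed C"] J(1) C unfolding two_sided_ideal_Q by blast
    then obtain D where D: "D \<in> J" "embed C = embed D" by blast
    then have "D \<in> carrier Q" using J(1) unfolding two_sided_ideal_Q by blast
    then show "C \<in> J" using emb.\<theta>_inj[of C D] D C by simp
  qed
  ultimately show ?thesis unfolding vertex_ideal_def generated_ideal_def by blast
qed

lemma purely_infinite_vertex_ideal:
  assumes P: "hereditary G P" "saturated G P" "P \<subseteq> properly_infinite_vertices G" "P \<inter> breaking_vertices G = {}"
  shows "purely_infinite_ideal (vertex_ideal K G P) Q"
proof -
  let ?J = "vertex_ideal K G P"
  note Jeq = vertex_ideal_eq[OF P(1)]
  have img: "embed ` ?J = lspan P"
    unfolding Jeq using embed_preimage[of "lspan P"] lspan_mono[OF hereditary_sub[OF P(1)]] by blast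
  have J: "two_sided_ideal ?J Q" "?J \<subseteq> carrier Q"
    unfolding two_sided_ideal_Q img using lideal_lspan[OF P(1)] Jeq by auto
  have "ring_embedding (Q\<lparr>carrier := ?J\<rparr>) embed (embed ` ?J)"
    using J by (intro emb.restrict_embedding) (simp_all add: two_sided_ideal_Q lideal_iff)
  then interpret R: ring_embedding "Q\<lparr>carrier := ?J\<rparr>" embed "lspan P" unfolding img .
  let ?R = "Q\<lparr>carrier := ?J\<rparr>"
  have "purely_infinite_ring ?R"
  proof (rule purely_infinite_ring.intro[OF R.is_nonunital_ring], rule purely_infinite_ring_axioms.intro)
    fix J0 assume J0: "two_sided_ideal J0 ?R"
    show "\<not> is_division_ring (?R Quot J0)"
    proof
      assume D: "is_division_ring (?R Quot J0)"
      have I: "J0 \<subseteq> ?J" "ideal_in (lspan P) (embed ` J0)" using J0 unfolding R.two_sided_ideal_iff by auto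
      have inJ0: "X \<in> J0" if "X \<in> ?J" "embed X \<in> embed ` J0" for X
        using that I(1) R.\<theta>_inj by auto
      have "embed ` J0 \<noteq> lspan P"
      proof
        assume "embed ` J0 = lspan P"
        then have "?J \<subseteq> J0" using inJ0 img by blast
        then show False using R.division_ring_quotient_domain(1)[OF J0 D] I(1) by auto
      qed
      then obtain x y where xy: "x \<in> lspan P - embed ` J0" "y \<in> lspan P - embed ` J0" "x * y = 0"
        using zero_divisors_mod_ideal[OF P(1-3), of "embed ` J0"] I(2) unfolding ideal_in_def by blast
      then have "x \<in> embed ` ?J" "y \<in> embed ` ?J" unfolding img by auto
      then obtain X Y where XY: "X \<in> ?J" "embed X = x" "Y \<in> ?J" "embed Y = y" by (elim imageE) simp
      have c: "X \<otimes>\<^bsub>?R\<^esub> Y \<in> ?J" using R.mult_carrier[of X Y] XY by simp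
      have "embed (X \<otimes>\<^bsub>?R\<^esub> Y) = 0" using R.\<theta>_mult[of X Y] XY xy(3) by simp
      then have "X \<otimes>\<^bsub>?R\<^esub> Y \<in> J0" using inJ0[OF c] I(2) by (simp add: ideal_in_def)
      then have "X \<in> J0 \<or> Y \<in> J0" using R.division_ring_quotient_domain(2)[OF J0 D, of X Y] XY by simp
      then show False using XY xy by blast
    qed
  next
    fix a b assume a: "a \<in> carrier ?R" and b: "b \<in> principal_products ?R a"
    obtain n x y where b': "b \<in> carrier ?R" "\<forall>i<n. x i \<in> lspan P \<and> y i \<in> lspan P"
      "embed b = (\<Sum>i<(n::nat). x i * embed a * y i)" using R.principal_products_sum[OF a b] by blast
    obtain s t where st: "s \<in> lspan P" "t \<in> lspan P" "embed b = s * embed a * t"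
      using absorb_products[OF P R.\<theta>_mem[OF a], of n x y] b' by auto
    obtain X where X: "X \<in> carrier ?R" "embed X = s" using R.\<theta>_surj[OF st(1)] by blast
    obtain Y where Y: "Y \<in> carrier ?R" "embed Y = t" using R.\<theta>_surj[OF st(2)] by blast
    have "embed (X \<otimes>\<^bsub>?R\<^esub> a \<otimes>\<^bsub>?R\<^esub> Y) = embed b"
      using R.\<theta>_mult[OF R.mult_carrier[OF X(1) a] Y(1)] R.\<theta>_mult[OF X(1) a] X Y st(3) by simp
    then have "b = X \<otimes>\<^bsub>?R\<^esub> a \<otimes>\<^bsub>?R\<^esub> Y"
      using R.\<theta>_inj[OF b'(1) R.mult_carrier[OF R.mult_carrier[OF X(1) a] Y(1)]] by simp
    then show "\<exists>x\<in>carrier ?R. \<exists>y\<in>carrier ?R. b = x \<otimes>\<^bsub>?R\<^esub> a \<otimes>\<^bsub>?R\<^esub> y" using X Y by blast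
  qed
  then show ?thesis unfolding purely_infinite_ideal_def using J by blast
qed

lemma purely_infinite_ideal_subset:
  assumes "purely_infinite_ideal J Q"
  shows "J \<subseteq> vertex_ideal K G (P_ppi G)"
proof -
  have JQ: "J \<subseteq> carrier Q" "lideal (embed ` J)"
    using assms unfolding purely_infinite_ideal_def two_sided_ideal_Q by auto
  let ?R = "Q\<lparr>carrier := J\<rparr>"
  interpret R: ring_embedding ?R embed "embed ` J"
    using JQ by (intro emb.restrict_embedding) (simp_all add: lideal_iff)
  interpret PI: purely_infinite_ring ?R using assms unfolding purely_infinite_ideal_def by blast
  have "pi_ideal G (embed ` J)"
  proof (intro pi_ideal.intro pi_ideal_axioms.intro lpa_presentation_axioms JQ(2))
    fix a x y x' y' assume "a \<in> embed ` J" "x \<in> embed ` J" "y \<in> embed ` J" "x' \<in> embed ` J" "y' \<in> embed ` J"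
    then obtain A X Y X' Y' where c: "A \<in> carrier ?R" "X \<in> carrier ?R" "Y \<in> carrier ?R" "X' \<in> carrier ?R" "Y' \<in> carrier ?R"
      and v: "a = embed A" "x = embed X" "y = embed Y" "x' = embed X'" "y' = embed Y'" by auto
    let ?b = "X \<otimes>\<^bsub>?R\<^esub> A \<otimes>\<^bsub>?R\<^esub> Y \<oplus>\<^bsub>?R\<^esub> X' \<otimes>\<^bsub>?R\<^esub> A \<otimes>\<^bsub>?R\<^esub> Y'"
    obtain S T where ST: "S \<in> carrier ?R" "T \<in> carrier ?R" "?b = S \<otimes>\<^bsub>?R\<^esub> A \<otimes>\<^bsub>?R\<^esub> T"
      using PI.purely_infinite[OF c(1) R.two_products[OF c(2-5)]] by blast
    have m: "embed (B \<otimes>\<^bsub>?R\<^esub> A \<otimes>\<^bsub>?R\<^esub> C) = embed B * embed A * embed C" "B \<otimes>\<^bsub>?R\<^esub> A \<otimes>\<^bsub>?R\<^esub> C \<in> carrier ?R"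
      if "B \<in> carrier ?R" "C \<in> carrier ?R" for B C
      using R.\<theta>_mult[OF R.mult_carrier[OF that(1) c(1)] that(2)] R.\<theta>_mult[OF that(1) c(1)]
        R.mult_carrier[OF R.mult_carrier[OF that(1) c(1)] that(2)] by simp_all
    have "x * a * y + x' * a * y' = embed ?b"
      using R.\<theta>_add[OF m(2)[OF c(2,3)] m(2)[OF c(4,5)]] m(1)[OF c(2,3)] m(1)[OF c(4,5)] v by simp
    also have "\<dots> = embed S * a * embed T" unfolding ST(3) m(1)[OF ST(1,2)] v by simp
    finally show "\<exists>s\<in>embed ` J. \<exists>t\<in>embed ` J. x * a * y + x' * a * y' = s * a * t" using ST by auto
  next
    fix \<chi> :: "('v, 'e, 'k) lpa_free endo \<Rightarrow> 'k poly endo" and e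
    assume \<chi>: "\<And>x y. x \<in> embed ` J \<Longrightarrow> y \<in> embed ` J \<Longrightarrow> \<chi> (x + y) = \<chi> x + \<chi> y"
      "\<And>x y. x \<in> embed ` J \<Longrightarrow> y \<in> embed ` J \<Longrightarrow> \<chi> (x * y) = \<chi> x * \<chi> y"
      "e \<in> \<chi> ` embed ` J" "e \<noteq> 0" "\<And>s. s \<in> \<chi> ` embed ` J \<Longrightarrow> e * s = s \<and> s * e = s"
      "\<And>s. s \<in> \<chi> ` embed ` J \<Longrightarrow> s \<noteq> 0 \<Longrightarrow> \<exists>t\<in>\<chi> ` embed ` J. s * t = e \<and> t * s = e"
    have "\<exists>J0. two_sided_ideal J0 ?R \<and> is_division_ring (?R Quot J0)"
      by (rule R.division_ring_quotient[OF \<chi>])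
    then obtain J0 where J0: "two_sided_ideal J0 ?R" "is_division_ring (?R Quot J0)" by (elim exE conjE)
    from PI.no_division_ring_quotient[OF J0(1)] J0(2) show False by (rule notE)
  qed
  then interpret pi_ideal G K "embed ` J" .
  show ?thesis unfolding vertex_ideal_eq[OF hereditary_P_ppi]
  proof (intro subsetI CollectI conjI)
    fix C assume C: "C \<in> J"
    show "C \<in> carrier Q" by (rule subsetD[OF JQ(1) C])
    show "embed C \<in> lspan (P_ppi G)" by (rule subsetD[OF pi_ideal_subset imageI[OF C]])
  qed
qed

end

theorem theorem4p12:
  fixes E :: "('v, 'e) pre_digraph" and K :: "'k::field itself"
  assumes "wf_digraph E"
  shows "purely_infinite_ideal (vertex_ideal K E (P_ppi E)) (leavitt_path_algebra K E) \<and>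
    (\<forall>J. purely_infinite_ideal J (leavitt_path_algebra K E)
      \<longrightarrow> J \<subseteq> vertex_ideal K E (P_ppi E))"
proof -
  interpret lpa_presentation E K using assms by (rule lpa_presentation.intro)
  show ?thesis
    using purely_infinite_vertex_ideal[OF hereditary_P_ppi saturated_P_ppi P_ppi_sub]
      purely_infinite_ideal_subset by blast
qed

end
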